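(* Let $0<c<\infty$, and let $W$ be the $d_1d_2\times d_1d_2$ complex Wishart matrix with left partial transpose $W^{L}$, right partial transpose $W^{R}$ and full transpose $W^{\mathrm T}$, where $\frac{p}{d_1d_2}\to c$. (i) If $d_1\to\infty$ and $d_2$ is fixed, then the family $\{W,W^{R}\}$ is asymptotically free from the family $\{W^{\mathrm T},W^{L}\}$, but $W$ is not asymptotically free from $W^{R}$, nor is $W^{\mathrm T}$ asymptotically free from $W^{L}$. (ii) If $d_1$ is fixed and $d_2\to\infty$, then the family $\{W,W^{L}\}$ is asymptotically free from the family $\{W^{\mathrm T},W^{R}\}$, but $W$ is not asymptotically free from $W^{L}$, nor is $W^{\mathrm T}$ asymptotically free from $W^{R}$.
   Context: Complex Wishart matrix: let $G_1,\dots,G_{d_1}$ be $d_2\times p$ random matrices, $G_i=(g^{(i)}_{jk})_{jk}$, where all the $g^{(i)}_{jk}$ are independent complex Gaussian random variables with mean $0$ and $\mathrm E(|g^{(i)}_{jk}|^2)=1$. Put $W(i,j)=\frac1{d_2}G_iG_j^*$ (a $d_2\times d_2$ matrix) and $W=\frac1{d_1}(W(i,j))_{i,j=1}^{d_1}$, a $d_1\times d_1$ block matrix with $d_2\times d_2$ blocks. Define $W^{L}=\frac1{d_1}(W(j,i))_{ij}$ (left partial transpose), $W^{R}=\frac1{d_1}(W(i,j)^{\mathrm T})_{ij}$ (right partial transpose), $W^{\mathrm T}=\frac1{d_1}(W(j,i)^{\mathrm T})_{ij}$ (full transpose). Asymptotic freeness: let $\mathrm{tr}$ denote the normalized trace on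 $d_1d_2\times d_1d_2$ matrices. Two families of random matrices are asymptotically free from each other if all joint moments of their union with respect to $\mathrm E\circ\mathrm{tr}$ converge, so that there is a limit joint distribution in some non-commutative probability space, and the unital algebras generated by the limits of the two families are free in that space. *)

theory Defs
  imports
    "HOL-Probability.Probability"
    "HOL-Library.Poly_Mapping"
    "Jordan_Normal_Form.Schur_Decomposition"
begin

section \<open>Non-commutative probability spaces and freeness\<close>

locale nc_prob_space = vector_space scl
  for scl :: "complex \<Rightarrow> 'a::ring_1 \<Rightarrow> 'a" +
  fixes \<phi> :: "'a \<Rightarrow> complex"
  assumes scale_mult_left: "scl c (x * y) = scl c x * y"
    and scale_mult_right: "scl c (x * y) = x * scl c y"
    and linear_functional: "Vector_Spaces.linear scl (*) \<phi>"
    and unital: "\<phi> 1 = 1"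

inductive_set generated_algebra :: "(complex \<Rightarrow> 'a::ring_1 \<Rightarrow> 'a) \<Rightarrow> 'a set \<Rightarrow> 'a set"
  for scl :: "complex \<Rightarrow> 'a \<Rightarrow> 'a" and S :: "'a set" where
  one: "1 \<in> generated_algebra scl S"
| gen: "x \<in> S \<Longrightarrow> x \<in> generated_algebra scl S"
| add: "x \<in> generated_algebra scl S \<Longrightarrow> y \<in> generated_algebra scl S
    \<Longrightarrow> x + y \<in> generated_algebra scl S"
| mult: "x \<in> generated_algebra scl S \<Longrightarrow> y \<in> generated_algebra scl S
    \<Longrightarrow> x * y \<in> generated_algebra scl S"
| scale: "x \<in> generated_algebra scl S \<Longrightarrow> scl c x \<in> generated_algebra scl S"

text \<open>A family of unital subalgebras is free if \<open>\<phi>\<close> vanishes on every non-empty product of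
  centred elements such that neighbouring factors come from different subalgebras.\<close>

definition free_family :: "('a::ring_1 \<Rightarrow> complex) \<Rightarrow> 'k set \<Rightarrow> ('k \<Rightarrow> 'a set) \<Rightarrow> bool" where
  "free_family \<phi> K A \<longleftrightarrow>
    (\<forall>ks as. as \<noteq> [] \<and> set ks \<subseteq> K \<and> distinct_adj ks
        \<and> list_all2 (\<lambda>k a. a \<in> A k \<and> \<phi> a = 0) ks as
      \<longrightarrow> \<phi> (prod_list as) = 0)"

definition free_sets ::
  "(complex \<Rightarrow> 'a::ring_1 \<Rightarrow> 'a) \<Rightarrow> ('a \<Rightarrow> complex) \<Rightarrow> 'a set \<Rightarrow> 'a set \<Rightarrow> bool" where
  "free_sets scl \<phi> S T \<longleftrightarrow>
    free_family \<phi> (UNIV :: bool set)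
      (\<lambda>k. if k then generated_algebra scl S else generated_algebra scl T)"


section \<open>Non-commutative polynomials\<close>

datatype 'i free_monoid = Word (letters: "'i list")

instantiation free_monoid :: (type) monoid_add
begin
definition zero_free_monoid :: "'a free_monoid" where "zero_free_monoid = Word []"
definition plus_free_monoid :: "'a free_monoid \<Rightarrow> 'a free_monoid \<Rightarrow> 'a free_monoid"
  where "plus_free_monoid u v = Word (letters u @ letters v)"
instance
proof
  fix a b c :: "'a free_monoid"
  show "a + b + c = a + (b + c)" by (simp add: plus_free_monoid_def)
  show "0 + a = a" by (simp add: plus_free_monoid_def zero_free_monoid_def)
  show "a + 0 = a" by (simp add: plus_free_monoid_def zero_free_monoid_def)
qed
end

text \<open>The monoid algebra of the free monoid is the free unital complex algebra on \<open>'i\<close>.\<close>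

type_synonym 'i nc_poly = "'i free_monoid \<Rightarrow>\<^sub>0 complex"

definition ncp_scale :: "complex \<Rightarrow> 'i nc_poly \<Rightarrow> 'i nc_poly" where
  "ncp_scale c f = Poly_Mapping.single 0 c * f"

definition ncp_var :: "'i \<Rightarrow> 'i nc_poly" where
  "ncp_var i = Poly_Mapping.single (Word [i]) 1"


section \<open>Asymptotic freeness of random matrices\<close>

definition normalized_trace :: "complex mat \<Rightarrow> complex" where
  "normalized_trace A = (\<Sum>i<dim_row A. A $$ (i, i)) / of_nat (dim_row A)"

definition matrix_word :: "nat \<Rightarrow> ('i \<Rightarrow> complex mat) \<Rightarrow> 'i list \<Rightarrow> complex mat" where
  "matrix_word N X w = foldr (\<lambda>i A. X i * A) w (1\<^sub>m N)"

text \<open>In the following definitions \<open>X n i\<close> is a family of random \<open>N n \<times> N n\<close> matrices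
  on the probability space \<open>M n\<close>, indexed by \<open>i\<close>.\<close>

definition converges_in_distribution ::
  "(nat \<Rightarrow> 'w measure) \<Rightarrow> (nat \<Rightarrow> nat) \<Rightarrow> (nat \<Rightarrow> 'i \<Rightarrow> 'w \<Rightarrow> complex mat) \<Rightarrow> 'i set
    \<Rightarrow> ('a::ring_1 \<Rightarrow> complex) \<Rightarrow> ('i \<Rightarrow> 'a) \<Rightarrow> bool" where
  "converges_in_distribution M N X S \<phi> a \<longleftrightarrow>
    (\<forall>w \<in> lists S.
      (\<forall>\<^sub>F n in sequentially.
        integrable (M n) (\<lambda>\<omega>. normalized_trace (matrix_word (N n) (\<lambda>i. X n i \<omega>) w))) \<and>
      (\<lambda>n. \<integral>\<omega>. normalized_trace (matrix_word (N n) (\<lambda>i. X n i \<omega>) w) \<partial>M n)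
        \<longlonglongrightarrow> \<phi> (prod_list (map a w)))"

text \<open>The limit joint distribution is realized on the free algebra, the limits being the
  variables. By \<open>asymptotically_free_iff\<close> below, any other non-commutative probability
  space containing limits of the two families gives the same notion.\<close>

definition asymptotically_free ::
  "(nat \<Rightarrow> 'w measure) \<Rightarrow> (nat \<Rightarrow> nat) \<Rightarrow> (nat \<Rightarrow> 'i \<Rightarrow> 'w \<Rightarrow> complex mat)
    \<Rightarrow> 'i set \<Rightarrow> 'i set \<Rightarrow> bool" where
  "asymptotically_free M N X I J \<longleftrightarrow>
    (\<exists>\<phi> :: 'i nc_poly \<Rightarrow> complex. nc_prob_space ncp_scale \<phi> \<and>
      converges_in_distribution M N X (I \<union> J) \<phi> ncp_var \<and>
      free_sets ncp_scale \<phi> (ncp_var ` I) (ncp_var ` J))"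

lemma ncp_scale_eq_map: "ncp_scale c f = Poly_Mapping.map ((*) c) f"
  by (simp add: ncp_scale_def mult_map_scale_conv_mult)

lemma lookup_ncp_scale [simp]:
  "Poly_Mapping.lookup (ncp_scale c f) w = c * Poly_Mapping.lookup f w"
  by (simp add: ncp_scale_eq_map Poly_Mapping.map.rep_eq when_def)

lemma ncp_scale_single [simp]: "ncp_scale c (Poly_Mapping.single w d) = Poly_Mapping.single w (c * d)"
  by (simp add: ncp_scale_def mult_single)

lemma ncp_induct [case_names single add]:
  assumes "\<And>w c. P (Poly_Mapping.single w c)" and "\<And>f g. P f \<Longrightarrow> P g \<Longrightarrow> P (f + g)"
  shows "P (f :: 'i nc_poly)"
proof (induction f rule: update_induct)
  case const
  show ?case using assms(1)[of 0 0] by simp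
next
  case (update f w c)
  have "Poly_Mapping.update w c f = f + Poly_Mapping.single w c"
    using update(1) by (intro poly_mapping_eqI)
      (auto simp: lookup_add lookup_single lookup_update in_keys_iff when_def)
  then show ?case using assms update by simp
qed

lemma vector_space_ncp_scale: "vector_space (ncp_scale :: complex \<Rightarrow> 'i nc_poly \<Rightarrow> _)"
  by unfold_locales (auto intro!: poly_mapping_eqI simp: lookup_add algebra_simps)

lemma ncp_scale_mult_left: "ncp_scale c (f * g) = ncp_scale c f * g"
  by (simp add: ncp_scale_def mult.assoc)

lemma ncp_scale_mult_right: "ncp_scale c (f * g) = f * ncp_scale c g"
proof -
  have "Poly_Mapping.single 0 c * f = f * Poly_Mapping.single 0 c"
    by (induction f rule: ncp_induct) (simp_all add: mult_single algebra_simps)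
  then show ?thesis by (simp add: ncp_scale_def flip: mult.assoc)
qed

lemma prod_list_ncp_var: "prod_list (map ncp_var w) = Poly_Mapping.single (Word w) 1"
  by (induction w)
    (simp_all add: ncp_var_def mult_single plus_free_monoid_def flip: single_one zero_free_monoid_def)

context nc_prob_space
begin

definition ncp_eval :: "('i \<Rightarrow> 'a) \<Rightarrow> 'i nc_poly \<Rightarrow> 'a" where
  "ncp_eval a f = (\<Sum>w\<in>Poly_Mapping.keys f. scl (Poly_Mapping.lookup f w) (prod_list (map a (letters w))))"

lemma phi_hom: "\<phi> (x + y) = \<phi> x + \<phi> y" "\<phi> (scl c x) = c * \<phi> x"
proof -
  interpret L: Vector_Spaces.linear scl "(*)" \<phi> by (rule linear_functional)
  show "\<phi> (x + y) = \<phi> x + \<phi> y" "\<phi> (scl c x) = c * \<phi> x" by (rule L.add L.scale)+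
qed

lemma ncp_eval_single [simp]:
  "ncp_eval a (Poly_Mapping.single w c) = scl c (prod_list (map a (letters w)))"
  by (simp add: ncp_eval_def)

lemma ncp_eval_add: "ncp_eval a (f + g) = ncp_eval a f + ncp_eval a g"
  unfolding ncp_eval_def by (rule setsum_keys_plus_distrib) (simp_all add: scale_left_distrib)

lemma ncp_eval_mult: "ncp_eval a (f * g) = ncp_eval a f * ncp_eval a g"
proof (induction f rule: ncp_induct)
  case (single w c)
  show ?case
  proof (induction g rule: ncp_induct)
    case (single v d)
    show ?case
      by (simp add: mult_single plus_free_monoid_def flip: scale_mult_left scale_mult_right)
  qed (simp add: algebra_simps ncp_eval_add)
qed (simp add: algebra_simps ncp_eval_add)

lemma ncp_eval_one [simp]: "ncp_eval a 1 = 1"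
  by (simp flip: single_one add: zero_free_monoid_def)

lemma ncp_eval_scale: "ncp_eval a (ncp_scale c f) = scl c (ncp_eval a f)"
  by (induction f rule: ncp_induct)
    (simp_all add: ncp_eval_add scale_right_distrib
      vector_space.vector_space_assms(1)[OF vector_space_ncp_scale])

lemma ncp_eval_var [simp]: "ncp_eval a (ncp_var i) = a i"
  by (simp add: ncp_var_def)

lemma ncp_eval_prod_list: "ncp_eval a (prod_list fs) = prod_list (map (ncp_eval a) fs)"
  by (induction fs) (simp_all add: ncp_eval_mult)

lemma nc_prob_space_ncp_eval: "nc_prob_space ncp_scale (\<lambda>f :: 'i nc_poly. \<phi> (ncp_eval a f))"
proof -
  interpret P: vector_space "ncp_scale :: complex \<Rightarrow> 'i nc_poly \<Rightarrow> _"
    by (rule vector_space_ncp_scale)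
  show ?thesis
    by unfold_locales
      (auto simp: ncp_scale_mult_left [symmetric] ncp_scale_mult_right [symmetric] phi_hom
        ncp_eval_add ncp_eval_scale unital algebra_simps)
qed

lemma generated_algebra_eval:
  "generated_algebra scl (a ` S) = ncp_eval a ` generated_algebra ncp_scale (ncp_var ` S)"
proof (intro equalityI subsetI)
  fix x assume "x \<in> generated_algebra scl (a ` S)"
  then show "x \<in> ncp_eval a ` generated_algebra ncp_scale (ncp_var ` S)"
  proof induction
    case one
    show ?case by (rule image_eqI[of _ _ 1]) (auto intro: generated_algebra.one)
  next
    case (gen x)
    then obtain i where "i \<in> S" "x = a i" by auto
    then show ?case by (intro image_eqI[of _ _ "ncp_var i"]) (auto intro: generated_algebra.gen)
  next
    case (add x y)
    then show ?case by (auto simp flip: ncp_eval_add intro!: imageI generated_algebra.add)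
  next
    case (mult x y)
    then show ?case by (auto simp flip: ncp_eval_mult intro!: imageI generated_algebra.mult)
  next
    case (scale x c)
    then show ?case by (auto simp flip: ncp_eval_scale intro!: imageI generated_algebra.scale)
  qed
next
  fix x assume "x \<in> ncp_eval a ` generated_algebra ncp_scale (ncp_var ` S)"
  then obtain f where "f \<in> generated_algebra ncp_scale (ncp_var ` S)" "x = ncp_eval a f" by blast
  from this(1) show "x \<in> generated_algebra scl (a ` S)" unfolding \<open>x = _\<close>
    by induction
      (auto simp: ncp_eval_add ncp_eval_mult ncp_eval_scale intro: generated_algebra.intros)
qed

end

lemma generated_algebra_mono:
  assumes "S \<subseteq> T" "x \<in> generated_algebra scl S"
  shows "x \<in> generated_algebra scl T"
  using assms(2)
proof induction
  case (gen x)
  then show ?case using assms(1) by (intro generated_algebra.gen) blast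
qed (simp_all add: generated_algebra.intros)

lemma generated_algebra_prod_list:
  "set xs \<subseteq> generated_algebra scl S \<Longrightarrow> prod_list xs \<in> generated_algebra scl S"
  by (induction xs) (simp_all add: generated_algebra.one generated_algebra.mult)

lemma keys_generated_ncp:
  assumes "f \<in> generated_algebra ncp_scale (ncp_var ` S)"
  shows "Poly_Mapping.keys f \<subseteq> Word ` lists S"
  using assms
proof induction
  case one
  show ?case by (simp add: zero_free_monoid_def)
next
  case (gen f)
  then obtain i where "i \<in> S" "f = ncp_var i" by blast
  then show ?case by (simp add: ncp_var_def)
next
  case (add f g)
  then show ?case using keys_add[of f g] by blast
next
  case (mult f g)
  show ?case
  proof
    fix w assume "w \<in> Poly_Mapping.keys (f * g)"
    then obtain u v where "w = u + v" "u \<in> Poly_Mapping.keys f" "v \<in> Poly_Mapping.keys g"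
      using keys_mult[of f g] by blast
    with mult obtain x y where "w = Word x + Word y" "x \<in> lists S" "y \<in> lists S" by blast
    then show "w \<in> Word ` lists S" by (simp add: plus_free_monoid_def image_iff)
  qed
next
  case (scale f c)
  show ?case
  proof
    fix w assume "w \<in> Poly_Mapping.keys (ncp_scale c f)"
    then have "Poly_Mapping.lookup f w \<noteq> 0" unfolding in_keys_iff by simp
    then show "w \<in> Word ` lists S" using scale by (auto simp only: in_keys_iff)
  qed
qed

context nc_prob_space
begin

lemma functional_unique:
  fixes \<psi> :: "'i nc_poly \<Rightarrow> complex"
  assumes psi: "nc_prob_space ncp_scale \<psi>"
    and moments: "\<And>w. w \<in> lists S \<Longrightarrow> \<psi> (prod_list (map ncp_var w)) = \<phi> (prod_list (map a w))"
    and f: "f \<in> generated_algebra ncp_scale (ncp_var ` S)"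
  shows "\<psi> f = \<phi> (ncp_eval a f)"
proof -
  interpret Psi: nc_prob_space ncp_scale \<psi> by (rule psi)
  interpret L: Vector_Spaces.linear scl "(*)" \<phi> by (rule linear_functional)
  interpret LP: Vector_Spaces.linear ncp_scale "(*)" \<psi> by (rule Psi.linear_functional)
  have "\<psi> f = \<psi> (\<Sum>w\<in>Poly_Mapping.keys f. ncp_scale (Poly_Mapping.lookup f w) (Poly_Mapping.single w 1))"
    by (rule arg_cong[of _ _ \<psi>], rule poly_mapping_eqI)
      (simp add: lookup_sum lookup_single when_def not_in_keys_iff_lookup_eq_zero)
  also have "\<dots> = (\<Sum>w\<in>Poly_Mapping.keys f. Poly_Mapping.lookup f w * \<psi> (Poly_Mapping.single w 1))"
    by (simp add: LP.sum LP.scale del: ncp_scale_single)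
  also have "\<dots> = (\<Sum>w\<in>Poly_Mapping.keys f. Poly_Mapping.lookup f w * \<phi> (prod_list (map a (letters w))))"
  proof (rule sum.cong[OF refl])
    fix w assume "w \<in> Poly_Mapping.keys f"
    then obtain v where "w = Word v" "v \<in> lists S" using keys_generated_ncp[OF f] by blast
    then show "Poly_Mapping.lookup f w * \<psi> (Poly_Mapping.single w 1)
        = Poly_Mapping.lookup f w * \<phi> (prod_list (map a (letters w)))"
      using moments[of v] by (simp add: prod_list_ncp_var)
  qed
  also have "\<dots> = \<phi> (ncp_eval a f)"
    by (simp add: ncp_eval_def L.sum L.scale)
  finally show ?thesis .
qed

lemma free_sets_ncp_iff:
  fixes \<psi> :: "'i nc_poly \<Rightarrow> complex"
  assumes agree: "\<And>f. f \<in> generated_algebra ncp_scale (ncp_var ` (I \<union> J)) \<Longrightarrow> \<psi> f = \<phi> (ncp_eval a f)"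
  shows "free_sets ncp_scale \<psi> (ncp_var ` I) (ncp_var ` J) \<longleftrightarrow> free_sets scl \<phi> (a ` I) (a ` J)"
proof -
  define F where "F k = generated_algebra ncp_scale (ncp_var ` (if k then I else J))" for k
  define A where "A k = generated_algebra scl (a ` (if k then I else J))" for k
  have A: "A k = ncp_eval a ` F k" for k
    unfolding A_def F_def by (rule generated_algebra_eval)
  have F: "f \<in> generated_algebra ncp_scale (ncp_var ` (I \<union> J))" if "f \<in> F k" for f k
    using that unfolding F_def by (rule generated_algebra_mono[rotated]) auto
  have "free_family \<psi> UNIV F \<longleftrightarrow> free_family \<phi> UNIV A"
  proof
    assume free: "free_family \<psi> UNIV F"
    show "free_family \<phi> UNIV A" unfolding free_family_def
    proof (intro allI impI, elim conjE)
      fix ks as assume as: "as \<noteq> []" "distinct_adj ks"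
        and all: "list_all2 (\<lambda>k x. x \<in> A k \<and> \<phi> x = 0) ks as"
      from all have "\<exists>fs. list_all2 (\<lambda>k f. f \<in> F k \<and> \<psi> f = 0) ks fs \<and> map (ncp_eval a) fs = as"
      proof (induction rule: list_all2_induct)
        case Nil
        show ?case by simp
      next
        case (Cons k ks x xs)
        then obtain fs where fs: "list_all2 (\<lambda>k f. f \<in> F k \<and> \<psi> f = 0) ks fs"
          "map (ncp_eval a) fs = xs" by blast
        from Cons obtain f where "f \<in> F k" "x = ncp_eval a f" "\<phi> x = 0" unfolding A by blast
        then show ?case using fs agree[OF F] by (intro exI[of _ "f # fs"]) auto
      qed
      then obtain fs where fs: "list_all2 (\<lambda>k f. f \<in> F k \<and> \<psi> f = 0) ks fs"
        "map (ncp_eval a) fs = as" by blast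
      have "set fs \<subseteq> generated_algebra ncp_scale (ncp_var ` (I \<union> J))"
        using fs(1) F by (auto simp: list_all2_conv_all_nth set_conv_nth)
      then have "\<phi> (prod_list as) = \<psi> (prod_list fs)"
        by (simp add: agree generated_algebra_prod_list ncp_eval_prod_list fs(2))
      also have "\<dots> = 0"
        using free as fs unfolding free_family_def by auto
      finally show "\<phi> (prod_list as) = 0" .
    qed
  next
    assume free: "free_family \<phi> UNIV A"
    show "free_family \<psi> UNIV F" unfolding free_family_def
    proof (intro allI impI, elim conjE)
      fix ks fs assume fs: "fs \<noteq> []" "distinct_adj ks"
        and all: "list_all2 (\<lambda>k f. f \<in> F k \<and> \<psi> f = 0) ks fs"
      have "list_all2 (\<lambda>k x. x \<in> A k \<and> \<phi> x = 0) ks (map (ncp_eval a) fs)"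
        unfolding list_all2_map2 using all
        by (rule list_all2_mono) (use agree[OF F] in \<open>auto simp: A\<close>)
      then have "\<phi> (prod_list (map (ncp_eval a) fs)) = 0"
        using free fs unfolding free_family_def by auto
      moreover have "set fs \<subseteq> generated_algebra ncp_scale (ncp_var ` (I \<union> J))"
        using all F by (auto simp: list_all2_conv_all_nth set_conv_nth)
      ultimately show "\<psi> (prod_list fs) = 0"
        by (simp add: agree generated_algebra_prod_list ncp_eval_prod_list)
    qed
  qed
  moreover have "F = (\<lambda>k. if k then generated_algebra ncp_scale (ncp_var ` I)
      else generated_algebra ncp_scale (ncp_var ` J))"
    by (rule ext) (simp add: F_def)
  moreover have "A = (\<lambda>k. if k then generated_algebra scl (a ` I) else generated_algebra scl (a ` J))"
    by (rule ext) (simp add: A_def)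
  ultimately show ?thesis by (simp only: free_sets_def)
qed

end

theorem asymptotically_free_iff:
  assumes space: "nc_prob_space scl \<phi>"
    and conv: "converges_in_distribution M N X (I \<union> J) \<phi> a"
  shows "asymptotically_free M N X I J \<longleftrightarrow> free_sets scl \<phi> (a ` I) (a ` J)"
proof -
  interpret nc_prob_space scl \<phi> by (rule space)
  show ?thesis
  proof
    assume "asymptotically_free M N X I J"
    then obtain \<psi> where psi: "nc_prob_space ncp_scale \<psi>"
      "converges_in_distribution M N X (I \<union> J) \<psi> ncp_var"
      "free_sets ncp_scale \<psi> (ncp_var ` I) (ncp_var ` J)"
      unfolding asymptotically_free_def by blast
    have "\<psi> (prod_list (map ncp_var w)) = \<phi> (prod_list (map a w))" if "w \<in> lists (I \<union> J)" for w
      using conv psi(2) that unfolding converges_in_distribution_def by (blast intro: LIMSEQ_unique)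
    then show "free_sets scl \<phi> (a ` I) (a ` J)"
      using free_sets_ncp_iff functional_unique[OF psi(1)] psi(3) by blast
  next
    assume free: "free_sets scl \<phi> (a ` I) (a ` J)"
    have "converges_in_distribution M N X (I \<union> J) (\<lambda>f. \<phi> (ncp_eval a f)) ncp_var"
      using conv by (simp add: converges_in_distribution_def ncp_eval_prod_list o_def)
    moreover have "free_sets ncp_scale (\<lambda>f. \<phi> (ncp_eval a f)) (ncp_var ` I) (ncp_var ` J)"
      using free by (subst free_sets_ncp_iff) auto
    ultimately show "asymptotically_free M N X I J"
      unfolding asymptotically_free_def using nc_prob_space_ncp_eval by blast
  qed
qed


section \<open>Wishart matrices and their partial transposes\<close>

text \<open>The circular complex Gaussian distribution: independent real and imaginary parts
  of variance \<open>1/2\<close>, hence \<open>E (|X|\<^sup>2) = 1\<close>.\<close>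

definition standard_complex_gaussian :: "'w measure \<Rightarrow> ('w \<Rightarrow> complex) \<Rightarrow> bool" where
  "standard_complex_gaussian M X \<longleftrightarrow>
    prob_space.indep_var M borel (\<lambda>\<omega>. Re (X \<omega>)) borel (\<lambda>\<omega>. Im (X \<omega>)) \<and>
    distributed M lborel (\<lambda>\<omega>. Re (X \<omega>)) (normal_density 0 (1 / sqrt 2)) \<and>
    distributed M lborel (\<lambda>\<omega>. Im (X \<omega>)) (normal_density 0 (1 / sqrt 2))"

lemma (in prob_space) standard_complex_gaussian_moments:
  assumes "standard_complex_gaussian M X"
  shows "expectation X = 0" "expectation (\<lambda>\<omega>. (cmod (X \<omega>))\<^sup>2) = 1"
proof -
  let ?d = "normal_density 0 (1 / sqrt 2)"
  have parts: "integrable M Y" "integrable M (\<lambda>\<omega>. (Y \<omega>)\<^sup>2)"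
      "expectation Y = 0" "expectation (\<lambda>\<omega>. (Y \<omega>)\<^sup>2) = 1 / 2"
    if Y: "distributed M lborel Y ?d" for Y :: "'a \<Rightarrow> real"
  proof -
    have int: "integrable M (\<lambda>\<omega>. Y \<omega> ^ k)" for k
    proof -
      have "integrable lborel (\<lambda>x. ?d x * x ^ k)"
        using integrable_normal_moment[of "1 / sqrt 2" 0 k] by simp
      then show ?thesis
        using distributed_integrable[OF Y, of "\<lambda>x. x ^ k"] by simp
    qed
    show "integrable M Y" "integrable M (\<lambda>\<omega>. (Y \<omega>)\<^sup>2)" using int[of 1] int[of 2] by simp_all
    show mean: "expectation Y = 0"
      by (rule normal_distributed_expectation[OF _ Y]) simp
    show "expectation (\<lambda>\<omega>. (Y \<omega>)\<^sup>2) = 1 / 2"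
      using normal_distributed_variance[OF _ Y] by (simp add: mean power_divide)
  qed
  have re: "distributed M lborel (\<lambda>\<omega>. Re (X \<omega>)) ?d"
    and im: "distributed M lborel (\<lambda>\<omega>. Im (X \<omega>)) ?d"
    using assms unfolding standard_complex_gaussian_def by blast+
  have "expectation (\<lambda>\<omega>. complex_of_real (Re (X \<omega>)) + \<i> * complex_of_real (Im (X \<omega>))) =
      expectation (\<lambda>\<omega>. complex_of_real (Re (X \<omega>)))
        + expectation (\<lambda>\<omega>. \<i> * complex_of_real (Im (X \<omega>)))"
    using parts(1)[OF re] parts(1)[OF im]
    by (intro Bochner_Integration.integral_add integrable_mult_right integrable_of_real)
  also have "\<dots> = 0"
    by (simp only: integral_mult_right_zero integral_complex_of_real parts(3)[OF re] parts(3)[OF im]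
      of_real_0 mult_zero_right add_0_left)
  finally show "expectation X = 0"
    by (simp only: complex_eq[symmetric])
  have "expectation (\<lambda>\<omega>. (Re (X \<omega>))\<^sup>2 + (Im (X \<omega>))\<^sup>2) =
      expectation (\<lambda>\<omega>. (Re (X \<omega>))\<^sup>2) + expectation (\<lambda>\<omega>. (Im (X \<omega>))\<^sup>2)"
    using parts(2)[OF re] parts(2)[OF im] by (rule Bochner_Integration.integral_add)
  then show "expectation (\<lambda>\<omega>. (cmod (X \<omega>))\<^sup>2) = 1"
    by (simp add: cmod_power2 parts(4)[OF re] parts(4)[OF im])
qed

definition independent_gaussian_entries ::
  "'w measure \<Rightarrow> nat \<Rightarrow> nat \<Rightarrow> nat \<Rightarrow> (nat \<Rightarrow> nat \<Rightarrow> nat \<Rightarrow> 'w \<Rightarrow> complex) \<Rightarrow> bool" where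
  "independent_gaussian_entries M d\<^sub>1 d\<^sub>2 p g \<longleftrightarrow>
    prob_space M \<and>
    prob_space.indep_vars M (\<lambda>_. borel) (\<lambda>(i, j, k). g i j k) ({..<d\<^sub>1} \<times> {..<d\<^sub>2} \<times> {..<p}) \<and>
    (\<forall>i<d\<^sub>1. \<forall>j<d\<^sub>2. \<forall>k<p. standard_complex_gaussian M (g i j k))"

text \<open>Below, \<open>z i j k\<close> is the \<open>(j, k)\<close> entry of the \<open>i\<close>-th \<open>d\<^sub>2 \<times> p\<close> matrix; all indices
  start at \<open>0\<close>.\<close>

definition wishart_block ::
  "nat \<Rightarrow> nat \<Rightarrow> (nat \<Rightarrow> nat \<Rightarrow> nat \<Rightarrow> complex) \<Rightarrow> nat \<Rightarrow> nat \<Rightarrow> complex mat" where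
  "wishart_block d\<^sub>2 p z i j =
    (let G = (\<lambda>i. mat d\<^sub>2 p (\<lambda>(j, k). z i j k))
     in (1 / of_nat d\<^sub>2) \<cdot>\<^sub>m (G i * mat_adjoint (G j)))"

definition block_matrix :: "nat \<Rightarrow> nat \<Rightarrow> (nat \<Rightarrow> nat \<Rightarrow> 'a mat) \<Rightarrow> 'a mat" where
  "block_matrix d\<^sub>1 d\<^sub>2 B =
    mat (d\<^sub>1 * d\<^sub>2) (d\<^sub>1 * d\<^sub>2) (\<lambda>(r, s). B (r div d\<^sub>2) (s div d\<^sub>2) $$ (r mod d\<^sub>2, s mod d\<^sub>2))"

datatype transposition = NoT | LeftT | RightT | FullT

fun wishart ::
  "nat \<Rightarrow> nat \<Rightarrow> nat \<Rightarrow> (nat \<Rightarrow> nat \<Rightarrow> nat \<Rightarrow> complex) \<Rightarrow> transposition \<Rightarrow> complex mat" where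
  "wishart d\<^sub>1 d\<^sub>2 p z NoT =
    (1 / of_nat d\<^sub>1) \<cdot>\<^sub>m block_matrix d\<^sub>1 d\<^sub>2 (\<lambda>i j. wishart_block d\<^sub>2 p z i j)"
| "wishart d\<^sub>1 d\<^sub>2 p z LeftT =
    (1 / of_nat d\<^sub>1) \<cdot>\<^sub>m block_matrix d\<^sub>1 d\<^sub>2 (\<lambda>i j. wishart_block d\<^sub>2 p z j i)"
| "wishart d\<^sub>1 d\<^sub>2 p z RightT =
    (1 / of_nat d\<^sub>1) \<cdot>\<^sub>m block_matrix d\<^sub>1 d\<^sub>2 (\<lambda>i j. transpose_mat (wishart_block d\<^sub>2 p z i j))"
| "wishart d\<^sub>1 d\<^sub>2 p z FullT =
    (1 / of_nat d\<^sub>1) \<cdot>\<^sub>m block_matrix d\<^sub>1 d\<^sub>2 (\<lambda>i j. transpose_mat (wishart_block d\<^sub>2 p z j i))"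

end

theory Submission
  imports Defs
begin

text \<open>Gaussian integration by parts turns the expectation of a product of traces of words in the
  blocks into a sum over the partners of the first letter (the loop equation). As \<open>d \<rightarrow> \<infinity>\<close> only
  contractions of two letters of the same kind within one trace survive, and they split the trace;
  hence traces factorize asymptotically, and in the limit a letter is never contracted with a transposed one.
  Summing over the small indices gives a moment recursion for \<open>W\<close> and its partial transposes in
  which the letters contracted with each other have the same colour (transposed or not in the large
  factor). Applied to a centred alternating product, each term of this recursion contains the limit
  of a shorter centred alternating product, so that all of them vanish: this is freeness of the two
  colours. Within one colour, \<open>\<phi>(W W') = c\<^sup>2 + c / D\<close> for the small-factor transpose \<open>W'\<close> of \<open>W\<close>,
  which excludes freeness.\<close>

section \<open>Gaussian integration by parts\<close>

text \<open>The loop equation does not close on single traces, because a contraction across two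
  traces merges them; so it is set up for products of traces. Every contraction carries
  \<open>1 / (d * D)\<close>, and its weight for large \<open>d\<close> is decided by the number of
  traces it leaves, which is why \<open>F\<close> is normalized by one power of \<open>d\<close> per
  trace. A second obstacle is that the recursion leaves the algebra generated by the variables: what
  remains of two contracted letters is a new letter, whose small indices no longer fit those of its
  neighbours in the word. The sum over the small indices is thus not a sum of moments of shorter
  words. What matters is only how the two indices of such a letter are paired with the two ends of
  the word beside it, and this takes the three coefficients \<open>\<kappa>\<close>. The induction
  for freeness must therefore treat \<open>\<kappa>\<close> along with \<open>\<phi>\<close>, and
  since a contraction cuts a centred factor in two, it must admit uncentred pieces on both sides of
  a centred product.\<close>

fun gauss_moment :: "nat \<Rightarrow> real" where
  "gauss_moment 0 = 1"
| "gauss_moment (Suc 0) = 0"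
| "gauss_moment (Suc (Suc n)) = real (Suc n) / 2 * gauss_moment n"

text \<open>One-dimensional integration by parts for the normal law of variance 1/2, in the form
  needed by \<open>gaussian_parts_cmono\<close>. For \<open>n = 0\<close> the truncated
  \<open>n - 1\<close> is harmless, since its coefficient vanishes; \<open>cmono_diff\<close> relies
  on the same convention.\<close>

lemma gauss_moment_Suc: "gauss_moment (Suc n) = real n / 2 * gauss_moment (n - 1)"
  by (cases n) simp_all

lemma gauss_moment_odd: "odd n \<Longrightarrow> gauss_moment n = 0"
  by (induction n rule: gauss_moment.induct) auto

lemma gauss_moment_even: "gauss_moment (2 * k) = fact (2 * k) / (4 ^ k * fact k)"
proof (induction k)
  case (Suc k)
  have "gauss_moment (2 * Suc k) = real (2 * k + 1) / 2 * (fact (2 * k) / (4 ^ k * fact k))"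
    using Suc by (simp add: gauss_moment.simps(3))
  also have "\<dots> = (real (2 * k + 2) * real (2 * k + 1) * fact (2 * k)) / (4 ^ Suc k * (real (Suc k) * fact k))"
    by (simp add: divide_simps)
  also have "\<dots> = fact (2 * Suc k) / (4 ^ Suc k * fact (Suc k))"
    by (simp add: algebra_simps)
  finally show ?case .
qed simp

lemma has_bochner_integral_normal_power:
  "has_bochner_integral lborel (\<lambda>x. normal_density 0 (1 / sqrt 2) x * x ^ k) (gauss_moment k)"
proof (cases "even k")
  case True
  then obtain m where "k = 2 * m" by (elim evenE)
  then show ?thesis
    using normal_moment_even[of "1 / sqrt 2" 0 m] gauss_moment_even[of m]
    by (simp add: power_divide)
next
  case False
  then obtain m where "k = 2 * m + 1" by (elim oddE)
  then show ?thesis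
    using normal_moment_odd[of "1 / sqrt 2" 0 m] gauss_moment_odd[of k] False
    by simp
qed

lemma (in prob_space) normal_power:
  assumes "distributed M lborel Y (normal_density 0 (1 / sqrt 2))"
  shows "integrable M (\<lambda>\<omega>. Y \<omega> ^ k)" "expectation (\<lambda>\<omega>. Y \<omega> ^ k) = gauss_moment k"
  using distributed_integrable[OF assms, of "\<lambda>x. x ^ k"] distributed_integral[OF assms, of "\<lambda>x. x ^ k"]
    has_bochner_integral_normal_power[of k]
  by (auto simp: has_bochner_integral_iff)

section \<open>Joint moments of independent complex Gaussian variables\<close>

definition cmono :: "'x set \<Rightarrow> ('x \<Rightarrow> nat) \<Rightarrow> ('x \<Rightarrow> nat) \<Rightarrow> ('x \<Rightarrow> complex) \<Rightarrow> complex" where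
  "cmono K \<alpha> \<beta> z = (\<Prod>x\<in>K. of_real (Re (z x) ^ \<alpha> x * Im (z x) ^ \<beta> x))"

text \<open>Independence enters the later arguments only through these mixed moments, which
  factorize in real and imaginary parts. Keeping nothing else makes it easy to rename or conjugate
  the coordinates.\<close>

definition gaussian_config :: "'w measure \<Rightarrow> 'x set \<Rightarrow> ('x \<Rightarrow> 'w \<Rightarrow> complex) \<Rightarrow> bool" where
  "gaussian_config M K Z \<longleftrightarrow> finite K \<and> prob_space M \<and>
    (\<forall>\<alpha> \<beta>. has_bochner_integral M (\<lambda>\<omega>. cmono K \<alpha> \<beta> (\<lambda>x. Z x \<omega>))
      (of_real (\<Prod>x\<in>K. gauss_moment (\<alpha> x) * gauss_moment (\<beta> x))))"

lemma (in prob_space) gaussian_configI: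
  assumes fin: "finite K"
    and ind: "indep_vars (\<lambda>_. borel) Z K"
    and gauss: "\<And>x. x \<in> K \<Longrightarrow> standard_complex_gaussian M (Z x)"
  shows "gaussian_config M K Z"
  unfolding gaussian_config_def
proof (intro conjI allI)
  show "finite K" by (rule fin)
  show "prob_space M" by unfold_locales
  fix \<alpha> \<beta> :: "'b \<Rightarrow> nat"
  let ?Y = "\<lambda>x \<omega>. Re (Z x \<omega>) ^ \<alpha> x * Im (Z x \<omega>) ^ \<beta> x"
  have ind': "indep_vars (\<lambda>_. borel) ?Y K"
    by (rule indep_vars_compose2[OF ind, of "\<lambda>x z. Re z ^ \<alpha> x * Im z ^ \<beta> x"]) simp
  have one: "integrable M (?Y x)" "expectation (?Y x) = gauss_moment (\<alpha> x) * gauss_moment (\<beta> x)"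
    if "x \<in> K" for x
  proof -
    note g = gauss[OF that, unfolded standard_complex_gaussian_def]
    have iv: "indep_var borel (\<lambda>\<omega>. Re (Z x \<omega>) ^ \<alpha> x) borel (\<lambda>\<omega>. Im (Z x \<omega>) ^ \<beta> x)"
      using indep_var_compose[of borel "\<lambda>\<omega>. Re (Z x \<omega>)" borel "\<lambda>\<omega>. Im (Z x \<omega>)" "\<lambda>r. r ^ \<alpha> x" borel
          "\<lambda>r. r ^ \<beta> x" borel] g
      by (simp add: o_def)
    have int: "integrable M (\<lambda>\<omega>. Re (Z x \<omega>) ^ \<alpha> x)" "integrable M (\<lambda>\<omega>. Im (Z x \<omega>) ^ \<beta> x)"
      using g by (auto intro: normal_power)
    show "integrable M (?Y x)" by (rule indep_var_integrable[OF iv int])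
    show "expectation (?Y x) = gauss_moment (\<alpha> x) * gauss_moment (\<beta> x)"
      using indep_var_lebesgue_integral[OF iv int] g by (simp add: normal_power)
  qed
  have "has_bochner_integral M (\<lambda>\<omega>. \<Prod>x\<in>K. ?Y x \<omega>)
      (\<Prod>x\<in>K. gauss_moment (\<alpha> x) * gauss_moment (\<beta> x))"
    using indep_vars_integrable[OF fin ind'] indep_vars_lebesgue_integral[OF fin ind'] one
    by (simp add: has_bochner_integral_iff)
  then show "has_bochner_integral M (\<lambda>\<omega>. cmono K \<alpha> \<beta> (\<lambda>x. Z x \<omega>))
      (of_real (\<Prod>x\<in>K. gauss_moment (\<alpha> x) * gauss_moment (\<beta> x)))"
    unfolding cmono_def of_real_prod[symmetric] by (rule has_bochner_integral_of_real)
qed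

text \<open>Serves to exchange the roles of the two tensor factors when the second one
  grows.\<close>

lemma gaussian_config_reindex:
  assumes "gaussian_config M K Z" "bij_betw f K' K"
  shows "gaussian_config M K' (\<lambda>x. Z (f x))"
proof -
  have fin: "finite K'" using assms by (simp add: gaussian_config_def bij_betw_finite)
  have *: "(\<Prod>x\<in>K'. h x) = (\<Prod>y\<in>K. h (inv_into K' f y))" for h :: "_ \<Rightarrow> 'd :: comm_monoid_mult"
    using prod.reindex_bij_betw[OF assms(2), of "\<lambda>y. h (inv_into K' f y)"]
    by (simp add: inv_into_f_f[OF bij_betw_imp_inj_on[OF assms(2)]])
  have f: "f (inv_into K' f y) = y" if "y \<in> K" for y
    using assms(2) that by (auto simp: bij_betw_def f_inv_into_f)
  have "cmono K' \<alpha> \<beta> (\<lambda>x. Z (f x) \<omega>)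
      = cmono K (\<lambda>y. \<alpha> (inv_into K' f y)) (\<lambda>y. \<beta> (inv_into K' f y)) (\<lambda>y. Z y \<omega>)" for \<alpha> \<beta> \<omega>
    unfolding cmono_def * by (rule prod.cong) (simp_all add: f)
  then show ?thesis
    using assms(1) fin unfolding gaussian_config_def * by auto
qed

text \<open>Derivatives are Wirtinger derivatives with respect to the conjugate of the coordinate \<open>x\<close>;
  \<open>cpoly K P D\<close> says that \<open>P\<close> is a polynomial in the coordinates from \<open>K\<close> and their
  conjugates, with derivatives \<open>D\<close>.\<close>

definition cmono_diff ::
  "'x set \<Rightarrow> ('x \<Rightarrow> nat) \<Rightarrow> ('x \<Rightarrow> nat) \<Rightarrow> 'x \<Rightarrow> ('x \<Rightarrow> complex) \<Rightarrow> complex" where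
  "cmono_diff K \<alpha> \<beta> x z = (of_nat (\<alpha> x) * cmono K (\<alpha>(x := \<alpha> x - 1)) \<beta> z
    + \<i> * of_nat (\<beta> x) * cmono K \<alpha> (\<beta>(x := \<beta> x - 1)) z) / 2"

inductive cpoly ::
  "'x set \<Rightarrow> (('x \<Rightarrow> complex) \<Rightarrow> complex) \<Rightarrow> ('x \<Rightarrow> ('x \<Rightarrow> complex) \<Rightarrow> complex) \<Rightarrow> bool"
  for K :: "'x set" where
  mono: "cpoly K (\<lambda>z. c * cmono K \<alpha> \<beta> z) (\<lambda>x z. c * cmono_diff K \<alpha> \<beta> x z)"
| add: "cpoly K P D \<Longrightarrow> cpoly K Q E \<Longrightarrow> cpoly K (\<lambda>z. P z + Q z) (\<lambda>x z. D x z + E x z)"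

section \<open>Calculus of polynomials in the coordinates and their conjugates\<close>

lemma cmono_add:
  "cmono K (\<lambda>y. \<alpha> y + \<alpha>' y) (\<lambda>y. \<beta> y + \<beta>' y) z = cmono K \<alpha> \<beta> z * cmono K \<alpha>' \<beta>' z"
  unfolding cmono_def prod.distrib[symmetric] by (simp add: power_add algebra_simps)

lemma cmono_diff_add:
  "cmono_diff K (\<lambda>y. \<alpha> y + \<alpha>' y) (\<lambda>y. \<beta> y + \<beta>' y) x z
    = cmono_diff K \<alpha> \<beta> x z * cmono K \<alpha>' \<beta>' z + cmono K \<alpha> \<beta> z * cmono_diff K \<alpha>' \<beta>' x z"
proof -
  \<comment> \<open>Lowering the total exponent means lowering the first summand only if that is
    positive; if it is 0, the coefficient makes both sides vanish.\<close>
  have left: "of_nat (\<gamma> x) * h ((\<lambda>y. \<gamma> y + \<gamma>' y)(x := \<gamma> x + \<gamma>' x - 1))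
      = of_nat (\<gamma> x) * h (\<lambda>y. (\<gamma>(x := \<gamma> x - 1)) y + \<gamma>' y)"
    for \<gamma> \<gamma>' :: "'a \<Rightarrow> nat" and h :: "_ \<Rightarrow> complex"
  proof (cases "\<gamma> x = 0")
    case False
    then have "(\<lambda>y. \<gamma> y + \<gamma>' y)(x := \<gamma> x + \<gamma>' x - 1) = (\<lambda>y. (\<gamma>(x := \<gamma> x - 1)) y + \<gamma>' y)"
      by (auto simp: fun_eq_iff)
    then show ?thesis by simp
  qed simp
  have right: "of_nat (\<gamma>' x) * h ((\<lambda>y. \<gamma> y + \<gamma>' y)(x := \<gamma> x + \<gamma>' x - 1))
      = of_nat (\<gamma>' x) * h (\<lambda>y. \<gamma> y + (\<gamma>'(x := \<gamma>' x - 1)) y)"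
    for \<gamma> \<gamma>' :: "'a \<Rightarrow> nat" and h :: "_ \<Rightarrow> complex"
    using left[of \<gamma>' h \<gamma>] by (simp add: add.commute)
  show ?thesis
    unfolding cmono_diff_def of_nat_add distrib_right distrib_left
    using left[of \<alpha> "\<lambda>\<gamma>. cmono K \<gamma> (\<lambda>y. \<beta> y + \<beta>' y) z" \<alpha>'] right[of \<alpha>' "\<lambda>\<gamma>. cmono K \<gamma> (\<lambda>y. \<beta> y + \<beta>' y) z" \<alpha>]
      left[of \<beta> "\<lambda>\<gamma>. cmono K (\<lambda>y. \<alpha> y + \<alpha>' y) \<gamma> z" \<beta>'] right[of \<beta>' "\<lambda>\<gamma>. cmono K (\<lambda>y. \<alpha> y + \<alpha>' y) \<gamma> z" \<beta>]
    unfolding cmono_add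
    by (simp only: mult.assoc) (simp add: field_simps del: fun_upd_apply One_nat_def)
qed

lemma cpoly_mult:
  assumes "cpoly K P D" "cpoly K Q E"
  shows "cpoly K (\<lambda>z. P z * Q z) (\<lambda>x z. D x z * Q z + P z * E x z)"
  using assms(1)
proof induction
  case (mono c \<alpha> \<beta>)
  from assms(2) show ?case
  proof induction
    case (mono c' \<alpha>' \<beta>')
    show ?case
      using cpoly.mono[of K "c * c'" "\<lambda>y. \<alpha> y + \<alpha>' y" "\<lambda>y. \<beta> y + \<beta>' y"]
      by (simp add: cmono_add cmono_diff_add algebra_simps)
  next
    case (add P D Q E)
    show ?case using cpoly.add[OF add.IH] by (simp add: algebra_simps)
  qed
next
  case (add P1 D1 P2 D2)
  show ?case using cpoly.add[OF add.IH] by (simp add: algebra_simps)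
qed

lemma cpoly_const: "cpoly K (\<lambda>z. c) (\<lambda>x z. 0)"
  using cpoly.mono[of K c "\<lambda>_. 0" "\<lambda>_. 0"] by (simp add: cmono_def cmono_diff_def)

lemma cpoly_cong:
  "cpoly K P D \<Longrightarrow> (\<And>z. P z = P' z) \<Longrightarrow> (\<And>x z. D x z = D' x z) \<Longrightarrow> cpoly K P' D'"
  by (metis ext)

lemma cpoly_scale: "cpoly K P D \<Longrightarrow> cpoly K (\<lambda>z. c * P z) (\<lambda>x z. c * D x z)"
  using cpoly_mult[OF cpoly_const[of K c]] by fastforce

lemma cpoly_sum:
  "finite A \<Longrightarrow> (\<And>i. i \<in> A \<Longrightarrow> cpoly K (P i) (D i)) \<Longrightarrow>
    cpoly K (\<lambda>z. \<Sum>i\<in>A. P i z) (\<lambda>x z. \<Sum>i\<in>A. D i x z)"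
  by (induction A rule: finite_induct) (simp_all add: cpoly_const cpoly.add)

lemma cmono_unit:
  assumes "finite K" "y \<in> K"
  shows "cmono K ((\<lambda>_. 0)(y := 1)) (\<lambda>_. 0) z = of_real (Re (z y))"
    and "cmono K (\<lambda>_. 0) ((\<lambda>_. 0)(y := 1)) z = of_real (Im (z y))"
  unfolding cmono_def using assms by (simp_all add: prod.remove)

lemma cmono_zero: "cmono K (\<lambda>_. 0) (\<lambda>_. 0) z = 1"
  by (simp add: cmono_def)

lemma cpoly_Re:
  assumes "finite K" "y \<in> K"
  shows "cpoly K (\<lambda>z. of_real (Re (z y))) (\<lambda>x z. of_bool (x = y) / 2)"
proof -
  have "((\<lambda>_. 0)(y := 1))(y := 0) = (\<lambda>_. 0 :: nat)" by auto
  then have "cmono_diff K ((\<lambda>_. 0)(y := 1)) (\<lambda>_. 0) x z = of_bool (x = y) / 2" for x z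
    by (simp add: cmono_diff_def cmono_zero)
  then show ?thesis
    by (intro cpoly_cong[OF cpoly.mono[of K 1 "(\<lambda>_. 0)(y := 1)" "\<lambda>_. 0"]])
      (simp_all only: mult_1_left cmono_unit[OF assms])
qed

lemma cpoly_Im:
  assumes "finite K" "y \<in> K"
  shows "cpoly K (\<lambda>z. of_real (Im (z y))) (\<lambda>x z. \<i> * of_bool (x = y) / 2)"
proof -
  have "((\<lambda>_. 0)(y := 1))(y := 0) = (\<lambda>_. 0 :: nat)" by auto
  then have "cmono_diff K (\<lambda>_. 0) ((\<lambda>_. 0)(y := 1)) x z = \<i> * of_bool (x = y) / 2" for x z
    by (simp add: cmono_diff_def cmono_zero)
  then show ?thesis
    by (intro cpoly_cong[OF cpoly.mono[of K 1 "\<lambda>_. 0" "(\<lambda>_. 0)(y := 1)"]])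
      (simp_all only: mult_1_left cmono_unit[OF assms])
qed

text \<open>The two halves cancel because the coordinate is holomorphic. Hence differentiating a
  letter only sees its conjugated factor.\<close>

lemma cpoly_var:
  assumes "finite K" "y \<in> K"
  shows "cpoly K (\<lambda>z. z y) (\<lambda>x z. 0)"
proof -
  have "cpoly K (\<lambda>z. of_real (Re (z y)) + \<i> * of_real (Im (z y)))
      (\<lambda>x z. of_bool (x = y) / 2 + \<i> * (\<i> * of_bool (x = y) / 2))"
    by (intro cpoly.add cpoly_scale cpoly_Re cpoly_Im assms)
  moreover have "(\<lambda>z. of_real (Re (z y)) + \<i> * of_real (Im (z y))) = (\<lambda>z. z y)"
    by (simp flip: complex_eq)
  moreover have "of_bool (x = y) / 2 + \<i> * (\<i> * of_bool (x = y) / 2) = (0 :: complex)" for x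
    by (simp add: field_simps)
  ultimately show ?thesis by (simp only:)
qed

lemma cpoly_cnj:
  assumes "finite K" "y \<in> K"
  shows "cpoly K (\<lambda>z. cnj (z y)) (\<lambda>x z. of_bool (x = y))"
proof -
  have "cpoly K (\<lambda>z. of_real (Re (z y)) + (- \<i>) * of_real (Im (z y)))
      (\<lambda>x z. of_bool (x = y) / 2 + (- \<i>) * (\<i> * of_bool (x = y) / 2))"
    by (intro cpoly.add cpoly_scale cpoly_Re cpoly_Im assms)
  moreover have "(\<lambda>z. of_real (Re (z y)) + (- \<i>) * of_real (Im (z y))) = (\<lambda>z. cnj (z y))"
    by (simp add: fun_eq_iff complex_eq_iff)
  moreover have "of_bool (x = y) / 2 + (- \<i>) * (\<i> * of_bool (x = y) / 2) = (of_bool (x = y) :: complex)" for x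
    by simp
  ultimately show ?thesis by (simp only:)
qed

section \<open>Integrability and integration by parts\<close>

lemma cpoly_integrable:
  assumes "gaussian_config M K Z" "cpoly K P D"
  shows "integrable M (\<lambda>\<omega>. P (\<lambda>x. Z x \<omega>))"
  using assms(2)
proof induction
  case (mono c \<alpha> \<beta>)
  then show ?case using assms(1) by (auto simp: gaussian_config_def has_bochner_integral_iff)
qed simp

lemma integrable_cmono_diff:
  assumes "gaussian_config M K Z"
  shows "integrable M (\<lambda>\<omega>. cmono_diff K \<alpha> \<beta> x (\<lambda>x. Z x \<omega>))"
  using assms unfolding cmono_diff_def by (auto simp: gaussian_config_def has_bochner_integral_iff)

lemma cpoly_diff_integrable:
  assumes "gaussian_config M K Z" "cpoly K P D"
  shows "integrable M (\<lambda>\<omega>. D x (\<lambda>x. Z x \<omega>))"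
  using assms(2) by induction (simp_all add: integrable_cmono_diff[OF assms(1)])

lemma cmono_mult_Re:
  assumes "finite K" "x \<in> K"
  shows "of_real (Re (z x)) * cmono K \<alpha> \<beta> z = cmono K (\<alpha>(x := Suc (\<alpha> x))) \<beta> z"
proof -
  have "(\<Prod>y\<in>K - {x}. complex_of_real (Re (z y) ^ (\<alpha>(x := Suc (\<alpha> x))) y * Im (z y) ^ \<beta> y))
      = (\<Prod>y\<in>K - {x}. of_real (Re (z y) ^ \<alpha> y * Im (z y) ^ \<beta> y))"
    by (rule prod.cong) auto
  then show ?thesis unfolding cmono_def prod.remove[OF assms] by simp
qed

lemma cmono_mult_Im:
  assumes "finite K" "x \<in> K"
  shows "of_real (Im (z x)) * cmono K \<alpha> \<beta> z = cmono K \<alpha> (\<beta>(x := Suc (\<beta> x))) z"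
proof -
  have "(\<Prod>y\<in>K - {x}. complex_of_real (Re (z y) ^ \<alpha> y * Im (z y) ^ (\<beta>(x := Suc (\<beta> x))) y))
      = (\<Prod>y\<in>K - {x}. of_real (Re (z y) ^ \<alpha> y * Im (z y) ^ \<beta> y))"
    by (rule prod.cong) auto
  then show ?thesis unfolding cmono_def prod.remove[OF assms] by simp
qed

lemma cmono_mult_var:
  assumes "finite K" "x \<in> K"
  shows "z x * cmono K \<alpha> \<beta> z
    = cmono K (\<alpha>(x := Suc (\<alpha> x))) \<beta> z + \<i> * cmono K \<alpha> (\<beta>(x := Suc (\<beta> x))) z"
  unfolding cmono_mult_Re[OF assms, symmetric] cmono_mult_Im[OF assms, symmetric]
  by (subst (1) complex_eq) (simp add: algebra_simps)

text \<open>The other coordinates contribute a common factor, so this is the one-variable recursion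
  for the real and the imaginary part of \<open>Z x\<close>. The Wirtinger factor 1/2 agrees with
  their variance, whence no further constant appears.\<close>

lemma gaussian_parts_cmono:
  fixes K :: "'x set"
  assumes G: "gaussian_config M K Z" and x: "x \<in> K"
  shows "(\<integral>\<omega>. Z x \<omega> * cmono K \<alpha> \<beta> (\<lambda>x. Z x \<omega>) \<partial>M) = (\<integral>\<omega>. cmono_diff K \<alpha> \<beta> x (\<lambda>x. Z x \<omega>) \<partial>M)"
proof -
  have fin: "finite K" using G by (simp add: gaussian_config_def)
  define m where "m \<alpha> \<beta> = (\<Prod>x\<in>K. gauss_moment (\<alpha> x) * gauss_moment (\<beta> x))" for \<alpha> \<beta>
  have int: "integrable M (\<lambda>\<omega>. cmono K \<alpha> \<beta> (\<lambda>x. Z x \<omega>))"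
    "(\<integral>\<omega>. cmono K \<alpha> \<beta> (\<lambda>x. Z x \<omega>) \<partial>M) = of_real (m \<alpha> \<beta>)" for \<alpha> \<beta>
    using G by (auto simp: gaussian_config_def has_bochner_integral_iff m_def)
  have m: "m \<alpha> \<beta> = gauss_moment (\<alpha> x) * gauss_moment (\<beta> x)
      * (\<Prod>x\<in>K - {x}. gauss_moment (\<alpha> x) * gauss_moment (\<beta> x))" for \<alpha> \<beta>
    unfolding m_def by (rule prod.remove[OF fin x])
  have cong: "(\<Prod>y\<in>K - {x}. gauss_moment ((\<alpha>(x := a)) y) * gauss_moment ((\<beta>(x := b)) y))
    = (\<Prod>y\<in>K - {x}. gauss_moment (\<alpha> y) * gauss_moment (\<beta> y))" for a b and \<alpha> \<beta> :: "'x \<Rightarrow> nat"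
    by (rule prod.cong) auto
  have 1: "m (\<alpha>(x := Suc (\<alpha> x))) \<beta> = real (\<alpha> x) / 2 * m (\<alpha>(x := \<alpha> x - 1)) \<beta>"
    using cong[of \<alpha> _ \<beta> "\<beta> x"] by (simp add: m gauss_moment_Suc)
  have 2: "m \<alpha> (\<beta>(x := Suc (\<beta> x))) = real (\<beta> x) / 2 * m \<alpha> (\<beta>(x := \<beta> x - 1))"
    using cong[of \<alpha> "\<alpha> x" \<beta>] by (simp add: m gauss_moment_Suc)
  show ?thesis
    unfolding cmono_mult_var[where z = "\<lambda>x. Z x _", OF fin x] cmono_diff_def
    by (simp add: int 1 2 algebra_simps add_divide_distrib)
qed

lemma cpoly_times_var_integrable:
  assumes G: "gaussian_config M K Z" and x: "x \<in> K" and P: "cpoly K P D"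
  shows "integrable M (\<lambda>\<omega>. Z x \<omega> * P (\<lambda>x. Z x \<omega>))"
proof -
  have "finite K" using G by (simp add: gaussian_config_def)
  from cpoly_integrable[OF G cpoly_mult[OF cpoly_var[OF this x] P]] show ?thesis .
qed

theorem gaussian_parts:
  assumes G: "gaussian_config M K Z" and x: "x \<in> K" and P: "cpoly K P D"
  shows "(\<integral>\<omega>. Z x \<omega> * P (\<lambda>x. Z x \<omega>) \<partial>M) = (\<integral>\<omega>. D x (\<lambda>x. Z x \<omega>) \<partial>M)"
  using P
proof induction
  case (mono c \<alpha> \<beta>)
  then show ?case using gaussian_parts_cmono[OF G x, of \<alpha> \<beta>]
    by (simp only: mult.left_commute[of _ c] integral_mult_right_zero)
next
  case (add P D Q E)
  then show ?case
    using cpoly_diff_integrable[OF G] cpoly_times_var_integrable[OF G x]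
    by (simp add: distrib_left)
qed

text \<open>A monomial can change its sign under conjugation only if some imaginary part has an odd
  exponent, and then its moment is 0. Because of this symmetry the loop equation is needed only for
  words that start with an unconjugated letter.\<close>

theorem gaussian_cnj:
  fixes K :: "'x set"
  assumes G: "gaussian_config M K Z" and P: "cpoly K P D"
  shows "(\<integral>\<omega>. P (\<lambda>x. cnj (Z x \<omega>)) \<partial>M) = (\<integral>\<omega>. P (\<lambda>x. Z x \<omega>) \<partial>M)"
proof -
  have fin: "finite K" using G by (simp add: gaussian_config_def)
  have "gaussian_config M K (\<lambda>x \<omega>. cnj (Z x \<omega>))"
    unfolding gaussian_config_def
  proof (intro conjI allI)
    show "finite K" by (rule fin)
    show "prob_space M" using G by (simp add: gaussian_config_def)
    fix \<alpha> \<beta> :: "'x \<Rightarrow> nat"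
    have flip: "cmono K \<alpha> \<beta> (\<lambda>x. cnj (Z x \<omega>)) = (\<Prod>x\<in>K. (-1) ^ \<beta> x) * cmono K \<alpha> \<beta> (\<lambda>x. Z x \<omega>)" for \<omega>
      unfolding cmono_def prod.distrib[symmetric]
      by (rule prod.cong[OF refl]) (simp add: power_minus[of "Im _"])
    have sign: "complex_of_real (\<Prod>x\<in>K. gauss_moment (\<alpha> x) * gauss_moment (\<beta> x))
        = (\<Prod>x\<in>K. (-1) ^ \<beta> x) * of_real (\<Prod>x\<in>K. gauss_moment (\<alpha> x) * gauss_moment (\<beta> x))"
      unfolding of_real_prod prod.distrib[symmetric]
      by (rule prod.cong[OF refl]) (use gauss_moment_odd in \<open>auto simp: minus_one_power_iff\<close>)
    have "has_bochner_integral M (\<lambda>\<omega>. (\<Prod>x\<in>K. (-1) ^ \<beta> x) * cmono K \<alpha> \<beta> (\<lambda>x. Z x \<omega>))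
        ((\<Prod>x\<in>K. (-1) ^ \<beta> x) * of_real (\<Prod>x\<in>K. gauss_moment (\<alpha> x) * gauss_moment (\<beta> x)))"
      using G by (intro has_bochner_integral_mult_right) (auto simp: gaussian_config_def)
    then show "has_bochner_integral M (\<lambda>\<omega>. cmono K \<alpha> \<beta> (\<lambda>x. cnj (Z x \<omega>)))
        (of_real (\<Prod>x\<in>K. gauss_moment (\<alpha> x) * gauss_moment (\<beta> x)))"
      by (simp only: flip sign[symmetric])
  qed
  note G' = this
  show "(\<integral>\<omega>. P (\<lambda>x. cnj (Z x \<omega>)) \<partial>M) = (\<integral>\<omega>. P (\<lambda>x. Z x \<omega>) \<partial>M)"
    using P
  proof induction
    case (mono c \<alpha> \<beta>)
    then show ?case using G G' by (simp add: gaussian_config_def has_bochner_integral_iff)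
  next
    case (add P D Q E)
    then show ?case
      using cpoly_integrable[OF G] cpoly_integrable[OF G'] by simp
  qed
qed

section \<open>The loop equation\<close>

text \<open>The Wishart matrix is split into blocks labelled by the indices of the tensor factor of fixed
  dimension \<open>D\<close>, which are \<open>d \<times> d\<close> matrices with \<open>d \<rightarrow> \<infinity>\<close>. A letter \<open>(s, e, e')\<close> stands for
  the block \<open>G\<^sub>e G\<^sub>e\<^sub>'\<^sup>* / N\<close> if \<open>s\<close> holds, and otherwise for its entrywise conjugate, which is the
  transpose of the block \<open>(e', e)\<close>. All partial transposes are made of such blocks.\<close>

type_synonym letter = "bool \<times> nat \<times> nat"
type_synonym config = "nat \<times> nat \<times> nat \<Rightarrow> complex"

definition transp :: "letter \<Rightarrow> letter" where "transp = (\<lambda>(s, e, e'). (\<not> s, e', e))"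
definition conj_letter :: "letter \<Rightarrow> letter" where "conj_letter = (\<lambda>(s, e, e'). (\<not> s, e, e'))"

definition valid_word :: "nat \<Rightarrow> letter list \<Rightarrow> bool" where
  "valid_word D w \<longleftrightarrow> list_all (\<lambda>(s, e, e'). e < D \<and> e' < D) w"

lemma valid_word_simps [simp]:
  "valid_word D []" "valid_word D ((s, e, e') # w) \<longleftrightarrow> e < D \<and> e' < D \<and> valid_word D w"
  "valid_word D (u @ v) \<longleftrightarrow> valid_word D u \<and> valid_word D v"
  "valid_word D (rev w) \<longleftrightarrow> valid_word D w" "valid_word D (map transp w) \<longleftrightarrow> valid_word D w" "valid_word D (map conj_letter w) \<longleftrightarrow> valid_word D w"
  by (auto simp: valid_word_def transp_def conj_letter_def list.pred_map o_def case_prod_unfold conj_commute)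

lemma valid_word_take [simp]: "valid_word D w \<Longrightarrow> valid_word D (take l w)"
  and valid_word_drop [simp]: "valid_word D w \<Longrightarrow> valid_word D (drop l w)"
  by (auto simp: valid_word_def list_all_iff dest!: in_set_takeD in_set_dropD)

lemma valid_word_nth: "valid_word D w \<Longrightarrow> l < length w \<Longrightarrow> w ! l = (s, e, e') \<Longrightarrow> e < D \<and> e' < D"
  unfolding valid_word_def list_all_length by (metis (mono_tags, lifting) case_prodD)

text \<open>The unconjugated factor of the first letter, with small index \<open>b\<close>, is
  contracted with the conjugated factor of another letter; this factor carries the second index if
  \<open>s\<close> holds and the first one otherwise.\<close>

definition matches :: "nat \<Rightarrow> letter \<Rightarrow> bool" where
  "matches b = (\<lambda>(s, f, f'). b = (if s then f' else f))"

text \<open>What a contraction of the first letter with \<open>(s, f, f')\<close>, standing between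
  \<open>u\<close> and \<open>v\<close>, leaves of the trace. The uncontracted halves join to a new
  letter ending in \<open>b'\<close>. For equal kinds the word \<open>v\<close> closes up to a trace
  of its own; for opposite kinds the trace stays in one piece and \<open>v\<close> is passed
  backwards, hence transposed and reversed.\<close>

definition self_words :: "nat \<Rightarrow> letter \<Rightarrow> letter list \<Rightarrow> letter list \<Rightarrow> letter list list" where
  "self_words b' = (\<lambda>(s, f, f') u v.
    if s then [v, (True, f, b') # u] else [(True, f', b') # u @ rev (map transp v)])"

text \<open>The analogue for a letter of another trace, which gets merged with the first one;
  \<open>v\<close> is that trace read cyclically from behind the contracted letter.\<close>

definition cross_word :: "nat \<Rightarrow> letter list \<Rightarrow> letter \<Rightarrow> letter list \<Rightarrow> letter list" where
  "cross_word b' w = (\<lambda>(s, f, f') v.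
    if s then (True, f, b') # w @ v else (True, f', b') # w @ rev (map transp v))"

lemma valid_self_words:
  assumes "valid_word D w" "l < length w" "b' < D"
  shows "list_all (valid_word D) (self_words b' (w ! l) (take l w) (drop (Suc l) w))"
  using assms valid_word_nth[OF assms(1,2)] by (cases "w ! l") (auto simp: self_words_def)

lemma valid_cross_word:
  assumes "valid_word D w" "valid_word D v" "l < length v" "b' < D"
  shows "valid_word D (cross_word b' w (v ! l) (drop (Suc l) v @ take l v))"
  using assms valid_word_nth[OF assms(2,3)] by (cases "v ! l") (auto simp: cross_word_def)

lemma sum_of_bool_mult:
  "a < (d :: nat) \<Longrightarrow> (\<Sum>b<d. of_bool (a = b) * (f b :: complex)) = f a"
  "a < (d :: nat) \<Longrightarrow> (\<Sum>b<d. of_bool (b = a) * (f b :: complex)) = f a"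
  "a < (d :: nat) \<Longrightarrow> (\<Sum>b<d. f b * of_bool (a = b)) = (f a :: complex)"
  "a < (d :: nat) \<Longrightarrow> (\<Sum>b<d. f b * of_bool (b = a)) = (f a :: complex)"
  by (simp_all add: of_bool_def if_distrib if_distribR mult.commute[of _ "if _ then _ else _"] cong: if_cong)

section \<open>Entries and traces of words in the blocks\<close>

locale label_matrices =
  fixes d N p :: nat
begin

declare sum_of_bool_mult [simp]

definition lmat :: "config \<Rightarrow> letter \<Rightarrow> nat \<Rightarrow> nat \<Rightarrow> complex" where
  "lmat z = (\<lambda>(s, e, e') a a'.
    (\<Sum>k<p. if s then z (a, e, k) * cnj (z (a', e', k)) else cnj (z (a, e, k)) * z (a', e', k)) / of_nat N)"

fun lent :: "config \<Rightarrow> letter list \<Rightarrow> nat \<Rightarrow> nat \<Rightarrow> complex" where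
  "lent z [] a a' = of_bool (a = a')"
| "lent z (l # w) a a' = (\<Sum>b<d. lmat z l a b * lent z w b a')"

definition ltrace :: "config \<Rightarrow> letter list \<Rightarrow> complex" where
  "ltrace z w = (\<Sum>a<d. lent z w a a)"

definition ltraces :: "config \<Rightarrow> letter list list \<Rightarrow> complex" where
  "ltraces z ws = prod_list (map (ltrace z) ws)"

lemma ltraces_simps [simp]: "ltraces z [] = 1" "ltraces z (w # ws) = ltrace z w * ltraces z ws"
  by (simp_all add: ltraces_def)

lemma lent_append:
  "a < d \<Longrightarrow> lent z (u @ v) a a' = (\<Sum>b<d. lent z u a b * lent z v b a')"
proof (induction u arbitrary: a)
  case (Cons l u)
  have "lent z ((l # u) @ v) a a' = (\<Sum>b<d. \<Sum>c<d. lmat z l a b * (lent z u b c * lent z v c a'))"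
    using Cons.IH by (simp add: sum_distrib_left)
  also have "\<dots> = (\<Sum>c<d. lent z (l # u) a c * lent z v c a')"
    by (subst sum.swap) (simp add: sum_distrib_right mult.assoc)
  finally show ?case .
qed simp

lemma lmat_transp: "lmat z (transp l) a a' = lmat z l a' a"
  by (cases l) (auto simp: lmat_def transp_def mult.commute intro!: arg_cong2[of _ _ _ _ "(/)"] sum.cong)

lemma lent_transp:
  "a < d \<Longrightarrow> a' < d \<Longrightarrow> lent z (rev (map transp w)) a a' = lent z w a' a"
proof (induction w arbitrary: a a')
  case (Cons l w)
  have "lent z (rev (map transp (l # w))) a a' = (\<Sum>b<d. lent z (rev (map transp w)) a b * lmat z l a' b)"
    using Cons.prems by (simp add: lent_append lmat_transp)
  also have "\<dots> = lent z (l # w) a' a"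
    using Cons by (simp add: mult.commute)
  finally show ?case .
qed auto

lemma lmat_conj: "lmat (\<lambda>x. cnj (z x)) l a a' = lmat z (conj_letter l) a a'"
proof -
  obtain s e e' where "l = (s, e, e')" by (cases l)
  then show ?thesis by (cases s) (simp_all add: lmat_def conj_letter_def)
qed

lemma lent_conj: "lent (\<lambda>x. cnj (z x)) w a a' = lent z (map conj_letter w) a a'"
  by (induction w arbitrary: a) (simp_all add: lmat_conj)

lemma ltraces_conj: "ltraces (\<lambda>x. cnj (z x)) ws = ltraces z (map (map conj_letter) ws)"
  by (induction ws) (simp_all add: ltrace_def lent_conj)

definition ldiff :: "config \<Rightarrow> nat \<times> nat \<times> nat \<Rightarrow> letter \<Rightarrow> nat \<Rightarrow> nat \<Rightarrow> complex" where
  "ldiff z x = (\<lambda>(s, e, e') a a'.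
    (\<Sum>k<p. if s then z (a, e, k) * of_bool (x = (a', e', k)) else of_bool (x = (a, e, k)) * z (a', e', k))
      / of_nat N)"

text \<open>Written out over the position of the differentiated letter, with the words before and
  after it kept whole: these are the pieces from which the contracted words are put
  together.\<close>

definition letdiff :: "config \<Rightarrow> nat \<times> nat \<times> nat \<Rightarrow> letter list \<Rightarrow> nat \<Rightarrow> nat \<Rightarrow> complex" where
  "letdiff z x w a a' = (\<Sum>l<length w. \<Sum>\<alpha><d. \<Sum>\<alpha>'<d.
    lent z (take l w) a \<alpha> * ldiff z x (w ! l) \<alpha> \<alpha>' * lent z (drop (Suc l) w) \<alpha>' a')"

definition lsdiff :: "config \<Rightarrow> nat \<times> nat \<times> nat \<Rightarrow> letter list list \<Rightarrow> complex" where
  "lsdiff z x ws = (\<Sum>j<length ws. (\<Sum>a<d. letdiff z x (ws ! j) a a) * ltraces z (take j ws @ drop (Suc j) ws))"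

lemma letdiff_Nil: "letdiff z x [] a a' = 0"
  by (simp add: letdiff_def)

lemma letdiff_Cons:
  assumes "a < d"
  shows "letdiff z x (l # w) a a' = (\<Sum>b<d. ldiff z x l a b * lent z w b a' + lmat z l a b * letdiff z x w b a')"
proof -
  have "(\<Sum>\<alpha><d. \<Sum>\<alpha>'<d. lent z (l # take i w) a \<alpha> * ldiff z x (w ! i) \<alpha> \<alpha>' * lent z (drop (Suc i) w) \<alpha>' a')
      = (\<Sum>b<d. lmat z l a b * (\<Sum>\<alpha><d. \<Sum>\<alpha>'<d. lent z (take i w) b \<alpha> * ldiff z x (w ! i) \<alpha> \<alpha>' * lent z (drop (Suc i) w) \<alpha>' a'))"
    (is "?l i = ?r i") for i
  proof -
    have "?l i = (\<Sum>\<alpha><d. \<Sum>\<alpha>'<d. \<Sum>b<d. lmat z l a b * (lent z (take i w) b \<alpha> * ldiff z x (w ! i) \<alpha> \<alpha>' * lent z (drop (Suc i) w) \<alpha>' a'))"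
      by (simp add: sum_distrib_right mult.assoc)
    also have "\<dots> = (\<Sum>\<alpha><d. \<Sum>b<d. \<Sum>\<alpha>'<d. lmat z l a b * (lent z (take i w) b \<alpha> * ldiff z x (w ! i) \<alpha> \<alpha>' * lent z (drop (Suc i) w) \<alpha>' a'))"
      by (rule sum.cong[OF refl], rule sum.swap)
    also have "\<dots> = ?r i"
      by (subst sum.swap) (simp add: sum_distrib_left)
    finally show ?thesis .
  qed
  then have "letdiff z x (l # w) a a' = (\<Sum>\<alpha>'<d. ldiff z x l a \<alpha>' * lent z w \<alpha>' a') + (\<Sum>i<length w. ?r i)"
    using assms by (simp add: letdiff_def sum.lessThan_Suc_shift mult.assoc flip: sum_distrib_left del: sum.lessThan_Suc lent.simps(2))
  also have "(\<Sum>i<length w. ?r i) = (\<Sum>b<d. lmat z l a b * letdiff z x w b a')"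
    unfolding letdiff_def sum_distrib_left[of "lmat z l a _"] by (rule sum.swap)
  finally show ?thesis by (simp add: sum.distrib)
qed

section \<open>Polynomiality of traces and contraction of letters\<close>

context
  fixes D :: nat and K :: "(nat \<times> nat \<times> nat) set"
  defines "K \<equiv> {..<d} \<times> {..<D} \<times> {..<p}"
begin

lemma finite_K: "finite K" by (simp add: K_def)

lemma cpoly_lmat:
  assumes "a < d" "a' < d" "e < D" "e' < D"
  shows "cpoly K (\<lambda>z. lmat z (s, e, e') a a') (\<lambda>x z. ldiff z x (s, e, e') a a')"
proof -
  have K: "(a, e, k) \<in> K" "(a', e', k) \<in> K" if "k < p" for k
    using that assms by (auto simp: K_def)
  show ?thesis
  proof (cases s)
    case True
    show ?thesis
      by (rule cpoly_cong[OF cpoly_scale[of _ _ _ "1 / of_nat N", OF cpoly_sum[of "{..<p}", OF _ cpoly_mult]]],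
          simp, rule cpoly_var[OF finite_K K(1)], simp, rule cpoly_cnj[OF finite_K K(2)], simp)
        (simp_all add: lmat_def ldiff_def True)
  next
    case False
    show ?thesis
      by (rule cpoly_cong[OF cpoly_scale[of _ _ _ "1 / of_nat N", OF cpoly_sum[of "{..<p}", OF _ cpoly_mult]]],
          simp, rule cpoly_cnj[OF finite_K K(1)], simp, rule cpoly_var[OF finite_K K(2)], simp)
        (simp_all add: lmat_def ldiff_def False)
  qed
qed

lemma cpoly_lent:
  assumes "valid_word D w" "a < d" "a' < d"
  shows "cpoly K (\<lambda>z. lent z w a a') (\<lambda>x z. letdiff z x w a a')"
  using assms
proof (induction w arbitrary: a)
  case Nil
  show ?case unfolding lent.simps letdiff_Nil by (rule cpoly_const)
next
  case (Cons l w)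
  obtain s e e' where l: "l = (s, e, e')" by (cases l)
  have "cpoly K (\<lambda>z. \<Sum>b<d. lmat z l a b * lent z w b a')
      (\<lambda>x z. \<Sum>b<d. ldiff z x l a b * lent z w b a' + lmat z l a b * letdiff z x w b a')"
    using Cons unfolding l by (intro cpoly_sum cpoly_mult cpoly_lmat) auto
  then show ?case using Cons.prems by (simp add: letdiff_Cons)
qed

lemma cpoly_ltrace:
  "valid_word D w \<Longrightarrow> cpoly K (\<lambda>z. ltrace z w) (\<lambda>x z. \<Sum>a<d. letdiff z x w a a)"
  unfolding ltrace_def by (intro cpoly_sum cpoly_lent) auto

lemma cpoly_ltraces:
  "list_all (valid_word D) ws \<Longrightarrow> cpoly K (\<lambda>z. ltraces z ws) (\<lambda>x z. lsdiff z x ws)"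
proof (induction ws)
  case Nil
  show ?case using cpoly_const by (simp add: lsdiff_def)
next
  case (Cons w ws)
  have "lsdiff z x (w # ws) = (\<Sum>a<d. letdiff z x w a a) * ltraces z ws + ltrace z w * lsdiff z x ws" for z x
    unfolding lsdiff_def
    by (simp add: sum.lessThan_Suc_shift sum_distrib_left mult.left_commute del: sum.lessThan_Suc)
  then show ?case using Cons by (auto intro!: cpoly_cong[OF cpoly_mult[OF cpoly_ltrace Cons.IH]])
qed

text \<open>\<open>Q\<close> stands for the rest of the words involved. The delta in
  \<open>ldiff\<close> fixes \<open>a1\<close>, and the two surviving halves,
  \<open>cnj (z (a2, b', k))\<close> from the first letter and an unconjugated coordinate from the
  other, share the column \<open>k\<close>; summing over \<open>k\<close> makes them a letter. It
  absorbs one of the two factors \<open>1 / N\<close>.\<close>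

lemma contraction:
  assumes "\<alpha> < d" "\<alpha>' < d"
  shows "(\<Sum>a1<d. \<Sum>a2<d. \<Sum>k<p. cnj (z (a2, b', k)) / of_nat N * (Q a2 a1 * ldiff z (a1, b, k) (s, f, f') \<alpha> \<alpha>'))
    = of_bool (b = (if s then f' else f)) / of_nat N *
      (\<Sum>a2<d. lmat z (True, if s then f else f', b') (if s then \<alpha> else \<alpha>') a2 * Q a2 (if s then \<alpha>' else \<alpha>))"
proof -
  define h h' \<beta> \<beta>' where "h = (if s then f' else f)" and "h' = (if s then f else f')"
    and "\<beta> = (if s then \<alpha>' else \<alpha>)" and "\<beta>' = (if s then \<alpha> else \<alpha>')"
  have \<beta>: "\<beta> < d" using assms by (simp add: \<beta>_def)
  have diff: "ldiff z (a1, b, k) (s, f, f') \<alpha> \<alpha>' = of_bool (a1 = \<beta>) * (of_bool (b = h) * z (\<beta>', h', k) / of_nat N)"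
    if "k < p" for a1 k
  proof -
    have "(\<Sum>i<p. g i * of_bool (a1 = \<beta> \<and> b = h \<and> k = i)) = of_bool (a1 = \<beta> \<and> b = h) * g k" for g :: "nat \<Rightarrow> complex"
      using that by (cases "a1 = \<beta> \<and> b = h") auto
    from this[of "\<lambda>i. z (\<beta>', h', i)"] show ?thesis
      by (cases s) (auto simp: ldiff_def h_def h'_def \<beta>_def \<beta>'_def mult.commute)
  qed
  have "(\<Sum>a1<d. \<Sum>a2<d. \<Sum>k<p. cnj (z (a2, b', k)) / of_nat N * (Q a2 a1 * ldiff z (a1, b, k) (s, f, f') \<alpha> \<alpha>'))
      = (\<Sum>a1<d. of_bool (a1 = \<beta>) * (\<Sum>a2<d. \<Sum>k<p. cnj (z (a2, b', k)) / of_nat N * (Q a2 a1 * (of_bool (b = h) * z (\<beta>', h', k) / of_nat N))))"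
    by (simp add: diff sum_distrib_left mult_ac)
  also have "\<dots> = (\<Sum>a2<d. \<Sum>k<p. cnj (z (a2, b', k)) / of_nat N * (Q a2 \<beta> * (of_bool (b = h) * z (\<beta>', h', k) / of_nat N)))"
    by (rule sum_of_bool_mult(2)[OF \<beta>])
  also have "\<dots> = of_bool (b = h) / of_nat N * (\<Sum>a2<d. lmat z (True, h', b') \<beta>' a2 * Q a2 \<beta>)"
    by (simp add: lmat_def sum_distrib_left sum_distrib_right sum_divide_distrib mult_ac)
  finally show ?thesis by (simp only: h_def h'_def \<beta>_def \<beta>'_def)
qed

lemma sum3_swap:
  "(\<Sum>a1<d. \<Sum>a2<d. \<Sum>k<p. \<Sum>i\<in>A. (f a1 a2 k i :: complex)) = (\<Sum>i\<in>A. \<Sum>a1<d. \<Sum>a2<d. \<Sum>k<p. f a1 a2 k i)"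
proof -
  have 1: "(\<Sum>k<p. \<Sum>i\<in>A. f a1 a2 k i) = (\<Sum>i\<in>A. \<Sum>k<p. f a1 a2 k i)" for a1 a2
    by (rule sum.swap)
  have 2: "(\<Sum>a2<d. \<Sum>i\<in>A. \<Sum>k<p. f a1 a2 k i) = (\<Sum>i\<in>A. \<Sum>a2<d. \<Sum>k<p. f a1 a2 k i)" for a1
    by (rule sum.swap)
  show ?thesis unfolding 1 2 by (rule sum.swap)
qed

lemma sum3_mult:
  "(\<Sum>a1<d. \<Sum>a2<d. \<Sum>k<p. f a1 a2 k) * (r :: complex) = (\<Sum>a1<d. \<Sum>a2<d. \<Sum>k<p. f a1 a2 k * r)"
  by (simp add: sum_distrib_right)

text \<open>For equal kinds the indices identified are the two ends of \<open>v\<close>, giving a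
  separate trace. For opposite kinds the far end of \<open>v\<close> is tied to the position where
  \<open>u\<close> stops, so \<open>v\<close> is traversed backwards, which
  \<open>lent_transp\<close> rewrites as a word.\<close>

lemma self_contraction:
  "(\<Sum>a1<d. \<Sum>a2<d. \<Sum>k<p. cnj (z (a2, b', k)) / of_nat N * letdiff z (a1, b, k) w a2 a1)
    = (\<Sum>l<length w. of_bool (matches b (w ! l)) / of_nat N * ltraces z (self_words b' (w ! l) (take l w) (drop (Suc l) w)))"
proof -
  have "(\<Sum>\<alpha><d. \<Sum>\<alpha>'<d. \<Sum>a1<d. \<Sum>a2<d. \<Sum>k<p. cnj (z (a2, b', k)) / of_nat N *
      ((lent z u a2 \<alpha> * lent z v \<alpha>' a1) * ldiff z (a1, b, k) m \<alpha> \<alpha>')) = of_bool (matches b m) / of_nat N * ltraces z (self_words b' m u v)" (is "?lhs = _")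
    for u v m
  proof -
    obtain s f f' where m: "m = (s, f, f')" by (cases m)
    have lhs: "?lhs = (\<Sum>\<alpha><d. \<Sum>\<alpha>'<d. of_bool (b = (if s then f' else f)) / of_nat N *
      (\<Sum>a2<d. lmat z (True, if s then f else f', b') (if s then \<alpha> else \<alpha>') a2 *
        (lent z u a2 \<alpha> * lent z v \<alpha>' (if s then \<alpha>' else \<alpha>))))"
      unfolding m by (intro sum.cong refl contraction) auto
    show ?thesis
    proof (cases s)
      case True
      show ?thesis
      proof -
        have "ltrace z v * ltrace z ((True, f, b') # u) =
          (\<Sum>\<alpha>'<d. \<Sum>\<alpha><d. \<Sum>a2<d. lmat z (True, f, b') \<alpha> a2 * (lent z u a2 \<alpha> * lent z v \<alpha>' \<alpha>'))"
          unfolding ltrace_def sum_product unfolding lent.simps sum_distrib_left by (simp only: mult_ac)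
        also have "\<dots> = (\<Sum>\<alpha><d. \<Sum>\<alpha>'<d. \<Sum>a2<d. lmat z (True, f, b') \<alpha> a2 * (lent z u a2 \<alpha> * lent z v \<alpha>' \<alpha>'))"
          by (rule sum.swap)
        finally show ?thesis unfolding lhs by (simp add: m True matches_def self_words_def cross_word_def sum_distrib_left)
      qed
    next
      case False
      have "ltrace z ((True, f', b') # u @ rev (map transp v)) =
        (\<Sum>\<alpha>'<d. \<Sum>a2<d. \<Sum>\<alpha><d. lmat z (True, f', b') \<alpha>' a2 * (lent z u a2 \<alpha> * lent z v \<alpha>' \<alpha>))"
        by (simp add: ltrace_def lent_append lent_transp sum_distrib_left)
      also have "\<dots> = (\<Sum>\<alpha>'<d. \<Sum>\<alpha><d. \<Sum>a2<d. lmat z (True, f', b') \<alpha>' a2 * (lent z u a2 \<alpha> * lent z v \<alpha>' \<alpha>))"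
        by (rule sum.cong[OF refl], rule sum.swap)
      also have "\<dots> = (\<Sum>\<alpha><d. \<Sum>\<alpha>'<d. \<Sum>a2<d. lmat z (True, f', b') \<alpha>' a2 * (lent z u a2 \<alpha> * lent z v \<alpha>' \<alpha>))"
        by (rule sum.swap)
      finally show ?thesis unfolding lhs by (simp add: m False matches_def self_words_def cross_word_def sum_distrib_left)
    qed
  qed
  note * = this
  show ?thesis
    unfolding letdiff_def sum_distrib_left sum3_swap *[symmetric]
    by (simp only: mult_ac)
qed

lemma cross_contraction:
  "(\<Sum>a1<d. \<Sum>a2<d. \<Sum>k<p. cnj (z (a2, b', k)) / of_nat N * (lent z w a2 a1 * (\<Sum>a<d. letdiff z (a1, b, k) v a a)))
    = (\<Sum>l<length v. of_bool (matches b (v ! l)) / of_nat N * ltrace z (cross_word b' w (v ! l) (drop (Suc l) v @ take l v)))"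
proof -
  have "(\<Sum>\<alpha><d. \<Sum>\<alpha>'<d. \<Sum>a1<d. \<Sum>a2<d. \<Sum>k<p. cnj (z (a2, b', k)) / of_nat N *
      ((lent z w a2 a1 * lent z v \<alpha>' \<alpha>) * ldiff z (a1, b, k) m \<alpha> \<alpha>')) = of_bool (matches b m) / of_nat N * ltrace z (cross_word b' w m v)" (is "?lhs = _")
    for v m
  proof -
    obtain s f f' where m: "m = (s, f, f')" by (cases m)
    have lhs: "?lhs = (\<Sum>\<alpha><d. \<Sum>\<alpha>'<d. of_bool (b = (if s then f' else f)) / of_nat N *
      (\<Sum>a2<d. lmat z (True, if s then f else f', b') (if s then \<alpha> else \<alpha>') a2 *
        (lent z w a2 (if s then \<alpha>' else \<alpha>) * lent z v \<alpha>' \<alpha>)))"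
      unfolding m by (intro sum.cong refl contraction) auto
    show ?thesis
    proof (cases s)
      case True
      have "ltrace z ((True, f, b') # w @ v) =
        (\<Sum>\<alpha><d. \<Sum>a2<d. \<Sum>\<alpha>'<d. lmat z (True, f, b') \<alpha> a2 * (lent z w a2 \<alpha>' * lent z v \<alpha>' \<alpha>))"
        by (simp add: ltrace_def lent_append sum_distrib_left)
      also have "\<dots> = (\<Sum>\<alpha><d. \<Sum>\<alpha>'<d. \<Sum>a2<d. lmat z (True, f, b') \<alpha> a2 * (lent z w a2 \<alpha>' * lent z v \<alpha>' \<alpha>))"
        by (rule sum.cong[OF refl], rule sum.swap)
      finally show ?thesis unfolding lhs by (simp add: m True matches_def self_words_def cross_word_def sum_distrib_left)
    next
      case False
      have "ltrace z ((True, f', b') # w @ rev (map transp v)) =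
        (\<Sum>\<alpha>'<d. \<Sum>a2<d. \<Sum>\<alpha><d. lmat z (True, f', b') \<alpha>' a2 * (lent z w a2 \<alpha> * lent z v \<alpha>' \<alpha>))"
        by (simp add: ltrace_def lent_append lent_transp sum_distrib_left)
      also have "\<dots> = (\<Sum>\<alpha>'<d. \<Sum>\<alpha><d. \<Sum>a2<d. lmat z (True, f', b') \<alpha>' a2 * (lent z w a2 \<alpha> * lent z v \<alpha>' \<alpha>))"
        by (rule sum.cong[OF refl], rule sum.swap)
      also have "\<dots> = (\<Sum>\<alpha><d. \<Sum>\<alpha>'<d. \<Sum>a2<d. lmat z (True, f', b') \<alpha>' a2 * (lent z w a2 \<alpha> * lent z v \<alpha>' \<alpha>))"
        by (rule sum.swap)
      finally show ?thesis unfolding lhs by (simp add: m False matches_def self_words_def cross_word_def sum_distrib_left)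
    qed
  qed
  note * = this
  \<comment> \<open>Cyclicity of the trace: the second trace is rotated so that the differentiated
    letter comes last.\<close>
  have eq: "(\<Sum>a<d. letdiff z x v a a) = (\<Sum>l<length v. \<Sum>\<alpha><d. \<Sum>\<alpha>'<d.
      lent z (drop (Suc l) v @ take l v) \<alpha>' \<alpha> * ldiff z x (v ! l) \<alpha> \<alpha>')" for x
  proof -
    have "(\<Sum>a<d. letdiff z x v a a) = (\<Sum>l<length v. \<Sum>a<d. \<Sum>\<alpha><d. \<Sum>\<alpha>'<d.
        lent z (take l v) a \<alpha> * ldiff z x (v ! l) \<alpha> \<alpha>' * lent z (drop (Suc l) v) \<alpha>' a)"
      unfolding letdiff_def by (rule sum.swap)
    also have "\<dots> = (\<Sum>l<length v. \<Sum>\<alpha><d. \<Sum>a<d. \<Sum>\<alpha>'<d.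
        lent z (take l v) a \<alpha> * ldiff z x (v ! l) \<alpha> \<alpha>' * lent z (drop (Suc l) v) \<alpha>' a)"
      by (rule sum.cong[OF refl], rule sum.swap)
    also have "\<dots> = (\<Sum>l<length v. \<Sum>\<alpha><d. \<Sum>\<alpha>'<d. \<Sum>a<d.
        lent z (take l v) a \<alpha> * ldiff z x (v ! l) \<alpha> \<alpha>' * lent z (drop (Suc l) v) \<alpha>' a)"
      by (rule sum.cong[OF refl], rule sum.cong[OF refl], rule sum.swap)
    finally show ?thesis
      by (simp add: lent_append sum_distrib_left sum_distrib_right mult_ac)
  qed
  show ?thesis
    unfolding eq unfolding sum_distrib_left sum3_swap *[symmetric]
    by (simp only: mult_ac)
qed

lemma ltraces_append [simp]: "ltraces z (us @ vs) = ltraces z us * ltraces z vs"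
  by (simp add: ltraces_def)

text \<open>Valid for each configuration before taking expectations. The factor taken out of the
  first letter meets the conjugated factor of that same letter, another letter of its trace, or a
  letter of another trace. In the first case nothing depends on \<open>k\<close> any more, and the
  sum over \<open>k\<close> yields \<open>p\<close>.\<close>

lemma loop_equation_pointwise:
  "(\<Sum>a1<d. \<Sum>a2<d. \<Sum>k<p. (of_bool ((a1, b, k) = (a2, b', k)) * (lent z w a2 a1 * ltraces z ws)
      + cnj (z (a2, b', k)) * (letdiff z (a1, b, k) w a2 a1 * ltraces z ws
        + lent z w a2 a1 * lsdiff z (a1, b, k) ws)) / of_nat N)
    = of_bool (b = b') * of_nat p / of_nat N * ltraces z (w # ws)
      + (\<Sum>l<length w. of_bool (matches b (w ! l)) / of_nat N
          * ltraces z (self_words b' (w ! l) (take l w) (drop (Suc l) w) @ ws))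
      + (\<Sum>j<length ws. \<Sum>l<length (ws ! j). of_bool (matches b (ws ! j ! l)) / of_nat N
          * ltraces z (cross_word b' w (ws ! j ! l) (drop (Suc l) (ws ! j) @ take l (ws ! j))
            # take j ws @ drop (Suc j) ws))"
  (is "?lhs = ?own + ?self + ?cross")
proof -
  have "?lhs = (\<Sum>a1<d. \<Sum>a2<d. \<Sum>k<p. of_bool (a1 = a2 \<and> b = b') * (lent z w a2 a1 * ltraces z ws) / of_nat N)
      + (\<Sum>a1<d. \<Sum>a2<d. \<Sum>k<p. cnj (z (a2, b', k)) / of_nat N * letdiff z (a1, b, k) w a2 a1) * ltraces z ws
      + (\<Sum>a1<d. \<Sum>a2<d. \<Sum>k<p. cnj (z (a2, b', k)) / of_nat N * (lent z w a2 a1 * lsdiff z (a1, b, k) ws))"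
    unfolding sum_distrib_right sum.distrib[symmetric]
    by (intro sum.cong refl) (simp add: add_divide_distrib distrib_left mult_ac)
  also have "(\<Sum>a1<d. \<Sum>a2<d. \<Sum>k<p. of_bool (a1 = a2 \<and> b = b') * (lent z w a2 a1 * ltraces z ws) / of_nat N) = ?own"
  proof -
    have "(\<Sum>a1<d. \<Sum>a2<d. \<Sum>k<p. of_bool (a1 = a2 \<and> b = b') * (lent z w a2 a1 * ltraces z ws) / of_nat N)
        = (\<Sum>a1<d. \<Sum>a2<d. of_bool (a1 = a2) * (of_bool (b = b') * of_nat p * (lent z w a2 a1 * ltraces z ws) / of_nat N))"
      by (simp add: of_bool_conj mult_ac)
    also have "\<dots> = (\<Sum>a1<d. of_bool (b = b') * of_nat p * (lent z w a1 a1 * ltraces z ws) / of_nat N)"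
      by (intro sum.cong refl sum_of_bool_mult(1)) auto
    also have "\<dots> = ?own"
      by (simp add: ltrace_def sum_distrib_left sum_distrib_right sum_divide_distrib mult_ac)
    finally show ?thesis .
  qed
  also have "(\<Sum>a1<d. \<Sum>a2<d. \<Sum>k<p. cnj (z (a2, b', k)) / of_nat N * letdiff z (a1, b, k) w a2 a1) * ltraces z ws = ?self"
    unfolding self_contraction by (simp add: sum_distrib_right mult.assoc)
  also have "(\<Sum>a1<d. \<Sum>a2<d. \<Sum>k<p. cnj (z (a2, b', k)) / of_nat N * (lent z w a2 a1 * lsdiff z (a1, b, k) ws)) = ?cross"
  proof -
    have "(\<Sum>a1<d. \<Sum>a2<d. \<Sum>k<p. cnj (z (a2, b', k)) / of_nat N * (lent z w a2 a1 * lsdiff z (a1, b, k) ws))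
        = (\<Sum>j<length ws. (\<Sum>a1<d. \<Sum>a2<d. \<Sum>k<p. cnj (z (a2, b', k)) / of_nat N *
            (lent z w a2 a1 * (\<Sum>a<d. letdiff z (a1, b, k) (ws ! j) a a))) * ltraces z (take j ws @ drop (Suc j) ws))"
      unfolding lsdiff_def sum_distrib_left[of _ _ "{..<length ws}"] sum3_swap sum3_mult
      by (simp only: mult.assoc)
    then show ?thesis unfolding cross_contraction sum_distrib_right by (simp add: mult_ac)
  qed
  finally show ?thesis .
qed

lemma loop_equation:
  assumes G: "gaussian_config M K Z"
    and valid: "valid_word D ((True, b, b') # w)" "list_all (valid_word D) ws"
  defines "F \<equiv> (\<lambda>ws. \<integral>\<omega>. ltraces (\<lambda>x. Z x \<omega>) ws \<partial>M)"
  shows "F (((True, b, b') # w) # ws) = of_bool (b = b') * of_nat p / of_nat N * F (w # ws)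
      + (\<Sum>l<length w. of_bool (matches b (w ! l)) / of_nat N
          * F (self_words b' (w ! l) (take l w) (drop (Suc l) w) @ ws))
      + (\<Sum>j<length ws. \<Sum>l<length (ws ! j). of_bool (matches b (ws ! j ! l)) / of_nat N
          * F (cross_word b' w (ws ! j ! l) (drop (Suc l) (ws ! j) @ take l (ws ! j))
            # take j ws @ drop (Suc j) ws))"
proof -
  let ?Z = "\<lambda>\<omega> x. Z x \<omega>"
  have int: "integrable M (\<lambda>\<omega>. ltraces (?Z \<omega>) ws)" if "list_all (valid_word D) ws" for ws
    by (rule cpoly_integrable[OF G cpoly_ltraces[OF that]])
  have b: "b < D" "b' < D" and w: "valid_word D w" using valid(1) by auto
  \<comment> \<open>\<open>P\<close> is what remains of the summand when the factor
    \<open>z (a1, b, k)\<close> of the first letter is taken out for integration by parts;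
    \<open>DP\<close> is its derivative by the product rule.\<close>
  define P where "P a1 a2 k z = cnj (z (a2, b', k)) * (lent z w a2 a1 * ltraces z ws)" for a1 a2 k and z :: config
  define DP where "DP a1 a2 k x z = of_bool (x = (a2, b', k)) * (lent z w a2 a1 * ltraces z ws)
      + cnj (z (a2, b', k)) * (letdiff z x w a2 a1 * ltraces z ws + lent z w a2 a1 * lsdiff z x ws)" for a1 a2 k x z
  have P: "cpoly K (P a1 a2 k) (DP a1 a2 k)" if "a1 < d" "a2 < d" "k < p" for a1 a2 k
    unfolding P_def[abs_def] DP_def[abs_def] using that b w valid(2)
    by (intro cpoly_mult cpoly_cnj cpoly_lent cpoly_ltraces finite_K) (auto simp: K_def)
  have parts: "integrable M (\<lambda>\<omega>. Z (a1, b, k) \<omega> * P a1 a2 k (?Z \<omega>) / of_nat N)"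
    "(\<integral>\<omega>. Z (a1, b, k) \<omega> * P a1 a2 k (?Z \<omega>) / of_nat N \<partial>M) = (\<integral>\<omega>. DP a1 a2 k (a1, b, k) (?Z \<omega>) / of_nat N \<partial>M)"
    "integrable M (\<lambda>\<omega>. DP a1 a2 k (a1, b, k) (?Z \<omega>) / of_nat N)"
    if "a1 < d" "a2 < d" "k < p" for a1 a2 k
  proof -
    have x: "(a1, b, k) \<in> K" using that b by (auto simp: K_def)
    show "integrable M (\<lambda>\<omega>. Z (a1, b, k) \<omega> * P a1 a2 k (?Z \<omega>) / of_nat N)"
      by (intro integrable_divide cpoly_times_var_integrable[OF G x P[OF that]])
    show "integrable M (\<lambda>\<omega>. DP a1 a2 k (a1, b, k) (?Z \<omega>) / of_nat N)"
      by (intro integrable_divide cpoly_diff_integrable[OF G P[OF that]])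
    show "(\<integral>\<omega>. Z (a1, b, k) \<omega> * P a1 a2 k (?Z \<omega>) / of_nat N \<partial>M) = (\<integral>\<omega>. DP a1 a2 k (a1, b, k) (?Z \<omega>) / of_nat N \<partial>M)"
      by (simp only: integral_divide_zero gaussian_parts[OF G x P[OF that]])
  qed
  have "ltraces z (((True, b, b') # w) # ws) = (\<Sum>a1<d. \<Sum>a2<d. \<Sum>k<p. z (a1, b, k) * P a1 a2 k z / of_nat N)" for z
    by (simp add: P_def ltrace_def lmat_def sum_distrib_left sum_distrib_right sum_divide_distrib mult_ac)
  then have "F (((True, b, b') # w) # ws) = (\<integral>\<omega>. (\<Sum>a1<d. \<Sum>a2<d. \<Sum>k<p. Z (a1, b, k) \<omega> * P a1 a2 k (?Z \<omega>) / of_nat N) \<partial>M)"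
    by (simp only: F_def)
  also have "\<dots> = (\<Sum>a1<d. \<Sum>a2<d. \<Sum>k<p. \<integral>\<omega>. Z (a1, b, k) \<omega> * P a1 a2 k (?Z \<omega>) / of_nat N \<partial>M)"
    by (intro has_bochner_integral_integral_eq has_bochner_integral_sum has_bochner_integral_integrable
        parts(1)) auto
  also have "\<dots> = (\<Sum>a1<d. \<Sum>a2<d. \<Sum>k<p. \<integral>\<omega>. DP a1 a2 k (a1, b, k) (?Z \<omega>) / of_nat N \<partial>M)"
    by (intro sum.cong refl parts(2)) auto
  also have "\<dots> = (\<integral>\<omega>. (\<Sum>a1<d. \<Sum>a2<d. \<Sum>k<p. DP a1 a2 k (a1, b, k) (?Z \<omega>) / of_nat N) \<partial>M)"
    by (intro has_bochner_integral_integral_eq[symmetric] has_bochner_integral_sum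
        has_bochner_integral_integrable parts(3)) auto
  also have "\<dots> = of_bool (b = b') * of_nat p / of_nat N * F (w # ws)
      + (\<Sum>l<length w. of_bool (matches b (w ! l)) / of_nat N
          * F (self_words b' (w ! l) (take l w) (drop (Suc l) w) @ ws))
      + (\<Sum>j<length ws. \<Sum>l<length (ws ! j). of_bool (matches b (ws ! j ! l)) / of_nat N
          * F (cross_word b' w (ws ! j ! l) (drop (Suc l) (ws ! j) @ take l (ws ! j))
            # take j ws @ drop (Suc j) ws))"
  proof -
    have own: "has_bochner_integral M (\<lambda>\<omega>. of_bool (b = b') * of_nat p / of_nat N * ltraces (?Z \<omega>) (w # ws))
      (of_bool (b = b') * of_nat p / of_nat N * F (w # ws))"
      unfolding F_def using w valid(2)
      by (intro has_bochner_integral_mult_right has_bochner_integral_integrable int) auto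
    have self: "has_bochner_integral M (\<lambda>\<omega>. \<Sum>l<length w. of_bool (matches b (w ! l)) / of_nat N
          * ltraces (?Z \<omega>) (self_words b' (w ! l) (take l w) (drop (Suc l) w) @ ws))
       (\<Sum>l<length w. of_bool (matches b (w ! l)) / of_nat N
          * F (self_words b' (w ! l) (take l w) (drop (Suc l) w) @ ws))"
      unfolding F_def using w valid(2) b
      by (intro has_bochner_integral_sum has_bochner_integral_mult_right has_bochner_integral_integrable int)
        (auto simp: valid_self_words)
    have cross: "has_bochner_integral M (\<lambda>\<omega>. \<Sum>j<length ws. \<Sum>l<length (ws ! j). of_bool (matches b (ws ! j ! l)) / of_nat N
          * ltraces (?Z \<omega>) (cross_word b' w (ws ! j ! l) (drop (Suc l) (ws ! j) @ take l (ws ! j))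
            # take j ws @ drop (Suc j) ws))
       (\<Sum>j<length ws. \<Sum>l<length (ws ! j). of_bool (matches b (ws ! j ! l)) / of_nat N
          * F (cross_word b' w (ws ! j ! l) (drop (Suc l) (ws ! j) @ take l (ws ! j))
            # take j ws @ drop (Suc j) ws))"
      unfolding F_def using w valid(2) b
      by (intro has_bochner_integral_sum has_bochner_integral_mult_right has_bochner_integral_integrable int)
        (auto simp: valid_cross_word list_all_iff dest!: in_set_takeD in_set_dropD)
    have "(\<Sum>a1<d. \<Sum>a2<d. \<Sum>k<p. DP a1 a2 k (a1, b, k) (?Z \<omega>) / of_nat N)
      = of_bool (b = b') * of_nat p / of_nat N * ltraces (?Z \<omega>) (w # ws)
      + (\<Sum>l<length w. of_bool (matches b (w ! l)) / of_nat N
          * ltraces (?Z \<omega>) (self_words b' (w ! l) (take l w) (drop (Suc l) w) @ ws))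
      + (\<Sum>j<length ws. \<Sum>l<length (ws ! j). of_bool (matches b (ws ! j ! l)) / of_nat N
          * ltraces (?Z \<omega>) (cross_word b' w (ws ! j ! l) (drop (Suc l) (ws ! j) @ take l (ws ! j))
            # take j ws @ drop (Suc j) ws))" for \<omega>
      unfolding DP_def by (rule loop_equation_pointwise)
    then show ?thesis
      by (simp only:)
        (intro has_bochner_integral_integral_eq has_bochner_integral_add own self cross)
  qed
  finally show ?thesis .
qed

end

end

section \<open>The limits of the moments\<close>

text \<open>The loop equation for one trace with only those terms whose coefficient survives. For
  \<open>s\<close> false the rule looks the same, because conjugating all letters is a symmetry and
  keeps the small indices in place.\<close>

fun limit_moment :: "nat \<Rightarrow> real \<Rightarrow> letter list \<Rightarrow> complex" where
  "limit_moment D c [] = 1"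
| "limit_moment D c ((s, b, b') # w) = of_real c * of_bool (b = b') * limit_moment D c w
    + (\<Sum>l<length w. of_bool (fst (w ! l) = s \<and> snd (snd (w ! l)) = b)
        * (limit_moment D c (drop (Suc l) w) * limit_moment D c ((s, fst (snd (w ! l)), b') # take l w))) / of_nat D"

declare limit_moment.simps(2) [simp del]

lemma limit_moment_conj: "limit_moment D c (map conj_letter w) = limit_moment D c w"
proof (induction D c w rule: limit_moment.induct)
  case (2 D c s b b' w)
  have conj: "fst (conj_letter m) = (\<not> fst m)" "snd (conj_letter m) = snd m"
    "conj_letter (s', e, e') = (\<not> s', e, e')" for m s' e e'
    by (simp_all add: conj_letter_def case_prod_unfold)
  have "(\<Sum>l<length w. of_bool (fst (w ! l) = s \<and> snd (snd (w ! l)) = b)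
        * (limit_moment D c (drop (Suc l) w) * limit_moment D c ((s, fst (snd (w ! l)), b') # take l w)))
      = (\<Sum>l<length w. of_bool (fst (w ! l) = s \<and> snd (snd (w ! l)) = b)
        * (limit_moment D c (map conj_letter (drop (Suc l) w))
          * limit_moment D c (map conj_letter ((s, fst (snd (w ! l)), b') # take l w))))"
    using 2(2,3) by (intro sum.cong) auto
  then show ?case
    using 2(1) by (simp add: limit_moment.simps(2)[of D c _ b b'] conj drop_map take_map)
qed simp

text \<open>Covers both cases of the theorem: \<open>d\<close> is the growing dimension and
  \<open>D\<close> the fixed one, and a coordinate lists the index of the growing factor
  first.\<close>

locale gaussian_sequence =
  fixes M :: "nat \<Rightarrow> 'w measure" and Z :: "nat \<Rightarrow> nat \<times> nat \<times> nat \<Rightarrow> 'w \<Rightarrow> complex"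
    and d p :: "nat \<Rightarrow> nat" and D :: nat and c :: real
  assumes gaussian: "\<And>n. gaussian_config (M n) ({..<d n} \<times> {..<D} \<times> {..<p n}) (Z n)"
    and d_at_top: "filterlim d at_top sequentially"
    and D_pos: "D > 0"
    and ratio: "(\<lambda>n. real (p n) / (real (d n) * real D)) \<longlonglongrightarrow> c"
begin

definition \<tau> :: "nat \<Rightarrow> 'w \<Rightarrow> letter list list \<Rightarrow> complex" where
  "\<tau> n \<omega> = label_matrices.ltraces (d n) (d n * D) (p n) (\<lambda>x. Z n x \<omega>)"

definition F :: "nat \<Rightarrow> letter list list \<Rightarrow> complex" where
  "F n ws = (\<integral>\<omega>. \<tau> n \<omega> ws \<partial>M n) / of_nat (d n) ^ length ws"

abbreviation "valid_words \<equiv> list_all (valid_word D)"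

lemma \<tau>_integrable: "valid_words ws \<Longrightarrow> integrable (M n) (\<lambda>\<omega>. \<tau> n \<omega> ws)"
  unfolding \<tau>_def by (rule cpoly_integrable[OF gaussian label_matrices.cpoly_ltraces])

lemma F_Nil: "F n [] = 1"
proof -
  interpret prob_space "M n" using gaussian[of n] by (simp add: gaussian_config_def)
  show ?thesis by (simp add: F_def \<tau>_def label_matrices.ltraces_simps prob_space)
qed

lemma F_Nil_Cons: "d n > 0 \<Longrightarrow> F n ([] # ws) = F n ws"
  by (simp add: F_def \<tau>_def label_matrices.ltraces_simps label_matrices.ltrace_def label_matrices.lent.simps)

lemma F_conj:
  assumes "valid_words ws"
  shows "F n (map (map conj_letter) ws) = F n ws"
proof -
  have "\<tau> n \<omega> (map (map conj_letter) ws)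
      = label_matrices.ltraces (d n) (d n * D) (p n) (\<lambda>x. cnj (Z n x \<omega>)) ws" for \<omega>
    by (simp add: \<tau>_def label_matrices.ltraces_conj)
  then show ?thesis
    unfolding F_def using gaussian_cnj[OF gaussian label_matrices.cpoly_ltraces[OF assms]]
    by (simp add: \<tau>_def)
qed

text \<open>Counting powers of \<open>d\<close>: a split adds a trace and so turns
  \<open>1 / (d * D)\<close> into \<open>1 / D\<close>; a reversal keeps the number of traces and
  the weight \<open>1 / (d * D)\<close>; a merger loses a trace and costs another
  \<open>1 / d\<close>.\<close>

lemma F_loop:
  assumes d: "d n > 0" and valid: "valid_word D ((True, b, b') # w)" "valid_words ws"
  shows "F n (((True, b, b') # w) # ws)
    = of_bool (b = b') * (of_nat (p n) / of_nat (d n * D)) * F n (w # ws)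
      + (\<Sum>l<length w. of_bool (matches b (w ! l)) * (if fst (w ! l) then 1 / of_nat D else 1 / of_nat (d n * D))
          * F n (self_words b' (w ! l) (take l w) (drop (Suc l) w) @ ws))
      + (\<Sum>j<length ws. \<Sum>l<length (ws ! j). of_bool (matches b (ws ! j ! l)) * (1 / (of_nat (d n * D) * of_nat (d n)))
          * F n (cross_word b' w (ws ! j ! l) (drop (Suc l) (ws ! j) @ take l (ws ! j))
            # take j ws @ drop (Suc j) ws))"
proof -
  define E where "E ws = (\<integral>\<omega>. \<tau> n \<omega> ws \<partial>M n)" for ws
  have E: "E ws = F n ws * of_nat (d n) ^ length ws" for ws
    using d by (simp add: E_def F_def)
  have self: "E (self_words b' m u v @ ws) / of_nat (d n * D) / of_nat (d n) ^ Suc (length ws)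
     = (if fst m then 1 / of_nat D else 1 / of_nat (d n * D)) * F n (self_words b' m u v @ ws)" for m u v
    using d D_pos by (cases m) (auto simp: E self_words_def field_simps)
  have cross: "E (u # take j ws @ drop (Suc j) ws) / of_nat (d n * D) / of_nat (d n) ^ Suc (length ws)
     = 1 / (of_nat (d n * D) * of_nat (d n)) * F n (u # take j ws @ drop (Suc j) ws)" if "j < length ws" for u j
  proof -
    have "length (u # take j ws @ drop (Suc j) ws) = length ws" using that by simp
    then have "E (u # take j ws @ drop (Suc j) ws) = F n (u # take j ws @ drop (Suc j) ws) * of_nat (d n) ^ length ws"
      by (simp only: E)
    then show ?thesis using d D_pos by (simp add: divide_simps)
  qed
  let ?\<delta> = "of_nat (d n) ^ Suc (length ws) :: complex"
  have own_part: "of_bool (b = b') * of_nat (p n) / of_nat (d n * D) * E (w # ws) / ?\<delta>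
      = of_bool (b = b') * (of_nat (p n) / of_nat (d n * D)) * F n (w # ws)"
    using d D_pos by (simp add: E divide_simps)
  have self_part: "of_bool P / of_nat (d n * D) * E (self_words b' m u v @ ws) / ?\<delta>
      = of_bool P * (if fst m then 1 / of_nat D else 1 / of_nat (d n * D)) * F n (self_words b' m u v @ ws)" for P m u v
    unfolding mult.assoc self[symmetric] by simp
  have cross_part: "of_bool P / of_nat (d n * D) * E (u # take j ws @ drop (Suc j) ws) / ?\<delta>
      = of_bool P * (1 / (of_nat (d n * D) * of_nat (d n))) * F n (u # take j ws @ drop (Suc j) ws)"
    if "j < length ws" for P u j
    unfolding mult.assoc cross[OF that, symmetric] by simp
  have "F n (((True, b, b') # w) # ws) = E (((True, b, b') # w) # ws) / of_nat (d n) ^ Suc (length ws)"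
    by (simp add: F_def E_def)
  also have "E (((True, b, b') # w) # ws) = of_bool (b = b') * of_nat (p n) / of_nat (d n * D) * E (w # ws)
      + (\<Sum>l<length w. of_bool (matches b (w ! l)) / of_nat (d n * D)
          * E (self_words b' (w ! l) (take l w) (drop (Suc l) w) @ ws))
      + (\<Sum>j<length ws. \<Sum>l<length (ws ! j). of_bool (matches b (ws ! j ! l)) / of_nat (d n * D)
          * E (cross_word b' w (ws ! j ! l) (drop (Suc l) (ws ! j) @ take l (ws ! j))
            # take j ws @ drop (Suc j) ws))"
    unfolding E_def \<tau>_def by (rule label_matrices.loop_equation[OF gaussian valid])
  finally have "F n (((True, b, b') # w) # ws)
      = of_bool (b = b') * of_nat (p n) / of_nat (d n * D) * E (w # ws) / ?\<delta>
      + (\<Sum>l<length w. of_bool (matches b (w ! l)) / of_nat (d n * D)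
          * E (self_words b' (w ! l) (take l w) (drop (Suc l) w) @ ws) / ?\<delta>)
      + (\<Sum>j<length ws. \<Sum>l<length (ws ! j). of_bool (matches b (ws ! j ! l)) / of_nat (d n * D)
          * E (cross_word b' w (ws ! j ! l) (drop (Suc l) (ws ! j) @ take l (ws ! j))
            # take j ws @ drop (Suc j) ws) / ?\<delta>)"
    by (simp only: add_divide_distrib sum_divide_distrib)
  then show ?thesis
    unfolding own_part self_part
    by (simp only:) (intro arg_cong2[of _ _ _ _ "(+)"] sum.cong refl cross_part, auto)
qed

abbreviation \<mu> :: "letter list \<Rightarrow> complex" where "\<mu> \<equiv> limit_moment D c"

lemma limits:
  "(\<lambda>n. of_nat (p n) / of_nat (d n * D)) \<longlonglongrightarrow> complex_of_real c"
  "(\<lambda>n. 1 / of_nat (d n * D)) \<longlonglongrightarrow> (0 :: complex)"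
  "(\<lambda>n. 1 / (of_nat (d n * D) * of_nat (d n))) \<longlonglongrightarrow> (0 :: complex)"
proof -
  show "(\<lambda>n. of_nat (p n) / of_nat (d n * D)) \<longlonglongrightarrow> complex_of_real c"
    using tendsto_of_real[OF ratio, where ?'a = complex] by simp
  have d: "(\<lambda>n. 1 / of_nat (d n)) \<longlonglongrightarrow> (0 :: complex)"
    using filterlim_compose[OF lim_1_over_n d_at_top] by simp
  from tendsto_mult_left_zero[OF d, of "1 / of_nat D"]
  show 2: "(\<lambda>n. 1 / of_nat (d n * D)) \<longlonglongrightarrow> (0 :: complex)" by simp
  from tendsto_mult[OF 2 d] show "(\<lambda>n. 1 / (of_nat (d n * D) * of_nat (d n))) \<longlonglongrightarrow> (0 :: complex)" by simp
qed

text \<open>Contracting two letters removes a letter but may split a trace in two, whence the weight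
  \<open>2 * length w + 1\<close>. Words starting with a conjugated letter are reduced to the others by
  \<open>F_conj\<close>.\<close>

theorem F_tendsto: "valid_words ws \<Longrightarrow> (\<lambda>n. F n ws) \<longlonglongrightarrow> prod_list (map \<mu> ws)"
proof (induction "\<Sum>w\<leftarrow>ws. 2 * length w + 1" arbitrary: ws rule: less_induct)
  case less
  have IH: "(\<lambda>n. F n vs) \<longlonglongrightarrow> prod_list (map \<mu> vs)"
    if "valid_words vs" "(\<Sum>w\<leftarrow>vs. 2 * length w + 1) < (\<Sum>w\<leftarrow>ws. 2 * length w + 1)" for vs
    using less.hyps that by blast
  have d_pos: "\<forall>\<^sub>F n in sequentially. d n > 0"
    using d_at_top[unfolded filterlim_at_top, rule_format, of 1] by eventually_elim simp
  \<comment> \<open>Stated for any list of the same weight as \<open>ws\<close>, not for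
    \<open>ws\<close> itself, because it is also applied to the conjugated list. The 3 is the first
    letter, counted twice, plus 1 for its trace.\<close>
  have step: "(\<lambda>n. F n (((True, b, b') # w) # vs)) \<longlonglongrightarrow> \<mu> ((True, b, b') # w) * prod_list (map \<mu> vs)"
    if valid: "valid_words (((True, b, b') # w) # vs)"
      and size: "(\<Sum>w\<leftarrow>ws. 2 * length w + 1) = 2 * length w + 3 + (\<Sum>w\<leftarrow>vs. 2 * length w + 1)" for b b' w vs
  proof -
    have v: "b < D" "b' < D" "valid_word D w" "valid_words vs" using valid by (auto simp: valid_word_simps)
    have own: "(\<lambda>n. F n (w # vs)) \<longlonglongrightarrow> \<mu> w * prod_list (map \<mu> vs)"
      using IH[of "w # vs"] v size by simp
    have self: "(\<lambda>n. F n (self_words b' (w ! l) (take l w) (drop (Suc l) w) @ vs))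
        \<longlonglongrightarrow> prod_list (map \<mu> (self_words b' (w ! l) (take l w) (drop (Suc l) w))) * prod_list (map \<mu> vs)"
      if l: "l < length w" for l
    proof -
      have "(\<Sum>w\<leftarrow>self_words b' (w ! l) (take l w) (drop (Suc l) w). 2 * length w + 1) < 2 * length w + 3"
        using l by (cases "w ! l") (auto simp: self_words_def)
      then show ?thesis
        using IH[of "self_words b' (w ! l) (take l w) (drop (Suc l) w) @ vs"] v size valid_self_words[OF v(3) l v(2)]
        by simp
    qed
    have cross: "(\<lambda>n. F n (cross_word b' w (vs ! j ! l) (drop (Suc l) (vs ! j) @ take l (vs ! j)) # take j vs @ drop (Suc j) vs))
       \<longlonglongrightarrow> prod_list (map \<mu> (cross_word b' w (vs ! j ! l) (drop (Suc l) (vs ! j) @ take l (vs ! j)) # take j vs @ drop (Suc j) vs))"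
      if jl: "j < length vs" "l < length (vs ! j)" for j l
    proof (rule IH)
      have "(\<Sum>w\<leftarrow>vs. 2 * length w + 1) = (\<Sum>w\<leftarrow>take j vs @ vs ! j # drop (Suc j) vs. 2 * length w + 1)"
        using jl(1) by (simp flip: id_take_nth_drop)
      moreover have "length (cross_word b' w (vs ! j ! l) (drop (Suc l) (vs ! j) @ take l (vs ! j))) = length w + length (vs ! j)"
        using jl(2) by (cases "vs ! j ! l") (auto simp: cross_word_def)
      ultimately show "(\<Sum>w\<leftarrow>cross_word b' w (vs ! j ! l) (drop (Suc l) (vs ! j) @ take l (vs ! j)) # take j vs @ drop (Suc j) vs. 2 * length w + 1)
          < (\<Sum>w\<leftarrow>ws. 2 * length w + 1)"
        using size by simp
      have "valid_word D (vs ! j)" using v(4) jl(1) by (simp add: list_all_length)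
      then show "valid_words (cross_word b' w (vs ! j ! l) (drop (Suc l) (vs ! j) @ take l (vs ! j)) # take j vs @ drop (Suc j) vs)"
        using v valid_cross_word[OF v(3) _ jl(2) v(2)] by (auto simp: list_all_iff dest!: in_set_takeD in_set_dropD)
    qed
    have coeff: "(\<lambda>n. if s then 1 / of_nat D else 1 / of_nat (d n * D)) \<longlonglongrightarrow> (if s then 1 / of_nat D else 0 :: complex)" for s
      using limits(2) by (cases s) auto
    have lim: "(\<lambda>n. of_bool (b = b') * (of_nat (p n) / of_nat (d n * D)) * F n (w # vs)
      + (\<Sum>l<length w. of_bool (matches b (w ! l)) * (if fst (w ! l) then 1 / of_nat D else 1 / of_nat (d n * D))
          * F n (self_words b' (w ! l) (take l w) (drop (Suc l) w) @ vs))
      + (\<Sum>j<length vs. \<Sum>l<length (vs ! j). of_bool (matches b (vs ! j ! l)) * (1 / (of_nat (d n * D) * of_nat (d n)))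
          * F n (cross_word b' w (vs ! j ! l) (drop (Suc l) (vs ! j) @ take l (vs ! j))
            # take j vs @ drop (Suc j) vs)))
      \<longlonglongrightarrow> of_bool (b = b') * of_real c * (\<mu> w * prod_list (map \<mu> vs))
      + (\<Sum>l<length w. of_bool (matches b (w ! l)) * (if fst (w ! l) then 1 / of_nat D else 0)
          * (prod_list (map \<mu> (self_words b' (w ! l) (take l w) (drop (Suc l) w))) * prod_list (map \<mu> vs)))
      + (\<Sum>j<length vs. \<Sum>l<length (vs ! j). of_bool (matches b (vs ! j ! l)) * 0
          * prod_list (map \<mu> (cross_word b' w (vs ! j ! l) (drop (Suc l) (vs ! j) @ take l (vs ! j))
            # take j vs @ drop (Suc j) vs)))"
    proof (intro tendsto_add)
      show "(\<lambda>n. of_bool (b = b') * (of_nat (p n) / of_nat (d n * D)) * F n (w # vs))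
        \<longlonglongrightarrow> of_bool (b = b') * of_real c * (\<mu> w * prod_list (map \<mu> vs))"
        by (rule tendsto_mult[OF tendsto_mult[OF tendsto_const limits(1)] own])
    next
      show "(\<lambda>n. \<Sum>l<length w. of_bool (matches b (w ! l)) * (if fst (w ! l) then 1 / of_nat D else 1 / of_nat (d n * D))
          * F n (self_words b' (w ! l) (take l w) (drop (Suc l) w) @ vs))
        \<longlonglongrightarrow> (\<Sum>l<length w. of_bool (matches b (w ! l)) * (if fst (w ! l) then 1 / of_nat D else 0)
          * (prod_list (map \<mu> (self_words b' (w ! l) (take l w) (drop (Suc l) w))) * prod_list (map \<mu> vs)))"
        by (rule tendsto_sum, rule tendsto_mult[OF tendsto_mult[OF tendsto_const coeff] self]) simp
    next
      show "(\<lambda>n. \<Sum>j<length vs. \<Sum>l<length (vs ! j). of_bool (matches b (vs ! j ! l)) * (1 / (of_nat (d n * D) * of_nat (d n)))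
          * F n (cross_word b' w (vs ! j ! l) (drop (Suc l) (vs ! j) @ take l (vs ! j))
            # take j vs @ drop (Suc j) vs))
        \<longlonglongrightarrow> (\<Sum>j<length vs. \<Sum>l<length (vs ! j). of_bool (matches b (vs ! j ! l)) * 0
          * prod_list (map \<mu> (cross_word b' w (vs ! j ! l) (drop (Suc l) (vs ! j) @ take l (vs ! j))
            # take j vs @ drop (Suc j) vs)))"
        by (rule tendsto_sum, rule tendsto_sum, rule tendsto_mult[OF tendsto_mult[OF tendsto_const limits(3)] cross]) simp_all
    qed
    have eq: "of_bool (b = b') * of_real c * (\<mu> w * prod_list (map \<mu> vs))
      + (\<Sum>l<length w. of_bool (matches b (w ! l)) * (if fst (w ! l) then 1 / of_nat D else 0)
          * (prod_list (map \<mu> (self_words b' (w ! l) (take l w) (drop (Suc l) w))) * prod_list (map \<mu> vs)))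
      + (\<Sum>j<length vs. \<Sum>l<length (vs ! j). of_bool (matches b (vs ! j ! l)) * 0
          * prod_list (map \<mu> (cross_word b' w (vs ! j ! l) (drop (Suc l) (vs ! j) @ take l (vs ! j))
            # take j vs @ drop (Suc j) vs)))
      = \<mu> ((True, b, b') # w) * prod_list (map \<mu> vs)"
    proof -
      have term_eq: "of_bool (matches b m) * (if fst m then 1 / of_nat D else 0) * (prod_list (map \<mu> (self_words b' m u v)) * r)
        = of_bool (fst m = True \<and> snd (snd m) = b) * (\<mu> v * \<mu> ((True, fst (snd m), b') # u)) / of_nat D * r" for m u v r
      proof -
        obtain s f f' where m: "m = (s, f, f')" by (cases m)
        show ?thesis
        proof (cases "s \<and> b = f'")
          case True
          then show ?thesis by (simp add: m matches_def self_words_def)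
        next
          case False
          then show ?thesis by (auto simp add: m matches_def)
        qed
      qed
      have "(\<Sum>l<length w. of_bool (matches b (w ! l)) * (if fst (w ! l) then 1 / of_nat D else 0)
          * (prod_list (map \<mu> (self_words b' (w ! l) (take l w) (drop (Suc l) w))) * prod_list (map \<mu> vs)))
        = (\<Sum>l<length w. of_bool (fst (w ! l) = True \<and> snd (snd (w ! l)) = b)
          * (\<mu> (drop (Suc l) w) * \<mu> ((True, fst (snd (w ! l)), b') # take l w))) / of_nat D * prod_list (map \<mu> vs)"
        unfolding sum_divide_distrib sum_distrib_right term_eq ..
      then show ?thesis
        unfolding limit_moment.simps(2)[of D c True b b' w] distrib_right
        by (simp only: mult_zero_right mult_zero_left sum.neutral_const add_0_right mult_ac)
    qed
    show ?thesis
      by (rule Lim_transform_eventually[OF lim[unfolded eq]])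
        (use d_pos in eventually_elim, use F_loop valid in simp)
  qed
  show ?case
  proof (cases ws)
    case Nil
    then show ?thesis by (simp add: F_Nil)
  next
    case (Cons w vs)
    show ?thesis
    proof (cases w)
      case Nil
      have "(\<lambda>n. F n vs) \<longlonglongrightarrow> prod_list (map \<mu> vs)" using IH[of vs] less.prems Cons by simp
      then have "(\<lambda>n. F n ([] # vs)) \<longlonglongrightarrow> prod_list (map \<mu> vs)"
        by (rule Lim_transform_eventually) (use d_pos in eventually_elim, simp add: F_Nil_Cons)
      then show ?thesis using Cons Nil by simp
    next
      case w: (Cons m u)
      obtain s b b' where m: "m = (s, b, b')" by (cases m)
      show ?thesis
      proof (cases s)
        case True
        then show ?thesis using step[of b b' u vs] less.prems Cons w m by simp
      next
        case False
        have "(\<lambda>n. F n (((True, b, b') # map conj_letter u) # map (map conj_letter) vs))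
            \<longlonglongrightarrow> \<mu> ((True, b, b') # map conj_letter u) * prod_list (map \<mu> (map (map conj_letter) vs))"
          using step[of b b' "map conj_letter u" "map (map conj_letter) vs"] less.prems Cons w m
          by (simp add: valid_word_simps list.pred_map o_def)
        moreover have "((True, b, b') # map conj_letter u) # map (map conj_letter) vs = map (map conj_letter) ws"
          using Cons w m False by (simp add: conj_letter_def)
        moreover have "\<mu> ((True, b, b') # map conj_letter u) = \<mu> w"
          using limit_moment_conj[of D c w] w m False by (simp add: conj_letter_def)
        ultimately show ?thesis
          using F_conj[OF less.prems] Cons by (simp add: o_def limit_moment_conj)
      qed
    qed
  qed
qed

end

section \<open>Vanishing of centred alternating products\<close>

text \<open>A variable is coloured by \<open>col\<close> according to whether it is transposed in the large factor,
  while \<open>sw\<close> says whether its blocks carry the two small indices in swapped order. The vector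
  \<open>\<kappa> s w\<close> records the result of closing the word \<open>w\<close> to the right of a half-contracted letter
  of colour \<open>s\<close>; its three entries are the coefficients of the three pairings in \<open>brauer\<close> below.\<close>

locale limit_law =
  fixes col sw :: "'i \<Rightarrow> bool" and D :: nat and c :: real
begin

text \<open>The effect on the three coefficients of the next contraction, derived in
  \<open>brauer_contract\<close>. A swapped variable exchanges the pairings 0 and 2. An unswapped
  one always produces pairing 1, and closes an index loop worth \<open>D\<close> if the pairing was
  already 1. Only the entries 0, 1 and 2 have a meaning.\<close>

definition trans :: "bool \<Rightarrow> (nat \<Rightarrow> complex) \<Rightarrow> nat \<Rightarrow> complex" where
  "trans b x i = (if b then x (2 - i) else if i = 1 then x 0 + of_nat D * x 1 + x 2 else 0)"

text \<open>In \<open>\<phi>\<close>, the sum over the small index between \<open>t\<close> and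
  \<open>w\<close> is pinned by two of the pairings and free for the third, which gets the factor
  \<open>D\<close>; this is pairing 2 for a swapped variable and pairing 1 for an unswapped
  one.\<close>

function (sequential) \<phi> :: "'i list \<Rightarrow> complex"
  and \<kappa> :: "bool \<Rightarrow> 'i list \<Rightarrow> nat \<Rightarrow> complex" where
  "\<phi> [] = 1"
| "\<phi> (t # w) = (if sw t then \<kappa> (col t) w 0 + \<kappa> (col t) w 1 + of_nat D * \<kappa> (col t) w 2
      else \<kappa> (col t) w 0 + of_nat D * \<kappa> (col t) w 1 + \<kappa> (col t) w 2)"
| "\<kappa> s w i = of_real c * of_bool (i = 0) * \<phi> w
    + (\<Sum>l<length w. of_bool (col (w ! l) = s) * \<phi> (drop (Suc l) w) * trans (sw (w ! l)) (\<lambda>j. \<kappa> s (take l w) j) i)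
      / of_nat D"
  by pat_completeness auto
termination
  \<comment> \<open>\<open>\<kappa> s w\<close> calls \<open>\<phi>\<close> on the same word and
    \<open>\<phi> (t # w)\<close> calls \<open>\<kappa>\<close> on the tail, so
    \<open>\<kappa>\<close> on a word has to rank strictly between.\<close>
  by (relation "Wellfounded.measure (\<lambda>x. case x of Inl w \<Rightarrow> 2 * length w | Inr (s, w, i) \<Rightarrow> 2 * length w + 1)") auto

declare \<kappa>.simps [simp del]

text \<open>\<open>cent F us\<close> is the linear extension of \<open>F\<close> evaluated at the product of the \<open>u - \<phi> u\<close>.\<close>

fun cent :: "('i list \<Rightarrow> complex) \<Rightarrow> 'i list list \<Rightarrow> complex" where
  "cent F [] = F []"
| "cent F (u # us) = cent (\<lambda>x. F (u @ x)) us - \<phi> u * cent F us"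

fun alternating :: "bool \<Rightarrow> 'i list list \<Rightarrow> bool" where
  "alternating k [] \<longleftrightarrow> True"
| "alternating k (u # us) \<longleftrightarrow> (\<forall>t\<in>set u. col t = k) \<and> alternating (\<not> k) us"

lemma alternating_append:
  "alternating k (us @ vs) \<longleftrightarrow> alternating k us \<and> alternating (if even (length us) then k else \<not> k) vs"
  by (induction us arbitrary: k) auto

lemma cent_add: "cent (\<lambda>x. F x + G x) us = cent F us + cent G us"
  by (induction us arbitrary: F G) (simp_all add: algebra_simps)

lemma cent_scale: "cent (\<lambda>x. a * F x) us = a * cent F us"
  by (induction us arbitrary: F) (simp_all add: algebra_simps)

lemma cent_scale_right: "cent (\<lambda>x. F x * a) us = cent F us * a"
  using cent_scale[of a F us] by (simp add: mult.commute)

lemma cent_diff: "cent (\<lambda>x. F x - G x) us = cent F us - cent G us"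
  using cent_add[of F "\<lambda>x. - 1 * G x" us] cent_scale[of "- 1" G us] by simp

lemma cent_zero: "cent (\<lambda>x. 0) us = 0"
  by (induction us) simp_all

lemma cent_divide: "cent (\<lambda>x. F x / a) us = cent F us / a"
  using cent_scale_right[of F "inverse a" us] by (simp add: divide_inverse)

lemma cent_sum: "cent (\<lambda>x. \<Sum>i\<in>A. F i x) us = (\<Sum>i\<in>A. cent (F i) us)"
  by (induction A rule: infinite_finite_induct) (simp_all add: cent_zero cent_add)

lemma cent_append: "cent F (us @ vs) = cent (\<lambda>x. cent (\<lambda>y. F (x @ y)) vs) us"
  by (induction us arbitrary: F) simp_all

lemma cent_trans: "cent (\<lambda>x. trans b (F x) i) us = trans b (\<lambda>j. cent (\<lambda>x. F x j) us) i"
  by (simp add: trans_def cent_add cent_scale cent_zero)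

section \<open>Sums over the splits of a word\<close>

definition spl :: "('i list \<Rightarrow> 'i \<Rightarrow> 'i list \<Rightarrow> complex) \<Rightarrow> 'i list \<Rightarrow> complex" where
  "spl h w = (\<Sum>l<length w. h (take l w) (w ! l) (drop (Suc l) w))"

lemma spl_Cons: "spl h (t # w) = h [] t w + spl (\<lambda>x. h (t # x)) w"
  by (simp add: spl_def sum.lessThan_Suc_shift del: sum.lessThan_Suc)

lemma spl_append: "spl h (u @ v) = spl (\<lambda>x t y. h x t (y @ v)) u + spl (\<lambda>x t y. h (u @ x) t y) v"
proof (induction u arbitrary: h)
  case Nil
  show ?case by (simp add: spl_def)
qed (simp add: spl_Cons)

lemma spl_zero: "(\<And>x t y. w = x @ t # y \<Longrightarrow> h x t y = 0) \<Longrightarrow> spl h w = 0"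
  unfolding spl_def by (intro sum.neutral) (auto simp: id_take_nth_drop)

lemma spl_diff: "spl (\<lambda>x t y. h x t y - h' x t y) w = spl h w - spl h' w"
  by (simp add: spl_def sum_subtractf)

lemma spl_scale: "spl (\<lambda>x t y. a * h x t y) w = a * spl h w"
  by (simp add: spl_def sum_distrib_left)

lemma cent_spl: "cent (\<lambda>x. spl (h x) w) us = spl (\<lambda>x t y. cent (\<lambda>z. h z x t y) us) w"
  by (simp add: spl_def cent_sum)

text \<open>The product rule: a split of a centred product takes place inside one of its factors or in
  the tail, and the factors before and after it stay centred.\<close>

lemma cent_spl_eq_0:
  assumes blocks: "\<And>j x t y. j < length us \<Longrightarrow> us ! j = x @ t # y \<Longrightarrow>
      cent (\<lambda>X. cent (\<lambda>Y. h (X @ x) t (y @ Y @ s)) (drop (Suc j) us)) (take j us) = 0"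
    and tail: "\<And>x t y. s = x @ t # y \<Longrightarrow> cent (\<lambda>X. h (X @ x) t y) us = 0"
  shows "cent (\<lambda>x. spl h (x @ s)) us = 0"
  using assms
proof (induction us arbitrary: h)
  case Nil
  then show ?case by (simp add: spl_zero)
next
  case (Cons u us)
  have "cent (\<lambda>x. spl (\<lambda>X t y. h X t (y @ x @ s)) u) us = 0"
    unfolding cent_spl by (rule spl_zero) (use Cons.prems(1)[of 0] in simp)
  \<comment> \<open>Splits inside \<open>u\<close> are gone. Later splits see \<open>u\<close> only
    as a prefix, so its centring can be absorbed into the split function, which is why the induction
    generalizes over \<open>h\<close>.\<close>
  then have "cent (\<lambda>x. spl h (x @ s)) (u # us)
      = cent (\<lambda>x. spl (\<lambda>X t y. h (u @ X) t y - \<phi> u * h X t y) (x @ s)) us"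
    by (simp add: spl_append cent_add spl_diff spl_scale cent_diff cent_scale algebra_simps)
  also have "\<dots> = 0"
  proof (rule Cons.IH)
    fix j x t y assume "j < length us" "us ! j = x @ t # y"
    then show "cent (\<lambda>X. cent (\<lambda>Y. h (u @ X @ x) t (y @ Y @ s) - \<phi> u * h (X @ x) t (y @ Y @ s)) (drop (Suc j) us)) (take j us) = 0"
      using Cons.prems(1)[of "Suc j" x t y] by (simp add: cent_diff cent_scale)
  next
    fix x t y assume "s = x @ t # y"
    then show "cent (\<lambda>X. h (u @ X @ x) t y - \<phi> u * h (X @ x) t y) us = 0"
      using Cons.prems(2) by (simp add: cent_diff cent_scale)
  qed
  finally show ?case .
qed

text \<open>Each flank is its centred version plus a scalar, which gives four centred alternating
  products; \<open>us \<noteq> []\<close> ensures that the one without flanks is not the empty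
  product.\<close>

lemma cent_phi_flanked:
  assumes centred: "\<forall>k us. us \<noteq> [] \<longrightarrow> alternating k us \<longrightarrow> length (concat us) \<le> m \<longrightarrow> cent \<phi> us = 0"
    and alt: "alternating (\<not> k) (r # us @ [s])" and ne: "us \<noteq> []"
    and size: "length r + length (concat us) + length s \<le> m"
  shows "cent (\<lambda>x. \<phi> (r @ x @ s)) us = 0"
proof -
  have tail: "cent (\<lambda>x. F (x @ s)) us = cent F (us @ [s]) + \<phi> s * cent F us" for F
    by (simp add: cent_append cent_diff cent_scale)
  have "cent (\<lambda>x. \<phi> (r @ x @ s)) us
      = cent \<phi> (r # us @ [s]) + \<phi> r * cent \<phi> (us @ [s]) + \<phi> s * (cent \<phi> (r # us) + \<phi> r * cent \<phi> us)"
    using tail[of "\<lambda>x. \<phi> (r @ x)"] by (simp add: algebra_simps)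
  also have "\<dots> = 0"
  proof -
    have alt': "alternating k (us @ [s])" "alternating (\<not> k) (r # us)" "alternating k us"
      using alt by (auto simp: alternating_append)
    have zero: "cent \<phi> vs = 0" if "alternating k' vs" "vs \<noteq> []" "length (concat vs) \<le> length r + length (concat us) + length s" for vs k'
      using centred that size by (meson order_trans)
    have "cent \<phi> (r # us @ [s]) = 0" by (rule zero[OF alt]) simp_all
    moreover have "cent \<phi> (us @ [s]) = 0" by (rule zero[OF alt'(1)]) simp_all
    moreover have "cent \<phi> (r # us) = 0" by (rule zero[OF alt'(2)]) simp_all
    moreover have "cent \<phi> us = 0" by (rule zero[OF alt'(3) ne]) simp
    ultimately have "cent \<phi> (r # us @ [s]) = 0" "cent \<phi> (r # us) = 0" "cent \<phi> (us @ [s]) = 0" "cent \<phi> us = 0"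
      by (simp_all only:)
    then show ?thesis by (simp only: mult_zero_right add_0_left)
  qed
  finally show ?thesis .
qed

text \<open>The half-contracted letter has the colour of \<open>r\<close>, and so must its partner.
  A partner in \<open>r\<close> leaves all of \<open>us\<close> to the \<open>\<phi>\<close> factor,
  where the previous lemma applies; one in \<open>s\<close> leaves all of \<open>us\<close> to the
  shorter \<open>\<kappa>\<close> factor; one inside \<open>us\<close> leaves a nonempty initial
  part of \<open>us\<close> there. The flanks make room for the pieces of the factor that is
  cut.\<close>

lemma cent_kappa_flanked:
  assumes centred: "\<forall>k us. us \<noteq> [] \<longrightarrow> alternating k us \<longrightarrow> length (concat us) \<le> m \<longrightarrow> cent \<phi> us = 0"
    and "alternating (\<not> k) (r # us @ [s])" "us \<noteq> []"
    and "length r + length (concat us) + length s \<le> m"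
  shows "cent (\<lambda>x. \<kappa> (\<not> k) (r @ x @ s) i) us = 0"
  using assms(2-)
proof (induction "length r + length (concat us) + length s" arbitrary: r us s i rule: less_induct)
  case less
  note alt = less.prems(1) and ne = less.prems(2) and size = less.prems(3)
  note flanked = cent_phi_flanked[OF centred]
  define h where "h X t Y = of_bool (col t = (\<not> k)) * \<phi> Y * trans (sw t) (\<lambda>j. \<kappa> (\<not> k) X j) i" for X t Y
  have kappa: "\<kappa> (\<not> k) w i = of_real c * of_bool (i = 0) * \<phi> w + spl h w / of_nat D" for w
    by (simp add: \<kappa>.simps[of _ w] spl_def h_def)
  have trans0: "cent (\<lambda>X. trans b (\<lambda>j. \<kappa> (\<not> k) (r @ X @ x) j) i') vs = 0"
    if "alternating (\<not> k) (r # vs @ [x])" "vs \<noteq> []"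
      "length r + length (concat vs) + length x < length r + length (concat us) + length s" for b x vs i'
    unfolding cent_trans using less.hyps[OF that(3,1,2)] that(3) size by (simp add: trans_def)
  have "cent (\<lambda>x. \<phi> (r @ x @ s)) us = 0"
    by (rule flanked[OF alt ne size])
  moreover have "cent (\<lambda>x. spl (\<lambda>X t Y. h X t (Y @ x @ s)) r) us = 0"
    unfolding cent_spl
  proof (rule spl_zero)
    fix x t y assume r: "r = x @ t # y"
    have "cent (\<lambda>z. \<phi> (y @ z @ s)) us = 0"
      by (rule flanked[OF _ ne, of k]) (use alt size r in auto)
    then show "cent (\<lambda>z. h x t (y @ z @ s)) us = 0"
      unfolding h_def by (simp add: cent_scale cent_scale_right)
  qed
  moreover have "cent (\<lambda>x. spl (\<lambda>X t Y. h (r @ X) t Y) (x @ s)) us = 0"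
  proof (rule cent_spl_eq_0)
    fix j x t y assume j: "j < length us" "us ! j = x @ t # y"
    have us: "us = take j us @ (x @ t # y) # drop (Suc j) us"
      using j by (metis id_take_nth_drop)
    have alt_us: "alternating k (take j us @ (x @ t # y) # drop (Suc j) us)"
      using alt us by (simp add: alternating_append)
    show "cent (\<lambda>X. cent (\<lambda>Y. h (r @ X @ x) t (y @ Y @ s)) (drop (Suc j) us)) (take j us) = 0"
    proof (cases "col t = (\<not> k)")
      case True
      \<comment> \<open>The first factor of \<open>us\<close> has the wrong colour for a partner, so
        at least one centred factor lies to the left of \<open>t\<close>.\<close>
      then have "take j us \<noteq> []" using alt_us by (cases "take j us") auto
      moreover have "alternating (\<not> k) (r # take j us @ [x])"
        using alt alt_us by (simp add: alternating_append split: if_splits)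
      moreover have "length (concat us) = length (concat (take j us)) + length (x @ t # y) + length (concat (drop (Suc j) us))"
        by (subst us) simp
      ultimately have "cent (\<lambda>X. trans (sw t) (\<lambda>j. \<kappa> (\<not> k) (r @ X @ x) j) i) (take j us) = 0"
        by (intro trans0) auto
      then show ?thesis by (simp add: h_def cent_scale cent_scale_right mult.assoc)
    next
      case False
      then show ?thesis by (simp add: h_def cent_zero)
    qed
  next
    fix x t y assume s: "s = x @ t # y"
    have "cent (\<lambda>X. trans (sw t) (\<lambda>j. \<kappa> (\<not> k) (r @ X @ x) j) i) us = 0"
      using alt ne s by (intro trans0) (auto simp: alternating_append split: if_splits)
    then show "cent (\<lambda>X. h (r @ X @ x) t y) us = 0"
      by (simp add: h_def cent_scale mult.assoc)
  qed
  ultimately show ?case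
    unfolding kappa by (simp add: cent_add cent_scale cent_divide spl_append)
qed

text \<open>Opening the first letter \<open>t\<close> expresses \<open>\<phi>\<close> through
  \<open>\<kappa> (col t)\<close>, with the rest \<open>r\<close> of its factor as an uncentred left
  flank and one letter fewer in total. The next factor has the other colour, as
  \<open>cent_kappa_flanked\<close> requires.\<close>

theorem cent_phi_eq_0: "us \<noteq> [] \<Longrightarrow> alternating k us \<Longrightarrow> cent \<phi> us = 0"
proof (induction "length (concat us)" arbitrary: k us rule: less_induct)
  case less
  then obtain u us' where us: "us = u # us'" by (cases us) auto
  show ?case
  proof (cases u)
    case Nil
    then show ?thesis by (simp add: us)
  next
    case (Cons t r)
    show ?thesis
    proof (cases "us' = []")
      case True
      then show ?thesis by (simp add: us)
    next
      case False
      have alt: "alternating (\<not> k) us'" "\<forall>t\<in>set (t # r). col t = k" using less.prems us Cons by auto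
      have centred: "\<forall>k vs. vs \<noteq> [] \<longrightarrow> alternating k vs \<longrightarrow> length (concat vs) \<le> length r + length (concat us')
          \<longrightarrow> cent \<phi> vs = 0"
      proof (intro allI impI)
        fix k vs
        assume vs: "vs \<noteq> []" "alternating k vs" "length (concat vs) \<le> length r + length (concat us')"
        show "cent \<phi> vs = 0"
          by (rule less.hyps[OF _ vs(1,2)]) (use vs(3) us Cons in simp)
      qed
      have kappa: "cent (\<lambda>x. \<kappa> (col t) (r @ x) i) us' = 0" for i
        using cent_kappa_flanked[OF centred, of "\<not> k" r us' "[]" i] alt False
        by (simp add: alternating_append)
      have "cent (\<lambda>x. \<phi> (u @ x)) us' = 0"
        using kappa by (cases "sw t") (simp_all add: Cons cent_add cent_scale)
      moreover have "cent \<phi> us' = 0"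
        by (rule centred[rule_format, OF False alt(1)]) simp
      ultimately show ?thesis by (simp add: us)
    qed
  qed
qed

section \<open>Extension to polynomials, and freeness of the two colours\<close>

definition \<Phi> :: "'i nc_poly \<Rightarrow> complex" where
  "\<Phi> f = (\<Sum>w\<in>Poly_Mapping.keys f. Poly_Mapping.lookup f w * \<phi> (letters w))"

lemma Phi_single [simp]: "\<Phi> (Poly_Mapping.single w a) = a * \<phi> (letters w)"
  by (simp add: \<Phi>_def)

lemma Phi_add: "\<Phi> (f + g) = \<Phi> f + \<Phi> g"
  unfolding \<Phi>_def by (rule setsum_keys_plus_distrib) (simp_all add: distrib_right)

lemma Phi_one [simp]: "\<Phi> 1 = 1"
  by (simp add: zero_free_monoid_def flip: single_one)

lemma Phi_scale: "\<Phi> (ncp_scale a f) = a * \<Phi> f"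
  by (induction f rule: ncp_induct)
    (simp_all add: Phi_add distrib_left vector_space.vector_space_assms(1)[OF vector_space_ncp_scale])

lemma Phi_zero [simp]: "\<Phi> 0 = 0"
  by (simp add: \<Phi>_def)

lemma Phi_diff: "\<Phi> (f - g) = \<Phi> f - \<Phi> g"
  using Phi_add[of "f - g" g] by simp

lemma Phi_sum: "\<Phi> (\<Sum>i\<in>A. f i) = (\<Sum>i\<in>A. \<Phi> (f i))"
  by (induction A rule: infinite_finite_induct) (simp_all add: Phi_add)

lemma nc_prob_space_Phi: "nc_prob_space ncp_scale \<Phi>"
proof -
  interpret P: vector_space "ncp_scale :: complex \<Rightarrow> 'i nc_poly \<Rightarrow> _"
    by (rule vector_space_ncp_scale)
  show ?thesis
    by unfold_locales
      (auto simp: ncp_scale_mult_left [symmetric] ncp_scale_mult_right [symmetric]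
        Phi_add Phi_scale algebra_simps)
qed

definition centred :: "'i nc_poly \<Rightarrow> 'i nc_poly" where
  "centred a = a - ncp_scale (\<Phi> a) 1"

abbreviation word :: "'i list \<Rightarrow> 'i nc_poly" where
  "word u \<equiv> Poly_Mapping.single (Word u) 1"

lemma Phi_centred_words:
  "\<Phi> (word v * prod_list (map (\<lambda>u. centred (word u)) us)) = cent (\<lambda>x. \<phi> (v @ x)) us"
proof (induction us arbitrary: v)
  case (Cons u us)
  let ?P = "prod_list (map (\<lambda>u. centred (word u)) us)"
  have "word v * prod_list (map (\<lambda>u. centred (word u)) (u # us)) = word (v @ u) * ?P - ncp_scale (\<phi> u) (word v * ?P)"
  proof -
    have "word v * (word u * ?P) = word (v @ u) * ?P"
      by (simp add: mult_single plus_free_monoid_def flip: mult.assoc)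
    moreover have "word v * (ncp_scale (\<phi> u) 1 * ?P) = ncp_scale (\<phi> u) (word v * ?P)"
      by (simp only: ncp_scale_mult_left[symmetric] ncp_scale_mult_right[symmetric] mult_1)
    ultimately show ?thesis by (simp add: centred_def algebra_simps)
  qed
  then show ?case by (simp only: Phi_diff Phi_scale Cons.IH cent.simps append_assoc)
qed simp

lemma centred_eq_sum:
  "centred a = (\<Sum>w\<in>Poly_Mapping.keys a. ncp_scale (Poly_Mapping.lookup a w) (centred (word (letters w))))"
proof -
  interpret P: vector_space "ncp_scale :: complex \<Rightarrow> 'i nc_poly \<Rightarrow> _"
    by (rule vector_space_ncp_scale)
  have a: "a = (\<Sum>w\<in>Poly_Mapping.keys a. ncp_scale (Poly_Mapping.lookup a w) (word (letters w)))"
    by (rule poly_mapping_eqI) (simp add: lookup_sum lookup_single when_def not_in_keys_iff_lookup_eq_zero)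
  have "centred a = (\<Sum>w\<in>Poly_Mapping.keys a. ncp_scale (Poly_Mapping.lookup a w) (word (letters w)))
      - ncp_scale (\<Phi> a) 1"
    unfolding centred_def by (rule arg_cong[OF a, of "\<lambda>x. x - ncp_scale (\<Phi> a) 1"])
  also have "\<dots> = (\<Sum>w\<in>Poly_Mapping.keys a. ncp_scale (Poly_Mapping.lookup a w) (centred (word (letters w))))"
    unfolding \<Phi>_def[of a]
    by (simp only: centred_def P.scale_right_diff_distrib sum_subtractf P.scale_sum_left P.scale_scale
      Phi_single mult_1_left free_monoid.collapse free_monoid.sel)
  finally show ?thesis .
qed

fun alternating_polys :: "bool \<Rightarrow> 'i nc_poly list \<Rightarrow> bool" where
  "alternating_polys k [] \<longleftrightarrow> True"
| "alternating_polys k (a # as) \<longleftrightarrow>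
    Poly_Mapping.keys a \<subseteq> Word ` lists {t. col t = k} \<and> alternating_polys (\<not> k) as"

text \<open>Multilinearity, one factor at a time from the left: \<open>us\<close> collects the words
  already picked from earlier factors, so that the base case is
  \<open>cent_phi_eq_0\<close>.\<close>

lemma Phi_centred_polys:
  assumes "alternating k us" "alternating_polys (if even (length us) then k else \<not> k) as" "us \<noteq> [] \<or> as \<noteq> []"
  shows "\<Phi> (prod_list (map (\<lambda>u. centred (word u)) us) * prod_list (map centred as)) = 0"
  using assms
proof (induction as arbitrary: us)
  case Nil
  have "word [] = 1" by (simp only: zero_free_monoid_def[symmetric] single_one)
  then show ?case
    using Phi_centred_words[of "[]" us] cent_phi_eq_0[of us k] Nil by simp
next
  case (Cons a as)
  let ?U = "prod_list (map (\<lambda>u. centred (word u)) us)" and ?A = "prod_list (map centred as)"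
  have "?U * prod_list (map centred (a # as))
      = (\<Sum>w\<in>Poly_Mapping.keys a. ncp_scale (Poly_Mapping.lookup a w) (?U * centred (word (letters w)) * ?A))"
  proof -
    have pull: "?U * (ncp_scale e f * ?A) = ncp_scale e (?U * f * ?A)" for e f
      by (simp only: ncp_scale_mult_left[symmetric] ncp_scale_mult_right[symmetric] mult.assoc)
    show ?thesis
      unfolding list.map prod_list.Cons
      by (subst centred_eq_sum[of a]) (simp only: sum_distrib_left sum_distrib_right pull)
  qed
  moreover have "\<Phi> (?U * centred (word (letters w)) * ?A) = 0" if "w \<in> Poly_Mapping.keys a" for w
  proof -
    have "letters w \<in> lists {t. col t = (if even (length us) then k else \<not> k)}"
      using Cons.prems(2) that by auto
    then have "alternating k (us @ [letters w])"
      using Cons.prems(1) by (auto simp: alternating_append)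
    moreover have "alternating_polys (if even (length (us @ [letters w])) then k else \<not> k) as"
      using Cons.prems(2) by (cases "even (length us)") simp_all
    ultimately have "\<Phi> (prod_list (map (\<lambda>u. centred (word u)) (us @ [letters w])) * ?A) = 0"
      by (rule Cons.IH) simp
    then show ?thesis
      by (simp only: map_append list.map prod_list.append prod_list.Cons prod_list.Nil mult_1_right)
  qed
  ultimately show ?case by (simp add: Phi_sum Phi_scale)
qed

theorem free_sets_Phi: "free_sets ncp_scale \<Phi> (ncp_var ` {t. col t}) (ncp_var ` {t. \<not> col t})"
  unfolding free_sets_def free_family_def
proof (intro allI impI, elim conjE)
  fix ks as
  assume ne: "as \<noteq> []" and adj: "distinct_adj ks"
    and as: "list_all2 (\<lambda>k a. a \<in> (if k then generated_algebra ncp_scale (ncp_var ` {t. col t})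
      else generated_algebra ncp_scale (ncp_var ` {t. \<not> col t})) \<and> \<Phi> a = 0) ks as"
  from as adj have "alternating_polys (hd ks) as \<and> map centred as = as"
  proof (induction rule: list_all2_induct)
    case (Cons k ks a as)
    have "Poly_Mapping.keys a \<subseteq> Word ` lists {t. col t = k}"
      using Cons(1) keys_generated_ncp[of a "{t. col t = k}"] by (cases k) simp_all
    moreover have "as \<noteq> [] \<Longrightarrow> hd ks = (\<not> k)"
      using Cons(2) Cons.prems by (cases ks) auto
    then have "alternating_polys (\<not> k) as"
      using Cons.IH Cons.prems Cons(2) by (cases "as = []") (auto simp: distinct_adj_Cons)
    moreover have "centred a = a" using Cons(1)
      by (simp add: centred_def ncp_scale_def)
    ultimately show ?case
      using Cons.IH Cons.prems Cons(2) by (cases "as = []") (auto simp: distinct_adj_Cons)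
  qed simp
  then show "\<Phi> (prod_list as) = 0"
    using Phi_centred_polys[of "hd ks" "[]" as] ne by simp
qed

end

section \<open>Summing over the indices of the small factor\<close>

context limit_law
begin

definition lab :: "'i \<Rightarrow> nat \<Rightarrow> nat \<Rightarrow> letter" where
  "lab t b b' = (col t, if sw t then b' else b, if sw t then b else b')"

text \<open>Matrix multiplication in the small factor, with a functional \<open>h\<close> of the
  resulting block word in place of its value. Entries, traces, expectations and limits are all
  obtained by varying \<open>h\<close>.\<close>

fun path_sum :: "(letter list \<Rightarrow> complex) \<Rightarrow> 'i list \<Rightarrow> nat \<Rightarrow> nat \<Rightarrow> complex" where
  "path_sum h [] b b' = of_bool (b = b') * h []"
| "path_sum h (t # w) b b' = (\<Sum>\<beta><D. path_sum (\<lambda>x. h (lab t b \<beta> # x)) w \<beta> b')"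

lemma path_sum_add: "path_sum (\<lambda>x. h x + h' x) w b b' = path_sum h w b b' + path_sum h' w b b'"
  by (induction w arbitrary: h h' b) (simp_all add: algebra_simps sum.distrib)

lemma path_sum_scale: "path_sum (\<lambda>x. r * h x) w b b' = r * path_sum h w b b'"
  by (induction w arbitrary: h b) (simp_all add: sum_distrib_left)

lemma path_sum_scale_right: "path_sum (\<lambda>x. h x * r) w b b' = path_sum h w b b' * r"
  using path_sum_scale[of r h w b b'] by (simp add: mult.commute)

lemma path_sum_divide: "path_sum (\<lambda>x. h x / r) w b b' = path_sum h w b b' / r"
  using path_sum_scale_right[of h "inverse r" w b b'] by (simp add: divide_inverse)

lemma path_sum_zero: "path_sum (\<lambda>x. 0) w b b' = 0"
  by (induction w arbitrary: b) simp_all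

lemma path_sum_sum: "path_sum (\<lambda>x. \<Sum>i\<in>A. h i x) w b b' = (\<Sum>i\<in>A. path_sum (h i) w b b')"
  by (induction A rule: infinite_finite_induct) (simp_all add: path_sum_zero path_sum_add)

text \<open>Transfers the sum over partners in \<open>limit_moment\<close> to words in the
  variables: cutting at a letter breaks the path at the two small indices of that letter.\<close>

lemma path_sum_split:
  assumes "b < D"
  shows "path_sum (\<lambda>x. \<Sum>l<length x. H (take l x) (x ! l) (drop (Suc l) x)) w b b'
    = (\<Sum>l<length w. \<Sum>\<beta><D. \<Sum>\<beta>'<D.
        path_sum (\<lambda>x. path_sum (\<lambda>y. H x (lab (w ! l) \<beta> \<beta>') y) (drop (Suc l) w) \<beta>' b') (take l w) b \<beta>)"
  using assms
proof (induction w arbitrary: H b)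
  case Nil
  show ?case by simp
next
  case (Cons t w)
  let ?S = "\<lambda>l \<gamma> \<beta> \<beta>'. path_sum (\<lambda>x. path_sum (\<lambda>y. H (lab t b \<gamma> # x) (lab (w ! l) \<beta> \<beta>') y) (drop (Suc l) w) \<beta>' b')
      (take l w) \<gamma> \<beta>"
  have IH: "path_sum (\<lambda>x. \<Sum>l<length x. H (lab t b \<gamma> # take l x) (x ! l) (drop (Suc l) x)) w \<gamma> b'
      = (\<Sum>l<length w. \<Sum>\<beta><D. \<Sum>\<beta>'<D. ?S l \<gamma> \<beta> \<beta>')" if "\<gamma> < D" for \<gamma>
    using Cons.IH[OF that, of "\<lambda>x. H (lab t b \<gamma> # x)"] .
  have "path_sum (\<lambda>x. \<Sum>l<length x. H (take l x) (x ! l) (drop (Suc l) x)) (t # w) b b'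
      = (\<Sum>\<gamma><D. path_sum (H [] (lab t b \<gamma>)) w \<gamma> b') + (\<Sum>\<gamma><D. \<Sum>l<length w. \<Sum>\<beta><D. \<Sum>\<beta>'<D. ?S l \<gamma> \<beta> \<beta>')"
    by (simp add: sum.lessThan_Suc_shift path_sum_add IH sum.distrib del: sum.lessThan_Suc)
  also have "(\<Sum>\<gamma><D. \<Sum>l<length w. \<Sum>\<beta><D. \<Sum>\<beta>'<D. ?S l \<gamma> \<beta> \<beta>')
      = (\<Sum>l<length w. \<Sum>\<gamma><D. \<Sum>\<beta><D. \<Sum>\<beta>'<D. ?S l \<gamma> \<beta> \<beta>')"
    by (rule sum.swap)
  also have "\<dots> = (\<Sum>l<length w. \<Sum>\<beta><D. \<Sum>\<gamma><D. \<Sum>\<beta>'<D. ?S l \<gamma> \<beta> \<beta>')"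
    by (rule sum.cong[OF refl], rule sum.swap)
  also have "\<dots> = (\<Sum>l<length w. \<Sum>\<beta><D. \<Sum>\<beta>'<D. \<Sum>\<gamma><D. ?S l \<gamma> \<beta> \<beta>')"
    by (rule sum.cong[OF refl], rule sum.cong[OF refl], rule sum.swap)
  also have "(\<Sum>\<gamma><D. path_sum (H [] (lab t b \<gamma>)) w \<gamma> b')
      = (\<Sum>\<beta><D. \<Sum>\<beta>'<D. path_sum (\<lambda>x. path_sum (\<lambda>y. H x (lab t \<beta> \<beta>') y) w \<beta>' b') [] b \<beta>)"
    using Cons.prems by (simp add: sum_of_bool_mult flip: sum_distrib_left)
  finally show ?case
    by (simp add: sum.lessThan_Suc_shift del: sum.lessThan_Suc)
qed

abbreviation \<nu> :: "letter list \<Rightarrow> complex" where "\<nu> \<equiv> limit_moment D c"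

text \<open>By orthogonal invariance in the small factor,
  the limits of open words are scalar, and those with a half-contracted letter are combinations of
  the three pairings of the four open indices.\<close>

definition brauer :: "bool \<Rightarrow> 'i list \<Rightarrow> nat \<Rightarrow> nat \<Rightarrow> nat \<Rightarrow> nat \<Rightarrow> complex" where
  "brauer s w e e' b b' = \<kappa> s w 0 * of_bool (e = e' \<and> b = b') + \<kappa> s w 1 * of_bool (b' = e \<and> b = e')
    + \<kappa> s w 2 * of_bool (e = b \<and> e' = b')"

text \<open>Explains \<open>trans\<close>. For a swapped variable both sums are fixed by deltas and
  the open indices of the pairings trade places. For an unswapped one \<open>\<beta>\<close> stays
  free: pairing 1 does not involve it and yields \<open>D\<close>, the others determine it and yield
  1.\<close>

lemma brauer_contract:
  assumes "e < D" "e' < D" "b < D" "b' < D"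
  shows "(\<Sum>\<beta><D. \<Sum>\<beta>'<D. of_bool (col t = s \<and> snd (snd (lab t \<beta> \<beta>')) = e) *
      (of_bool (\<beta>' = b') * r * brauer s w (fst (snd (lab t \<beta> \<beta>'))) e' b \<beta>))
    = of_bool (col t = s) * r * (trans (sw t) (\<kappa> s w) 0 * of_bool (e = e' \<and> b = b')
      + trans (sw t) (\<kappa> s w) 1 * of_bool (b' = e \<and> b = e') + trans (sw t) (\<kappa> s w) 2 * of_bool (e = b \<and> e' = b'))"
    (is "?lhs = ?rhs")
proof (cases "col t = s")
  case True
  show ?thesis
  proof (cases "sw t")
    case sw: True
    have "?lhs = (\<Sum>\<beta><D. of_bool (\<beta> = e) * (\<Sum>\<beta>'<D. of_bool (\<beta>' = b') * (r * brauer s w \<beta>' e' b \<beta>)))"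
      unfolding sum_distrib_left by (intro sum.cong refl) (simp add: True sw lab_def)
    also have "\<dots> = r * brauer s w b' e' b e"
      using assms by (simp only: sum_of_bool_mult)
    also have "\<dots> = ?rhs"
    proof -
      have "(b' = e' \<and> b = e) = (e = b \<and> e' = b')" "(e = b' \<and> b = e') = (b' = e \<and> b = e')"
        "(b' = b \<and> e' = e) = (e = e' \<and> b = b')" by auto
      then show ?thesis using True sw by (simp add: brauer_def trans_def add_ac)
    qed
    finally show ?thesis .
  next
    case sw: False
    have "?lhs = (\<Sum>\<beta><D. \<Sum>\<beta>'<D. of_bool (\<beta>' = b') * (of_bool (\<beta>' = e) * r * brauer s w \<beta> e' b \<beta>))"
      by (intro sum.cong refl) (simp add: True sw lab_def)
    also have "\<dots> = of_bool (b' = e) * r * (\<Sum>\<beta><D. brauer s w \<beta> e' b \<beta>)"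
      using assms by (simp only: sum_of_bool_mult sum_distrib_left)
    also have "(\<Sum>\<beta><D. brauer s w \<beta> e' b \<beta>)
        = (\<Sum>\<beta><D. of_bool (\<beta> = b) * (\<kappa> s w 0 * of_bool (b = e')))
          + of_nat D * (\<kappa> s w 1 * of_bool (b = e'))
          + (\<Sum>\<beta><D. of_bool (\<beta> = b) * (\<kappa> s w 2 * of_bool (b = e')))"
    proof -
      have "brauer s w \<beta> e' b \<beta> = of_bool (\<beta> = b) * (\<kappa> s w 0 * of_bool (b = e')) + \<kappa> s w 1 * of_bool (b = e')
          + of_bool (\<beta> = b) * (\<kappa> s w 2 * of_bool (b = e'))" for \<beta>
        by (auto simp: brauer_def)
      then show ?thesis by (simp add: sum.distrib)
    qed
    also have "\<dots> = (\<kappa> s w 0 + of_nat D * \<kappa> s w 1 + \<kappa> s w 2) * of_bool (b = e')"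
      using assms by (simp only: sum_of_bool_mult) (simp add: algebra_simps)
    also have "of_bool (b' = e) * r * \<dots> = ?rhs"
      using True sw by (simp add: trans_def of_bool_conj)
    finally show ?thesis .
  qed
qed simp

text \<open>The claims need each other: the first for \<open>w\<close> reduces to the second for the
  tail of \<open>w\<close>, while the second for \<open>w\<close> uses the first for the same
  \<open>w\<close> and both for shorter words. Hence \<open>scalar\<close> is settled first.\<close>

lemma path_sum_moments:
  "(\<forall>b<D. \<forall>b'<D. path_sum \<nu> w b b' = of_bool (b = b') * \<phi> w) \<and>
    (\<forall>s. \<forall>e<D. \<forall>e'<D. \<forall>b<D. \<forall>b'<D. path_sum (\<lambda>x. \<nu> ((s, e, e') # x)) w b b' = brauer s w e e' b b')"
proof (induction w rule: length_induct)
  case (1 w)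
  have IH_phi: "path_sum \<nu> v b b' = of_bool (b = b') * \<phi> v"
    if "length v < length w" "b < D" "b' < D" for v b b'
    by (rule 1[THEN spec, THEN mp, OF that(1), THEN conjunct1, rule_format, OF that(2,3)])
  have IH_brauer: "path_sum (\<lambda>x. \<nu> ((s, e, e') # x)) v b b' = brauer s v e e' b b'"
    if "length v < length w" "e < D" "e' < D" "b < D" "b' < D" for v b b' s e e'
    by (rule 1[THEN spec, THEN mp, OF that(1), THEN conjunct2, rule_format, OF that(2-5)])
  have scalar: "path_sum \<nu> w b b' = of_bool (b = b') * \<phi> w" if b: "b < D" "b' < D" for b b'
  proof (cases w)
    case Nil
    then show ?thesis by (simp only: path_sum.simps \<phi>.simps limit_moment.simps(1))
  next
    case (Cons t v)
    have "path_sum \<nu> w b b' = (\<Sum>\<beta><D. brauer (col t) v (if sw t then \<beta> else b) (if sw t then b else \<beta>) \<beta> b')"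
      unfolding Cons path_sum.simps lab_def
      by (intro sum.cong refl IH_brauer) (use b Cons in auto)
    also have "\<dots> = of_bool (b = b') * \<phi> w"
    proof (cases "sw t")
      case True
      have "brauer (col t) v \<beta> b \<beta> b' = of_bool (\<beta> = b) * (of_bool (b = b') * (\<kappa> (col t) v 0 + \<kappa> (col t) v 1))
          + of_bool (b = b') * \<kappa> (col t) v 2" for \<beta>
        by (auto simp: brauer_def)
      then have "(\<Sum>\<beta><D. brauer (col t) v \<beta> b \<beta> b')
          = of_bool (b = b') * (\<kappa> (col t) v 0 + \<kappa> (col t) v 1) + of_nat D * (of_bool (b = b') * \<kappa> (col t) v 2)"
        using b by (simp only: sum.distrib sum_of_bool_mult sum_constant card_lessThan)
      then show ?thesis by (simp add: Cons True algebra_simps)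
    next
      case False
      have "brauer (col t) v b \<beta> \<beta> b' = of_bool (\<beta> = b) * (of_bool (b = b') * (\<kappa> (col t) v 0 + \<kappa> (col t) v 2))
          + of_bool (b = b') * \<kappa> (col t) v 1" for \<beta>
        by (auto simp: brauer_def)
      then have "(\<Sum>\<beta><D. brauer (col t) v b \<beta> \<beta> b')
          = of_bool (b = b') * (\<kappa> (col t) v 0 + \<kappa> (col t) v 2) + of_nat D * (of_bool (b = b') * \<kappa> (col t) v 1)"
        using b by (simp only: sum.distrib sum_of_bool_mult sum_constant card_lessThan)
      then show ?thesis by (simp add: Cons False algebra_simps)
    qed
    finally show ?thesis .
  qed
  moreover have "path_sum (\<lambda>x. \<nu> ((s, e, e') # x)) w b b' = brauer s w e e' b b'"
    if e: "e < D" "e' < D" "b < D" "b' < D" for s e e' b b'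
  proof -
    define H where "H x m y = of_bool (fst m = s \<and> snd (snd m) = e) * (\<nu> y * \<nu> ((s, fst (snd m), e') # x))"
      for x y and m :: letter
    define A where "A i = (\<Sum>l<length w. of_bool (col (w ! l) = s) * \<phi> (drop (Suc l) w)
        * trans (sw (w ! l)) (\<lambda>j. \<kappa> s (take l w) j) i)" for i
    have "path_sum (\<lambda>x. \<nu> ((s, e, e') # x)) w b b'
        = of_real c * of_bool (e = e') * path_sum \<nu> w b b'
          + path_sum (\<lambda>x. \<Sum>l<length x. H (take l x) (x ! l) (drop (Suc l) x)) w b b' / of_nat D"
      unfolding limit_moment.simps(2)[of D c s e e'] H_def[symmetric]
      by (simp only: path_sum_add path_sum_scale path_sum_divide)
    also have "path_sum (\<lambda>x. \<Sum>l<length x. H (take l x) (x ! l) (drop (Suc l) x)) w b b'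
        = (\<Sum>l<length w. \<Sum>\<beta><D. \<Sum>\<beta>'<D. of_bool (col (w ! l) = s \<and> snd (snd (lab (w ! l) \<beta> \<beta>')) = e) *
          (of_bool (\<beta>' = b') * \<phi> (drop (Suc l) w) * brauer s (take l w) (fst (snd (lab (w ! l) \<beta> \<beta>'))) e' b \<beta>))"
      unfolding path_sum_split[OF e(3), of H w b']
    proof (intro sum.cong refl)
      fix l \<beta> \<beta>' assume "l \<in> {..<length w}" and \<beta>: "\<beta> \<in> {..<D}" "\<beta>' \<in> {..<D}"
      then have l: "length (take l w) < length w" "length (drop (Suc l) w) < length w" by auto
      have "fst (snd (lab (w ! l) \<beta> \<beta>')) < D" using \<beta> by (simp add: lab_def)
      then show "path_sum (\<lambda>x. path_sum (\<lambda>y. H x (lab (w ! l) \<beta> \<beta>') y) (drop (Suc l) w) \<beta>' b') (take l w) b \<beta>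
          = of_bool (col (w ! l) = s \<and> snd (snd (lab (w ! l) \<beta> \<beta>')) = e) *
          (of_bool (\<beta>' = b') * \<phi> (drop (Suc l) w) * brauer s (take l w) (fst (snd (lab (w ! l) \<beta> \<beta>'))) e' b \<beta>)"
        unfolding H_def path_sum_scale path_sum_scale_right
        using IH_phi[OF l(2), of \<beta>' b'] IH_brauer[OF l(1) _ e(2,3), of _ \<beta> s] \<beta> e(4)
        by (simp add: lab_def)
    qed
    also have "\<dots> = (\<Sum>l<length w. of_bool (col (w ! l) = s) * \<phi> (drop (Suc l) w) *
        (trans (sw (w ! l)) (\<kappa> s (take l w)) 0 * of_bool (e = e' \<and> b = b')
          + trans (sw (w ! l)) (\<kappa> s (take l w)) 1 * of_bool (b' = e \<and> b = e')
          + trans (sw (w ! l)) (\<kappa> s (take l w)) 2 * of_bool (e = b \<and> e' = b')))"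
      by (simp only: brauer_contract[OF e])
    also have "\<dots> = A 0 * of_bool (e = e' \<and> b = b') + A 1 * of_bool (b' = e \<and> b = e') + A 2 * of_bool (e = b \<and> e' = b')"
      unfolding A_def sum_distrib_right sum.distrib[symmetric]
      by (rule sum.cong[OF refl]) (simp only: distrib_left mult.assoc)
    finally have "path_sum (\<lambda>x. \<nu> ((s, e, e') # x)) w b b' = of_real c * of_bool (e = e') * (of_bool (b = b') * \<phi> w)
        + (A 0 * of_bool (e = e' \<and> b = b') + A 1 * of_bool (b' = e \<and> b = e') + A 2 * of_bool (e = b \<and> e' = b')) / of_nat D"
      by (simp only: scalar[OF e(3,4)])
    moreover have "\<kappa> s w i = of_real c * of_bool (i = 0) * \<phi> w + A i / of_nat D" for i
      unfolding A_def by (rule \<kappa>.simps)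
    ultimately show ?thesis
      unfolding brauer_def
      by (simp only: of_bool_conj distrib_right add_divide_distrib)
        (simp add: mult_ac)
  qed
  ultimately show ?case by (intro conjI allI impI)
qed

lemma path_sum_phi: "b < D \<Longrightarrow> path_sum \<nu> w b b = \<phi> w"
  using path_sum_moments[of w] by simp

section \<open>Expectations and limits of path sums\<close>

lemma valid_lab: "b < D \<Longrightarrow> b' < D \<Longrightarrow> valid_word D x \<Longrightarrow> valid_word D (lab t b b' # x)"
  by (simp add: lab_def)

lemma path_sum_integral:
  assumes "\<And>x. valid_word D x \<Longrightarrow> integrable M (\<lambda>\<omega>. h \<omega> x)" "b < D" "b' < D"
  shows "has_bochner_integral M (\<lambda>\<omega>. path_sum (h \<omega>) w b b') (path_sum (\<lambda>x. \<integral>\<omega>. h \<omega> x \<partial>M) w b b')"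
  using assms
proof (induction w arbitrary: h b)
  case Nil
  then show ?case
    unfolding path_sum.simps
    by (intro has_bochner_integral_mult_right has_bochner_integral_integrable) auto
next
  case (Cons t w)
  show ?case
    unfolding path_sum.simps
    by (intro has_bochner_integral_sum Cons.IH) (auto intro!: Cons.prems valid_lab)
qed

lemma path_sum_tendsto:
  assumes "\<And>x. valid_word D x \<Longrightarrow> (\<lambda>n. h n x) \<longlonglongrightarrow> L x" "b < D" "b' < D"
  shows "(\<lambda>n. path_sum (h n) w b b') \<longlonglongrightarrow> path_sum L w b b'"
  using assms
proof (induction w arbitrary: h L b)
  case Nil
  then show ?case
    unfolding path_sum.simps by (intro tendsto_mult tendsto_const) auto
next
  case (Cons t w)
  show ?case
    unfolding path_sum.simps by (intro tendsto_sum Cons.IH) (auto intro!: Cons.prems valid_lab)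
qed

end

context limit_law
begin

text \<open>Leaving open how \<open>\<iota>\<close> numbers the pairs of a large and a small index
  treats both orders of the tensor factors at once. The product in the large factor becomes
  \<open>lent\<close>, the one in the small factor \<open>path_sum\<close>.\<close>

lemma matrix_word_entry:
  assumes bij: "bij_betw (\<lambda>(a, b). \<iota> a b) ({..<d} \<times> {..<D}) {..<N}"
    and carrier: "\<And>i. X i \<in> carrier_mat N N"
    and entry: "\<And>i a a' b b'. a < d \<Longrightarrow> a' < d \<Longrightarrow> b < D \<Longrightarrow> b' < D \<Longrightarrow>
      X i $$ (\<iota> a b, \<iota> a' b') = label_matrices.lmat N p z (lab i b b') a a'"
  shows "matrix_word N X w \<in> carrier_mat N N"
    and "a < d \<Longrightarrow> a' < d \<Longrightarrow> b < D \<Longrightarrow> b' < D \<Longrightarrow>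
      matrix_word N X w $$ (\<iota> a b, \<iota> a' b') = path_sum (\<lambda>x. label_matrices.lent d N p z x a a') w b b'"
proof -
  have carrier_word: "matrix_word N X w \<in> carrier_mat N N" for w
  proof (induction w)
    case (Cons t w)
    then show ?case using mult_carrier_mat[OF carrier[of t]] by (simp add: matrix_word_def)
  qed (simp add: matrix_word_def)
  then show "matrix_word N X w \<in> carrier_mat N N" .
  have lt: "\<iota> a b < N" if "a < d" "b < D" for a b
    using bspec[OF bij_betwE[OF bij], of "(a, b)"] that by simp
  show "matrix_word N X w $$ (\<iota> a b, \<iota> a' b') = path_sum (\<lambda>x. label_matrices.lent d N p z x a a') w b b'"
    if "a < d" "a' < d" "b < D" "b' < D"
    using that
  proof (induction w arbitrary: a b)
    case Nil
    have "(\<iota> a b = \<iota> a' b') = (a = a' \<and> b = b')"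
      using inj_on_eq_iff[OF bij_betw_imp_inj_on[OF bij], of "(a, b)" "(a', b')"] Nil by simp
    then show ?case
      using Nil lt by (simp add: matrix_word_def label_matrices.lent.simps of_bool_def)
  next
    case (Cons t w)
    have dims: "dim_row (X t) = N" "dim_col (X t) = N"
        "dim_row (matrix_word N X w) = N" "dim_col (matrix_word N X w) = N"
      using carrier[of t] carrier_word[of w] by simp_all
    have "matrix_word N X (t # w) = X t * matrix_word N X w" by (simp add: matrix_word_def)
    then have "matrix_word N X (t # w) $$ (\<iota> a b, \<iota> a' b')
        = (\<Sum>k<N. X t $$ (\<iota> a b, k) * matrix_word N X w $$ (k, \<iota> a' b'))"
      using lt[OF Cons.prems(1,3)] lt[OF Cons.prems(2,4)] by (simp add: scalar_prod_def lessThan_atLeast0 dims)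
    also have "\<dots> = (\<Sum>(a1, \<beta>)\<in>{..<d} \<times> {..<D}. X t $$ (\<iota> a b, \<iota> a1 \<beta>) * matrix_word N X w $$ (\<iota> a1 \<beta>, \<iota> a' b'))"
      by (subst sum.reindex_bij_betw[OF bij, symmetric]) (simp add: case_prod_unfold)
    also have "\<dots> = (\<Sum>a1<d. \<Sum>\<beta><D. X t $$ (\<iota> a b, \<iota> a1 \<beta>) * matrix_word N X w $$ (\<iota> a1 \<beta>, \<iota> a' b'))"
      by (rule sum.cartesian_product[symmetric])
    also have "\<dots> = (\<Sum>\<beta><D. \<Sum>a1<d. X t $$ (\<iota> a b, \<iota> a1 \<beta>) * matrix_word N X w $$ (\<iota> a1 \<beta>, \<iota> a' b'))"
      by (rule sum.swap)
    also have "\<dots> = (\<Sum>\<beta><D. \<Sum>a1<d. label_matrices.lmat N p z (lab t b \<beta>) a a1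
        * path_sum (\<lambda>x. label_matrices.lent d N p z x a1 a') w \<beta> b')"
      using Cons.prems by (intro sum.cong refl arg_cong2[of _ _ _ _ "(*)"] entry Cons.IH) auto
    finally show ?case
      unfolding path_sum.simps label_matrices.lent.simps path_sum_sum path_sum_scale .
  qed
qed

lemma normalized_trace_matrix_word:
  assumes bij: "bij_betw (\<lambda>(a, b). \<iota> a b) ({..<d} \<times> {..<D}) {..<N}"
    and carrier: "\<And>i. X i \<in> carrier_mat N N"
    and entry: "\<And>i a a' b b'. a < d \<Longrightarrow> a' < d \<Longrightarrow> b < D \<Longrightarrow> b' < D \<Longrightarrow>
      X i $$ (\<iota> a b, \<iota> a' b') = label_matrices.lmat N p z (lab i b b') a a'"
  shows "normalized_trace (matrix_word N X w)
    = (\<Sum>b<D. path_sum (label_matrices.ltrace d N p z) w b b) / of_nat N"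
proof -
  note entries = matrix_word_entry[OF bij carrier entry, where w = w]
  have "(\<Sum>k<N. matrix_word N X w $$ (k, k)) = (\<Sum>(a, b)\<in>{..<d} \<times> {..<D}. matrix_word N X w $$ (\<iota> a b, \<iota> a b))"
    by (subst sum.reindex_bij_betw[OF bij, symmetric]) (simp add: case_prod_unfold)
  also have "\<dots> = (\<Sum>a<d. \<Sum>b<D. matrix_word N X w $$ (\<iota> a b, \<iota> a b))"
    by (rule sum.cartesian_product[symmetric])
  also have "\<dots> = (\<Sum>b<D. \<Sum>a<d. matrix_word N X w $$ (\<iota> a b, \<iota> a b))"
    by (rule sum.swap)
  also have "\<dots> = (\<Sum>b<D. \<Sum>a<d. path_sum (\<lambda>x. label_matrices.lent d N p z x a a) w b b)"
    by (intro sum.cong refl entries(2)) auto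
  also have "\<dots> = (\<Sum>b<D. path_sum (label_matrices.ltrace d N p z) w b b)"
    by (intro sum.cong refl) (simp only: label_matrices.ltrace_def[abs_def] path_sum_sum)
  finally show ?thesis
    using entries(1) by (simp add: normalized_trace_def)
qed

text \<open>The product of the two centred variables is the witness: freeness would make their
  covariance vanish, but it equals \<open>c / D\<close>.\<close>

lemma not_free_sets_Phi:
  assumes "col t1 = col t2" "\<not> sw t1" "sw t2" "c \<noteq> 0" "D > 0"
  shows "\<not> free_sets ncp_scale \<Phi> (ncp_var ` {t1}) (ncp_var ` {t2})"
proof
  assume free: "free_sets ncp_scale \<Phi> (ncp_var ` {t1}) (ncp_var ` {t2})"
  have mem: "centred (word [t]) \<in> generated_algebra ncp_scale (ncp_var ` {t})" for t
  proof -
    have "centred (word [t]) = ncp_var t + ncp_scale (- \<Phi> (word [t])) 1"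
      by (intro poly_mapping_eqI) (simp add: centred_def ncp_var_def lookup_add lookup_minus)
    then show ?thesis by (simp add: generated_algebra.intros)
  qed
  have zero: "\<Phi> (centred a) = 0" for a
    by (simp add: centred_def Phi_diff Phi_scale)
  have "\<Phi> (prod_list [centred (word [t1]), centred (word [t2])]) = 0"
    using free[unfolded free_sets_def free_family_def, rule_format,
      of "[centred (word [t1]), centred (word [t2])]" "[True, False]"] mem zero by simp
  moreover have "\<Phi> (prod_list [centred (word [t1]), centred (word [t2])]) = cent \<phi> [[t1], [t2]]"
  proof -
    have "word [] = 1" by (simp only: zero_free_monoid_def[symmetric] single_one)
    then show ?thesis using Phi_centred_words[of "[]" "[[t1], [t2]]"] by simp
  qed
  moreover have "cent \<phi> [[t1], [t2]] = \<phi> [t1, t2] - \<phi> [t1] * \<phi> [t2]"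
    by (simp del: \<phi>.simps(2))
  moreover have "\<phi> [t] = of_real c" for t
    by (simp add: \<kappa>.simps)
  \<comment> \<open>\<open>\<kappa> s []\<close> has the entries c, 0, 0. The swap in
    \<open>t2\<close> moves the contracted c to entry 2, which the unswapped \<open>t1\<close>
    weighs by 1, so that \<open>1 / D\<close> is left over; an unswapped \<open>t2\<close> would
    give entry 1 with weight \<open>D\<close>, and the covariance c.\<close>
  moreover have "\<phi> [t1, t2] = of_real c * of_real c + of_real c / of_nat D"
    using assms by (simp add: \<kappa>.simps trans_def)
  ultimately have "complex_of_real c / of_nat D = 0" by (simp del: \<phi>.simps(2))
  then show False using assms by simp
qed

end

lemma converges_in_distribution_mono:
  "converges_in_distribution M N X T \<phi> a \<Longrightarrow> S \<subseteq> T \<Longrightarrow> converges_in_distribution M N X S \<phi> a"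
  unfolding converges_in_distribution_def by (rule ballI, drule bspec, rule subsetD[OF lists_mono]) assumption+

section \<open>Convergence to the limit law\<close>

context gaussian_sequence
begin

theorem converges_to_limit_law:
  fixes col sw :: "'i \<Rightarrow> bool"
  assumes bij: "\<And>n. bij_betw (\<lambda>(a, b). \<iota> n a b) ({..<d n} \<times> {..<D}) {..<N n}"
    and N: "\<And>n. N n = d n * D"
    and carrier: "\<And>n i \<omega>. X n i \<omega> \<in> carrier_mat (N n) (N n)"
    and entry: "\<And>n i \<omega> a a' b b'. a < d n \<Longrightarrow> a' < d n \<Longrightarrow> b < D \<Longrightarrow> b' < D \<Longrightarrow>
      X n i \<omega> $$ (\<iota> n a b, \<iota> n a' b')
        = label_matrices.lmat (N n) (p n) (\<lambda>x. Z n x \<omega>) (limit_law.lab col sw i b b') a a'"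
  shows "converges_in_distribution M N X UNIV (limit_law.\<Phi> col sw D c) ncp_var"
  unfolding converges_in_distribution_def
proof (intro ballI conjI)
  interpret limit_law col sw D c .
  fix w :: "'i list"
  define T where "T n \<omega> = normalized_trace (matrix_word (N n) (\<lambda>i. X n i \<omega>) w)" for n \<omega>
  have T: "T n \<omega> = (\<Sum>b<D. path_sum (\<lambda>x. \<tau> n \<omega> [x]) w b b) / of_nat (N n)" for n \<omega>
    unfolding T_def
    by (subst normalized_trace_matrix_word[OF bij[of n] carrier entry])
      (simp_all add: \<tau>_def label_matrices.ltraces_simps N)
  have int: "has_bochner_integral (M n) (T n) ((\<Sum>b<D. path_sum (\<lambda>x. \<integral>\<omega>. \<tau> n \<omega> [x] \<partial>M n) w b b) / of_nat (N n))" for n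
    unfolding T[abs_def]
    by (intro has_bochner_integral_divide has_bochner_integral_sum path_sum_integral \<tau>_integrable) auto
  then show "\<forall>\<^sub>F n in sequentially. integrable (M n) (T n)"
    by (intro always_eventually) (auto simp: has_bochner_integral_iff)
  \<comment> \<open>Of the normalization \<open>d n * D\<close>, the factor \<open>d n\<close>
    belongs to \<open>F\<close>, and \<open>D\<close> averages over the small index at which the
    path closes.\<close>
  have F: "(\<integral>\<omega>. T n \<omega> \<partial>M n) = (\<Sum>b<D. path_sum (\<lambda>x. F n [x]) w b b) / of_nat D" for n
    unfolding has_bochner_integral_integral_eq[OF int]
    by (simp add: F_def path_sum_divide N sum_divide_distrib)
  have "(\<lambda>n. (\<Sum>b<D. path_sum (\<lambda>x. F n [x]) w b b) / of_nat D) \<longlonglongrightarrow> (\<Sum>b<D. path_sum \<nu> w b b) / of_nat D"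
    using F_tendsto[of "[_]"] D_pos
    by (intro tendsto_divide tendsto_sum path_sum_tendsto tendsto_const) auto
  moreover have "(\<Sum>b<D. path_sum \<nu> w b b) / of_nat D = \<phi> w"
    using D_pos by (simp add: path_sum_phi)
  ultimately show "(\<lambda>n. \<integral>\<omega>. T n \<omega> \<partial>M n) \<longlonglongrightarrow> \<Phi> (prod_list (map ncp_var w))"
    by (simp add: F prod_list_ncp_var)
qed

end

section \<open>Wishart matrices\<close>

lemma wishart_block_entry:
  assumes "j < d\<^sub>2" "j' < d\<^sub>2"
  shows "wishart_block d\<^sub>2 p z i i' $$ (j, j') = (\<Sum>k<p. z i j k * cnj (z i' j' k)) / of_nat d\<^sub>2"
  using assms
  by (simp add: wishart_block_def Let_def mat_adjoint_def scalar_prod_def lessThan_atLeast0 mat_of_rows_def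
    conjugate_complex_def)

lemma wishart_block_dim [simp]:
  "dim_row (wishart_block d\<^sub>2 p z i i') = d\<^sub>2" "dim_col (wishart_block d\<^sub>2 p z i i') = d\<^sub>2"
  by (simp_all add: wishart_block_def Let_def mat_adjoint_def mat_of_rows_def)

lemma wishart_carrier: "wishart d\<^sub>1 d\<^sub>2 p z t \<in> carrier_mat (d\<^sub>1 * d\<^sub>2) (d\<^sub>1 * d\<^sub>2)"
  by (cases t) (simp_all add: block_matrix_def)

lemma block_index_less: "i < d\<^sub>1 \<Longrightarrow> j < d\<^sub>2 \<Longrightarrow> i * d\<^sub>2 + j < d\<^sub>1 * (d\<^sub>2 :: nat)"
  using mult_le_mono1[of "Suc i" d\<^sub>1 d\<^sub>2] by simp

lemma bij_betw_block_index: "bij_betw (\<lambda>(i, j). i * d\<^sub>2 + j) ({..<d\<^sub>1} \<times> {..<d\<^sub>2}) {..<d\<^sub>1 * d\<^sub>2 :: nat}"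
  by (rule bij_betw_byWitness[where f' = "\<lambda>r. (r div d\<^sub>2, r mod d\<^sub>2)"])
    (auto simp: block_index_less less_mult_imp_div_less intro!: mod_less_divisor gr0I)

definition fst_swapped :: "transposition \<Rightarrow> bool" where
  "fst_swapped t \<longleftrightarrow> t \<in> {LeftT, FullT}"

definition snd_swapped :: "transposition \<Rightarrow> bool" where
  "snd_swapped t \<longleftrightarrow> t \<in> {RightT, FullT}"

lemma wishart_entry:
  assumes "i < d\<^sub>1" "i' < d\<^sub>1" "j < d\<^sub>2" "j' < d\<^sub>2"
  shows "wishart d\<^sub>1 d\<^sub>2 p z t $$ (i * d\<^sub>2 + j, i' * d\<^sub>2 + j') =
    (\<Sum>k<p. z (if fst_swapped t then i' else i) (if snd_swapped t then j' else j) k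
      * cnj (z (if fst_swapped t then i else i') (if snd_swapped t then j else j') k)) / of_nat (d\<^sub>1 * d\<^sub>2)"
proof -
  have "block_matrix d\<^sub>1 d\<^sub>2 B $$ (i * d\<^sub>2 + j, i' * d\<^sub>2 + j') = B i i' $$ (j, j')" for B :: "nat \<Rightarrow> nat \<Rightarrow> complex mat"
    using assms by (simp add: block_matrix_def block_index_less)
  moreover have "dim_row (block_matrix d\<^sub>1 d\<^sub>2 B) = d\<^sub>1 * d\<^sub>2" "dim_col (block_matrix d\<^sub>1 d\<^sub>2 B) = d\<^sub>1 * d\<^sub>2"
    for B :: "nat \<Rightarrow> nat \<Rightarrow> complex mat"
    by (simp_all add: block_matrix_def)
  ultimately show ?thesis
    using assms
    by (cases t) (simp_all add: block_index_less wishart_block_entry fst_swapped_def snd_swapped_def)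
qed

text \<open>\<open>S\<close> is the transposition of the small factor and \<open>T\<close> that of
  the large one. The swapped variables are the two partial transposes in either case: the full
  transpose is the entrywise conjugate of \<open>W\<close>, and a conjugated letter with its small
  indices in the original order already has both factors transposed.\<close>

lemma wishart_asymptotics:
  fixes M :: "nat \<Rightarrow> 'w measure"
  assumes seq: "gaussian_sequence M Z d p D c" and c: "c > 0"
    and bij: "\<And>n. bij_betw (\<lambda>(a, b). \<iota> n a b) ({..<d n} \<times> {..<D}) {..<N n}"
    and N: "\<And>n. N n = d n * D"
    and carrier: "\<And>n t \<omega>. W n t \<omega> \<in> carrier_mat (N n) (N n)"
    and entry: "\<And>n t \<omega> a a' b b'. a < d n \<Longrightarrow> a' < d n \<Longrightarrow> b < D \<Longrightarrow> b' < D \<Longrightarrow>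
      W n t \<omega> $$ (\<iota> n a b, \<iota> n a' b')
        = label_matrices.lmat (N n) (p n) (\<lambda>x. Z n x \<omega>)
            (limit_law.lab (\<lambda>t. t \<in> {NoT, S}) (\<lambda>t. t \<in> {LeftT, RightT}) t b b') a a'"
    and ST: "{S, T} = {LeftT, RightT}"
  shows "asymptotically_free M N W {NoT, S} {FullT, T}"
    and "\<not> asymptotically_free M N W {NoT} {S}"
    and "\<not> asymptotically_free M N W {FullT} {T}"
proof -
  interpret gaussian_sequence M Z d p D c by (rule seq)
  interpret limit_law "\<lambda>t. t \<in> {NoT, S}" "\<lambda>t. t \<in> {LeftT, RightT}" D c .
  have "converges_in_distribution M N W UNIV \<Phi> ncp_var"
    by (rule converges_to_limit_law[where \<iota> = \<iota>, OF bij N carrier entry])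
  then have conv: "converges_in_distribution M N W I \<Phi> ncp_var" for I
    by (rule converges_in_distribution_mono) simp
  have "{t. t \<in> {NoT, S}} = {NoT, S}" "{t. t \<notin> {NoT, S}} = {FullT, T}"
  proof -
    have "S = LeftT \<and> T = RightT \<or> S = RightT \<and> T = LeftT"
      using ST by (simp add: doubleton_eq_iff)
    then have "t \<notin> {NoT, S} \<longleftrightarrow> t \<in> {FullT, T}" for t
      by (cases t) auto
    then show "{t. t \<notin> {NoT, S}} = {FullT, T}"
      by (simp add: set_eq_iff)
  qed auto
  then have "free_sets ncp_scale \<Phi> (ncp_var ` {NoT, S}) (ncp_var ` {FullT, T})"
    using free_sets_Phi by simp
  then show "asymptotically_free M N W {NoT, S} {FullT, T}"
    by (simp only: asymptotically_free_iff[OF nc_prob_space_Phi conv])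
  have "S = LeftT \<and> T = RightT \<or> S = RightT \<and> T = LeftT"
    using ST by (simp add: doubleton_eq_iff)
  then have "\<not> free_sets ncp_scale \<Phi> (ncp_var ` {NoT}) (ncp_var ` {S})"
    "\<not> free_sets ncp_scale \<Phi> (ncp_var ` {FullT}) (ncp_var ` {T})"
    using c D_pos by (elim disjE conjE; intro not_free_sets_Phi; simp)+
  then show "\<not> asymptotically_free M N W {NoT} {S}" "\<not> asymptotically_free M N W {FullT} {T}"
    by (simp_all only: asymptotically_free_iff[OF nc_prob_space_Phi conv] not_False_eq_True)
qed

theorem theorem43:
  fixes M :: "nat \<Rightarrow> 'w measure"
    and g :: "nat \<Rightarrow> nat \<Rightarrow> nat \<Rightarrow> nat \<Rightarrow> 'w \<Rightarrow> complex"
    and d\<^sub>1 d\<^sub>2 p :: "nat \<Rightarrow> nat"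
    and c :: real
  defines "N \<equiv> (\<lambda>n. d\<^sub>1 n * d\<^sub>2 n)"
    and "W \<equiv> (\<lambda>n t \<omega>. wishart (d\<^sub>1 n) (d\<^sub>2 n) (p n) (\<lambda>i j k. g n i j k \<omega>) t)"
  assumes "0 < c"
    and "\<And>n. independent_gaussian_entries (M n) (d\<^sub>1 n) (d\<^sub>2 n) (p n) (g n)"
    and "(\<lambda>n. real (p n) / (real (d\<^sub>1 n) * real (d\<^sub>2 n))) \<longlonglongrightarrow> c"
  shows
    "(filterlim d\<^sub>1 at_top sequentially \<and> (\<exists>D. \<forall>n. d\<^sub>2 n = D) \<longrightarrow>
        asymptotically_free M N W {NoT, RightT} {FullT, LeftT} \<and>
        \<not> asymptotically_free M N W {NoT} {RightT} \<and>
        \<not> asymptotically_free M N W {FullT} {LeftT}) \<and>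
     ((\<exists>D. \<forall>n. d\<^sub>1 n = D) \<and> filterlim d\<^sub>2 at_top sequentially \<longrightarrow>
        asymptotically_free M N W {NoT, LeftT} {FullT, RightT} \<and>
        \<not> asymptotically_free M N W {NoT} {LeftT} \<and>
        \<not> asymptotically_free M N W {FullT} {RightT})"
proof -
  have gauss: "gaussian_config (M n) ({..<d\<^sub>1 n} \<times> {..<d\<^sub>2 n} \<times> {..<p n}) (\<lambda>(i, j, k). g n i j k)" for n
  proof -
    note ind = assms(4)[of n, unfolded independent_gaussian_entries_def]
    interpret prob_space "M n" using ind by blast
    show ?thesis using ind by (intro gaussian_configI) auto
  qed
  have carrier: "W n t \<omega> \<in> carrier_mat (N n) (N n)" for n t \<omega>
    unfolding W_def N_def by (rule wishart_carrier)
  have c: "c > 0" by fact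
  \<comment> \<open>If \<open>D\<close> were 0, division by zero would make the ratio constantly 0,
    contrary to its limit \<open>c > 0\<close>.\<close>
  have fixed_pos: "D > 0" if "\<And>n. d\<^sub>2 n = D \<or> d\<^sub>1 n = D" for D
  proof (rule ccontr)
    assume "\<not> D > 0"
    then have "(\<lambda>n. real (p n) / (real (d\<^sub>1 n) * real (d\<^sub>2 n))) = (\<lambda>n. 0)"
      using that by (metis div_by_0 gr0I mult_zero_left mult_zero_right of_nat_0)
    then show False using assms(5) c LIMSEQ_unique[OF _ tendsto_const] by fastforce
  qed
  show ?thesis
  proof (intro conjI impI; elim conjE exE)
    fix D assume d: "filterlim d\<^sub>1 at_top sequentially" and D: "\<forall>n. d\<^sub>2 n = D"
    define Z where "Z n = (\<lambda>(i, j, k). g n i j k)" for n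
    have seq: "gaussian_sequence M Z d\<^sub>1 p D c"
      using gauss d assms(5) fixed_pos[of D] D by unfold_locales (auto simp: Z_def)
    have bij: "bij_betw (\<lambda>(a, b). a * D + b) ({..<d\<^sub>1 n} \<times> {..<D}) {..<N n}" for n
      unfolding N_def D[rule_format] by (rule bij_betw_block_index)
    have entry: "W n t \<omega> $$ (a * D + b, a' * D + b')
        = label_matrices.lmat (N n) (p n) (\<lambda>x. Z n x \<omega>)
            (limit_law.lab (\<lambda>t. t \<in> {NoT, RightT}) (\<lambda>t. t \<in> {LeftT, RightT}) t b b') a a'"
      if "a < d\<^sub>1 n" "a' < d\<^sub>1 n" "b < D" "b' < D" for n t \<omega> a a' b b'
      using that D wishart_entry[of a "d\<^sub>1 n" a' b D b' "p n" "\<lambda>i j k. g n i j k \<omega>" t]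
      by (cases t) (simp_all add: W_def N_def Z_def label_matrices.lmat_def limit_law.lab_def
        fst_swapped_def snd_swapped_def mult.commute)
    have N: "N n = d\<^sub>1 n * D" for n using D by (simp add: N_def)
    note result = wishart_asymptotics[OF seq c bij N carrier entry, of LeftT]
    show "asymptotically_free M N W {NoT, RightT} {FullT, LeftT}"
      "\<not> asymptotically_free M N W {NoT} {RightT}" "\<not> asymptotically_free M N W {FullT} {LeftT}"
      by (rule result; auto)+
  next
    fix D assume d: "filterlim d\<^sub>2 at_top sequentially" and D: "\<forall>n. d\<^sub>1 n = D"
    \<comment> \<open>The second tensor factor is now the large one, so its index is moved to the
      front.\<close>
    define Z where "Z n = (\<lambda>(i, j, k). g n j i k)" for n
    have "gaussian_config (M n) ({..<d\<^sub>2 n} \<times> {..<D} \<times> {..<p n}) (Z n)" for n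
    proof -
      have "bij_betw (\<lambda>(j, i, k). (i, j, k)) ({..<d\<^sub>2 n} \<times> {..<D} \<times> {..<p n}) ({..<d\<^sub>1 n} \<times> {..<d\<^sub>2 n} \<times> {..<p n})"
        by (rule bij_betw_byWitness[where f' = "\<lambda>(i, j, k). (j, i, k)"]) (use D in auto)
      from gaussian_config_reindex[OF gauss this] show ?thesis
        by (simp add: Z_def case_prod_unfold)
    qed
    then have seq: "gaussian_sequence M Z d\<^sub>2 p D c"
      using d assms(5) fixed_pos[of D] D by unfold_locales (auto simp: mult.commute)
    have N: "N n = d\<^sub>2 n * D" for n using D by (simp add: N_def)
    have bij: "bij_betw (\<lambda>(a, b). b * d\<^sub>2 n + a) ({..<d\<^sub>2 n} \<times> {..<D}) {..<N n}" for n
    proof -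
      have "bij_betw prod.swap ({..<d\<^sub>2 n} \<times> {..<D}) ({..<D} \<times> {..<d\<^sub>2 n})"
        by (rule bij_betw_byWitness[where f' = prod.swap]) auto
      from bij_betw_trans[OF this bij_betw_block_index] show ?thesis
        by (simp add: N mult.commute[of "d\<^sub>2 n"] o_def case_prod_unfold)
    qed
    have entry: "W n t \<omega> $$ (b * d\<^sub>2 n + a, b' * d\<^sub>2 n + a')
        = label_matrices.lmat (N n) (p n) (\<lambda>x. Z n x \<omega>)
            (limit_law.lab (\<lambda>t. t \<in> {NoT, LeftT}) (\<lambda>t. t \<in> {LeftT, RightT}) t b b') a a'"
      if "a < d\<^sub>2 n" "a' < d\<^sub>2 n" "b < D" "b' < D" for n t \<omega> a a' b b'
      using that D wishart_entry[of b D b' a "d\<^sub>2 n" a' "p n" "\<lambda>i j k. g n i j k \<omega>" t]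
      by (cases t) (simp_all add: W_def N_def Z_def label_matrices.lmat_def limit_law.lab_def
        fst_swapped_def snd_swapped_def mult.commute)
    note result = wishart_asymptotics[OF seq c bij N carrier entry, of RightT]
    show "asymptotically_free M N W {NoT, LeftT} {FullT, RightT}"
      "\<not> asymptotically_free M N W {NoT} {LeftT}" "\<not> asymptotically_free M N W {FullT} {RightT}"
      by (rule result; auto)+
  qed
qed

end
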